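(* For every admissible transport cost $\tau:[0,\infty)\to[0,\infty)$ there exists a phase field cost $c:[0,\infty)\to[0,\infty)$ such that for all $w\geq0$ $$\tau(w)=\inf\left\{F^c[\psi]\,\middle|\,\psi:\mathbb{R}\to\mathbb{R},\ \int_{\mathbb{R}}\psi\,dy=w\right\}.$$ Furthermore, $c$ can be chosen such that the mass-specific phase field cost $\phi\mapsto z(\phi)=c(\phi)/\phi$ is lower semi-continuous and nonincreasing.
   Context: A transport cost $\tau:[0,\infty)\to[0,\infty)$ is admissible if it is nondecreasing, concave and continuous with $\tau(0)=0$. For $c:[0,\infty)\to[0,\infty)$ and $\psi:\mathbb{R}\to\mathbb{R}$ (with locally integrable weak derivative; otherwise the energy is $+\infty$), $F^c[\psi]=\int_{\mathbb{R}}\frac12|\psi'(y)|^2+c(|\psi(y)|)\,dy$. *)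

theory Defs
  imports "HOL-Analysis.Analysis"
begin

definition admissible_cost :: "(real \<Rightarrow> real) \<Rightarrow> bool" where
  "admissible_cost \<tau> \<longleftrightarrow>
     (\<forall>w\<ge>0. \<tau> w \<ge> 0) \<and> mono_on {0..} \<tau> \<and> concave_on {0..} \<tau> \<and>
     continuous_on {0..} \<tau> \<and> \<tau> 0 = 0"

definition smooth_fun :: "(real \<Rightarrow> real) \<Rightarrow> bool" where
  "smooth_fun \<phi> \<longleftrightarrow> (\<forall>k x. ((deriv ^^ k) \<phi>) differentiable (at x))"

definition test_fun :: "(real \<Rightarrow> real) \<Rightarrow> bool" where
  "test_fun \<phi> \<longleftrightarrow> smooth_fun \<phi> \<and> (\<exists>R. \<forall>x. \<bar>x\<bar> > R \<longrightarrow> \<phi> x = 0)"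

definition locally_integrable :: "(real \<Rightarrow> real) \<Rightarrow> bool" where
  "locally_integrable f \<longleftrightarrow> f \<in> borel_measurable lborel \<and>
     (\<forall>a b. set_integrable lborel {a..b} f)"

definition weak_deriv :: "(real \<Rightarrow> real) \<Rightarrow> (real \<Rightarrow> real) \<Rightarrow> bool" where
  "weak_deriv \<psi> g \<longleftrightarrow> locally_integrable \<psi> \<and> locally_integrable g \<and>
     (\<forall>\<phi>. test_fun \<phi> \<longrightarrow>
        (\<integral>y. \<psi> y * deriv \<phi> y \<partial>lborel) = - (\<integral>y. g y * \<phi> y \<partial>lborel))"

text \<open>Phase field energy; +infinity if psi has no locally integrable weak derivative.
  The value does not depend on the choice of weak derivative (unique a.e.).\<close>
definition energy :: "(real \<Rightarrow> real) \<Rightarrow> (real \<Rightarrow> real) \<Rightarrow> ennreal" where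
  "energy c \<psi> =
     (if \<exists>g. weak_deriv \<psi> g
      then (let g = (SOME g. weak_deriv \<psi> g) in
            \<integral>\<^sup>+ y. ennreal ((1/2) * (g y)\<^sup>2 + c \<bar>\<psi> y\<bar>) \<partial>lborel)
      else top)"

definition lsc_on :: "real set \<Rightarrow> (real \<Rightarrow> real) \<Rightarrow> bool" where
  "lsc_on S f \<longleftrightarrow> (\<forall>x\<in>S. \<forall>a. a < f x \<longrightarrow>
      (\<exists>e>0. \<forall>y\<in>S. \<bar>y - x\<bar> < e \<longrightarrow> a < f y))"

end

theory Submission
  imports Defs
begin

text \<open>
  Write \<open>\<tau>(w)\<close> as the integral of a nonincreasing density \<open>p\<close> over \<open>(0, w)\<close>, and let
  \<open>G(l)\<close> be the integral of the positive part of \<open>p - l\<close>, so that \<open>\<tau>(w)\<close> is the minimum over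
  \<open>l\<close> of \<open>G(l) + l w\<close>, attained at \<open>l = p(w)\<close>. With a Lagrange multiplier \<open>l\<close> for the mass
  constraint, an optimal profile for the cost \<open>c(f) = f z(f)\<close> satisfies \<open>\<psi>'^2 / 2 = \<psi> (z(\<psi>) - l)\<close>, and
  its energy is \<open>l w\<close> plus twice the integral of \<open>sqrt (2 f (z(f) - l))\<close> over the heights \<open>f\<close>
  with \<open>z(f) > l\<close>. Requiring this integral to equal \<open>G(l)\<close> for every \<open>l\<close> is an Abel integral
  equation for the inverse function of \<open>z\<close>; its solution says that \<open>z(f) > s\<close> iff
  \<open>f^(3/2)\<close> is smaller than a constant times the integral of \<open>sqrt (p - s)\<close> over \<open>{p > s}\<close>.

  Lower bound: given \<open>\<psi>\<close>, take for \<open>l\<close> the infimum of \<open>z(|\<psi>|)\<close>, use \<open>a^2/2 + b^2/2 \<ge> a b\<close> pointwise and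
  the fact that the continuous representative of \<open>\<psi>\<close> crosses every height below its supremum at least twice.
  Upper bound: run the profile for \<open>l = p(w)\<close> up to the height where \<open>z\<close> falls to \<open>l + d\<close>. Its
  mass is at most \<open>w\<close>, and a plateau at that height supplies the missing mass at cost at most
  \<open>l + d\<close> per unit.
\<close>

section \<open>Weak derivatives on the line\<close>

text \<open>The exponent 3/2: let F be the inverse function of \<open>z\<close>. The layer-cake
  formula for sqrt(z - l), and the integral (2/3) F(s)^(3/2) of the square root over heights below
  F(s), turn the requirement into: G(l) is 2 sqrt(2) / 3 times the integral of F(s)^(3/2) / sqrt(s -
  l) over s > l. Inverting an Abel equation usually costs a derivative. Here none is taken, because
  the positive part of p(w) - l is, up to the factor Beta(1/2, 3/2), the integral of sqrt(p(w) - s)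
  / sqrt(s - l) over l < s < p(w); so F^(3/2) is read off separately for each w and comes out
  nonnegative and nonincreasing. Low regularity shapes the rest. A competitor has only a weak
  derivative and may change sign, so its continuous representative has to be recovered, and the
  lower bound compares superlevel sets instead of changing variables. The speed of a profile is only
  measurable, so profiles are quantile functions instead of solutions of a differential equation.
  Stopping at \<open>l + d\<close> bounds the speed from below and the mass by a difference quotient
  of \<open>G\<close>, so that \<open>G\<close> is never differentiated.\<close>

lemma has_real_derivative_zero_of_quadratic_bound:
  fixes f :: "real \<Rightarrow> real"
  assumes "\<And>x. \<bar>f x\<bar> \<le> C * (x - a)\<^sup>2"
  shows "(f has_real_derivative 0) (at a)"
proof -
  have fa: "f a = 0" using assms[of a] by simp
  have "((\<lambda>x. C * \<bar>x - a\<bar>) \<longlongrightarrow> C * \<bar>a - a\<bar>) (at a)"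
    by (intro tendsto_intros)
  then have lim: "((\<lambda>x. C * \<bar>x - a\<bar>) \<longlongrightarrow> 0) (at a)" by simp
  have "\<forall>\<^sub>F x in at a. norm ((f x - f a) / (x - a)) \<le> C * \<bar>x - a\<bar>"
    unfolding eventually_at
  proof (intro exI[of _ 1] conjI ballI impI)
    fix x :: real assume "x \<noteq> a \<and> dist x a < 1"
    then have "x \<noteq> a" by simp
    then have "\<bar>f x\<bar> / \<bar>x - a\<bar> \<le> C * (x - a)\<^sup>2 / \<bar>x - a\<bar>"
      using assms[of x] by (intro divide_right_mono) auto
    also have "\<dots> = C * \<bar>x - a\<bar>"
      using \<open>x \<noteq> a\<close> by (simp add: field_simps flip: power2_eq_square)
    finally show "norm ((f x - f a) / (x - a)) \<le> C * \<bar>x - a\<bar>"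
      by (simp add: fa)
  qed simp
  then have "((\<lambda>x. (f x - f a) / (x - a)) \<longlongrightarrow> 0) (at a)"
    by (rule Lim_null_comparison) (rule lim)
  then show ?thesis by (simp add: has_field_derivative_iff)
qed

text \<open>A single term of the exponential series bounds \<open>exp (k / q)\<close> from below;
  take reciprocals. With \<open>n\<close> two larger than the order of a pole in \<open>q\<close>,
  the pole is absorbed and two powers of \<open>q\<close> remain.\<close>

lemma exp_neg_inverse_le_power:
  fixes q k :: real
  assumes "q > 0" "k > 0"
  shows "exp (- k / q) \<le> fact n * (q / k) ^ n"
proof -
  have pos: "0 < k / q" using assms by simp
  have "(k / q) ^ n / fact n \<le> exp (k / q)"
  proof -
    have "(\<lambda>j. (k / q) ^ j /\<^sub>R fact j) sums exp (k / q)" by (rule exp_converges)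
    then have "(\<Sum>j\<in>{n}. (k / q) ^ j /\<^sub>R fact j) \<le> exp (k / q)"
      using pos by (intro sum_le_suminf[of "\<lambda>j. (k / q) ^ j /\<^sub>R fact j" "{n}", unfolded sums_unique[symmetric, OF \<open>_ sums _\<close>]])
        (auto simp: sums_iff)
    then show ?thesis by (simp add: field_simps)
  qed
  then have "exp (- (k / q)) \<le> inverse ((k / q) ^ n / fact n)"
    unfolding exp_minus using pos by (intro le_imp_inverse_le) auto
  then show ?thesis by (simp add: field_simps power_divide)
qed

text \<open>The prefactor \<open>P / ((x - a) (b - x))^k\<close> makes the family closed under differentiation.\<close>

definition bump :: "real \<Rightarrow> real \<Rightarrow> real \<Rightarrow> real poly \<Rightarrow> nat \<Rightarrow> real \<Rightarrow> real" where
  "bump a b \<kappa> P k x = (if a < x \<and> x < b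
     then poly P x / ((x - a) * (b - x)) ^ k * exp (- \<kappa> / ((x - a) * (b - x))) else 0)"

text \<open>On the interval the function is at most a multiple of the square of
  \<open>(x - a) * (b - x)\<close>, and either factor is at most \<open>b - a\<close>. This flatness
  yields the vanishing derivative at both end points.\<close>

lemma bump_quadratic_bound:
  assumes "a < b" "\<kappa> > 0"
  obtains C where "\<And>x. \<bar>bump a b \<kappa> P k x\<bar> \<le> C * (x - a)\<^sup>2" "\<And>x. \<bar>bump a b \<kappa> P k x\<bar> \<le> C * (x - b)\<^sup>2"
proof -
  have "bounded (poly P ` {a..b})"
    by (intro compact_imp_bounded compact_continuous_image continuous_intros) auto
  then obtain M where M: "\<And>x. x \<in> {a..b} \<Longrightarrow> \<bar>poly P x\<bar> \<le> M"
    unfolding bounded_iff by (auto simp del: atLeastAtMost_iff)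
  have M0: "0 \<le> M" using M[of a] assms by auto
  define D where "D = M * (fact (k + 2) / \<kappa> ^ (k + 2))"
  have D0: "D \<ge> 0" using M0 assms by (auto simp: D_def)
  have *: "\<bar>bump a b \<kappa> P k x\<bar> \<le> D * ((x - a) * (b - x))\<^sup>2" if "a < x" "x < b" for x
  proof -
    define q where "q = (x - a) * (b - x)"
    have q: "q > 0" using that by (simp add: q_def)
    have "\<bar>bump a b \<kappa> P k x\<bar> = \<bar>poly P x\<bar> * (exp (- \<kappa> / q) / q ^ k)"
      using that q by (simp add: bump_def abs_mult flip: q_def)
    also have "\<dots> \<le> M * ((fact (k + 2) * (q / \<kappa>) ^ (k + 2)) / q ^ k)"
      using q M[of x] that M0 assms
      by (intro mult_mono divide_right_mono exp_neg_inverse_le_power) auto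
    also have "\<dots> = D * q\<^sup>2"
      using q assms by (simp add: D_def field_simps power_add power2_eq_square)
    finally show ?thesis by (simp add: q_def)
  qed
  define C where "C = D * (b - a)\<^sup>2"
  have C0: "C \<ge> 0" using D0 by (simp add: C_def)
  show thesis
  proof (rule that[of C])
    fix x
    show "\<bar>bump a b \<kappa> P k x\<bar> \<le> C * (x - a)\<^sup>2"
    proof (cases "a < x \<and> x < b")
      case True
      have "D * ((x - a) * (b - x))\<^sup>2 \<le> D * ((x - a) * (b - a))\<^sup>2"
        using True D0 by (intro mult_left_mono power_mono) auto
      also have "\<dots> = C * (x - a)\<^sup>2" by (simp add: C_def power_mult_distrib)
      finally show ?thesis using *[of x] True by simp
    qed (use C0 in \<open>auto simp: bump_def\<close>)
    show "\<bar>bump a b \<kappa> P k x\<bar> \<le> C * (x - b)\<^sup>2"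
    proof (cases "a < x \<and> x < b")
      case True
      have "D * ((x - a) * (b - x))\<^sup>2 \<le> D * ((b - a) * (b - x))\<^sup>2"
        using True D0 by (intro mult_left_mono power_mono mult_right_mono) auto
      also have "\<dots> = C * (x - b)\<^sup>2" by (simp add: C_def power_mult_distrib power2_commute[of x b])
      finally show ?thesis using *[of x] True by simp
    qed (use C0 in \<open>auto simp: bump_def\<close>)
  qed
qed

text \<open>Inside the interval this is the quotient rule over the common denominator Q^(k + 2); at
  \<open>a\<close> and \<open>b\<close> the quadratic bound gives derivative 0, which is also the
  value of the new bump there.\<close>

lemma bump_has_derivative:
  assumes "a < b" "\<kappa> > 0"
  defines "Q \<equiv> [:-a, 1:] * [:b, -1:]"
  shows "(bump a b \<kappa> P k has_real_derivative
     bump a b \<kappa> (pderiv P * Q\<^sup>2 - smult (real k) (P * pderiv Q * Q) + smult \<kappa> (pderiv Q * P)) (k + 2) x) (at x)"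
    (is "(_ has_real_derivative bump a b \<kappa> ?P' _ x) _")
proof -
  have Q: "poly Q y = (y - a) * (b - y)" for y by (simp add: Q_def algebra_simps)
  consider "x < a" | "x = a" | "a < x" "x < b" | "x = b" | "b < x" by linarith
  then show ?thesis
  proof cases
    case 1
    have "((\<lambda>x. 0) has_real_derivative 0) (at x)" by simp
    then have "(bump a b \<kappa> P k has_real_derivative 0) (at x)"
      by (rule has_field_derivative_transform_within_open[where S = "{..<a}"]) (use 1 in \<open>auto simp: bump_def\<close>)
    then show ?thesis using 1 by (simp add: bump_def)
  next
    case 5
    have "((\<lambda>x. 0) has_real_derivative 0) (at x)" by simp
    then have "(bump a b \<kappa> P k has_real_derivative 0) (at x)"
      by (rule has_field_derivative_transform_within_open[where S = "{b<..}"]) (use 5 in \<open>auto simp: bump_def\<close>)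
    then show ?thesis using 5 by (simp add: bump_def)
  next
    case 2
    obtain C where "\<And>x. \<bar>bump a b \<kappa> P k x\<bar> \<le> C * (x - a)\<^sup>2"
      using bump_quadratic_bound[OF assms(1,2)] by metis
    then have "(bump a b \<kappa> P k has_real_derivative 0) (at a)"
      by (rule has_real_derivative_zero_of_quadratic_bound)
    then show ?thesis using 2 by (simp add: bump_def[of _ _ _ _ _ a])
  next
    case 4
    obtain C where "\<And>x. \<bar>bump a b \<kappa> P k x\<bar> \<le> C * (x - b)\<^sup>2"
      using bump_quadratic_bound[OF assms(1,2)] by metis
    then have "(bump a b \<kappa> P k has_real_derivative 0) (at b)"
      by (rule has_real_derivative_zero_of_quadratic_bound)
    then show ?thesis using 4 by (simp add: bump_def[of _ _ _ _ _ b])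
  next
    case 3
    have q: "poly Q x > 0" using 3 by (simp add: Q)
    have "((\<lambda>x. poly P x / poly Q x ^ k * exp (- \<kappa> / poly Q x)) has_real_derivative
       (poly (pderiv P) x * poly Q x ^ k - poly P x * (real k * poly (pderiv Q) x * poly Q x ^ (k - 1))) / (poly Q x ^ k)\<^sup>2
         * exp (- \<kappa> / poly Q x) + poly P x / poly Q x ^ k * (exp (- \<kappa> / poly Q x) * (\<kappa> * poly (pderiv Q) x / (poly Q x)\<^sup>2))) (at x)"
      using q by (auto intro!: derivative_eq_intros simp: power2_eq_square field_simps)
    also have "(poly (pderiv P) x * poly Q x ^ k - poly P x * (real k * poly (pderiv Q) x * poly Q x ^ (k - 1))) / (poly Q x ^ k)\<^sup>2
         * exp (- \<kappa> / poly Q x) + poly P x / poly Q x ^ k * (exp (- \<kappa> / poly Q x) * (\<kappa> * poly (pderiv Q) x / (poly Q x)\<^sup>2))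
      = poly ?P' x / poly Q x ^ (k + 2) * exp (- \<kappa> / poly Q x)"
      using q by (cases k) (auto simp: field_simps power2_eq_square power_add)
    also have "\<dots> = bump a b \<kappa> ?P' (k + 2) x"
      using 3 by (simp add: bump_def Q)
    finally show ?thesis
      by (rule has_field_derivative_transform_within_open[where S = "{a<..<b}"]) (use 3 in \<open>auto simp: bump_def Q\<close>)
  qed
qed

lemma smooth_fun_bump:
  assumes "a < b" "\<kappa> > 0"
  shows "smooth_fun (bump a b \<kappa> P k)"
proof -
  have "((deriv ^^ j) (bump a b \<kappa> P k)) differentiable (at x)" for j x P k
  proof (induction j arbitrary: P k)
    case 0
    then show ?case
      using bump_has_derivative[OF assms, of P k x] by (auto simp: real_differentiable_def)
  next
    case (Suc j)
    obtain P' k' where "deriv (bump a b \<kappa> P k) = bump a b \<kappa> P' k'"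
      using DERIV_imp_deriv[OF bump_has_derivative[OF assms, of P k]] by blast
    then show ?case using Suc by (simp add: funpow_Suc_right del: funpow.simps)
  qed
  then show ?thesis by (auto simp: smooth_fun_def)
qed

lemma smooth_fun_diff:
  assumes "smooth_fun f" "smooth_fun g"
  shows "smooth_fun (\<lambda>x. f x - g x)"
proof -
  have *: "(deriv ^^ k) (\<lambda>x. f x - g x) = (\<lambda>x. (deriv ^^ k) f x - (deriv ^^ k) g x)" for k
  proof (induction k)
    case (Suc k)
    have "deriv (\<lambda>x. (deriv ^^ k) f x - (deriv ^^ k) g x) x = deriv ((deriv ^^ k) f) x - deriv ((deriv ^^ k) g) x" for x
      using assms by (intro deriv_diff) (auto simp: smooth_fun_def field_differentiable_def real_differentiable_def)
    then show ?case using Suc by auto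
  qed simp
  show ?thesis using assms unfolding smooth_fun_def * by (auto intro: differentiable_diff)
qed

lemma smooth_fun_antiderivative:
  assumes "smooth_fun f" "\<And>x. (F has_real_derivative f x) (at x)"
  shows "smooth_fun F"
proof -
  have dF: "deriv F = f" using assms(2) DERIV_imp_deriv by blast
  have "((deriv ^^ k) F) differentiable (at x)" for k x
  proof (cases k)
    case 0
    then show ?thesis using assms(2) by (auto simp: real_differentiable_def)
  next
    case (Suc j)
    then show ?thesis using assms(1) by (simp add: funpow_Suc_right dF smooth_fun_def del: funpow.simps)
  qed
  then show ?thesis by (simp add: smooth_fun_def)
qed

lemma smooth_fun_deriv: "smooth_fun f \<Longrightarrow> smooth_fun (deriv f)"
  unfolding smooth_fun_def by (metis funpow_Suc_right comp_apply)

lemma smooth_fun_has_derivative: "smooth_fun f \<Longrightarrow> (f has_real_derivative deriv f x) (at x)"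
  unfolding smooth_fun_def
  by (metis DERIV_deriv_iff_real_differentiable funpow_0)

lemma smooth_fun_continuous: "smooth_fun f \<Longrightarrow> continuous_on A f"
  by (intro continuous_at_imp_continuous_on ballI DERIV_isCont[OF smooth_fun_has_derivative])

text \<open>As \<kappa> = 1/(n + 1) tends to 0, the exponential tends to 1 inside the interval.
  These smooth functions stay below the indicator and converge to it, so dominated convergence
  passes from test functions to intervals without mollification.\<close>

abbreviation bump0 :: "real \<Rightarrow> real \<Rightarrow> nat \<Rightarrow> real \<Rightarrow> real" where
  "bump0 a b n \<equiv> bump a b (1 / real (Suc n)) 1 0"

lemma bump0_bounds: "0 \<le> bump0 a b n x" "bump0 a b n x \<le> indicator {a<..<b} x"
  by (auto simp: bump_def indicator_def)

lemma bump0_tendsto: "(\<lambda>n. bump0 a b n x) \<longlonglongrightarrow> indicator {a<..<b} x"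
proof (cases "a < x \<and> x < b")
  case True
  have "(\<lambda>n. exp (- (1 / real (Suc n)) / ((x - a) * (b - x)))) \<longlonglongrightarrow> exp (- 0 / ((x - a) * (b - x)))"
    using True LIMSEQ_inverse_real_of_nat by (intro tendsto_intros) (auto simp: inverse_eq_divide)
  then show ?thesis using True by (simp add: bump_def)
qed (auto simp: bump_def indicator_def)

lemma bump0_measurable [measurable]: "a < b \<Longrightarrow> bump0 a b n \<in> borel_measurable borel"
  by (intro borel_measurable_continuous_onI smooth_fun_continuous smooth_fun_bump) auto

lemma test_fun_bump0:
  assumes "a < b"
  shows "test_fun (bump0 a b n)"
  unfolding test_fun_def
proof (intro conjI exI[of _ "\<bar>a\<bar> + \<bar>b\<bar>"] allI impI)
  show "smooth_fun (bump0 a b n)" using assms by (intro smooth_fun_bump) auto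
qed (auto simp: bump_def)

section \<open>The fundamental lemma of the calculus of variations\<close>

lemma locally_integrable_times_compact_support:
  assumes u: "locally_integrable u" and f: "continuous_on UNIV f" "\<And>x. \<bar>x\<bar> > R \<Longrightarrow> f x = 0"
  shows "integrable lborel (\<lambda>x. u x * f x)"
proof -
  have "bounded (f ` {-R..R})"
    using f by (intro compact_imp_bounded compact_continuous_image) (auto intro: continuous_on_subset)
  then obtain M where M: "\<And>x. x \<in> {-R..R} \<Longrightarrow> \<bar>f x\<bar> \<le> M"
    unfolding bounded_iff by (auto simp del: atLeastAtMost_iff)
  have [measurable]: "u \<in> borel_measurable borel" using u by (simp add: locally_integrable_def)
  have [measurable]: "f \<in> borel_measurable borel" using f by (intro borel_measurable_continuous_onI)
  have "set_integrable lborel {-R..R} u" using u by (simp add: locally_integrable_def)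
  then have "integrable lborel (\<lambda>x. M * (indicator {-R..R} x * u x))"
    by (intro integrable_mult_right) (simp add: set_integrable_def)
  then show ?thesis
  proof (rule Bochner_Integration.integrable_bound)
    show "AE x in lborel. norm (u x * f x) \<le> norm (M * (indicator {-R..R} x * u x))"
    proof (intro AE_I2)
      fix x
      show "norm (u x * f x) \<le> norm (M * (indicator {-R..R} x * u x))"
      proof (cases "\<bar>x\<bar> > R")
        case False
        then have "x \<in> {-R..R}" by auto
        then have "\<bar>u x\<bar> * \<bar>f x\<bar> \<le> \<bar>u x\<bar> * \<bar>M\<bar>" using M[of x] by (intro mult_left_mono) auto
        then show ?thesis using \<open>x \<in> {-R..R}\<close> by (simp add: abs_mult mult.commute)
      qed (use f in simp)
    qed
  qed simp
qed

lemma locally_integrable_Ioo: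
  assumes "locally_integrable u"
  shows "integrable lborel (\<lambda>x. indicator {a<..<b::real} x * u x)"
proof -
  have "set_integrable lborel {a..b} u" using assms by (simp add: locally_integrable_def)
  then have "set_integrable lborel {a<..<b} u" by (rule set_integrable_subset) auto
  then show ?thesis by (simp add: set_integrable_def)
qed

lemma bump0_integral_tendsto:
  assumes u: "locally_integrable u" and "a < b"
  shows "(\<lambda>n. \<integral>x. u x * bump0 a b n x \<partial>lborel) \<longlonglongrightarrow> (\<integral>x. indicator {a<..<b} x * u x \<partial>lborel)"
proof (rule integral_dominated_convergence[where w = "\<lambda>x. \<bar>indicator {a<..<b} x * u x\<bar>"])
  have [measurable]: "u \<in> borel_measurable borel" using u by (simp add: locally_integrable_def)
  show "(\<lambda>x. indicator {a<..<b} x * u x) \<in> borel_measurable lborel" by measurable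
  show "(\<lambda>x. u x * bump0 a b n x) \<in> borel_measurable lborel" for n using \<open>a < b\<close> by measurable
  show "integrable lborel (\<lambda>x. \<bar>indicator {a<..<b} x * u x\<bar>)"
    by (intro integrable_abs locally_integrable_Ioo u)
  show "AE x in lborel. (\<lambda>n. u x * bump0 a b n x) \<longlonglongrightarrow> indicator {a<..<b} x * u x"
  proof (intro AE_I2)
    fix x
    show "(\<lambda>n. u x * bump0 a b n x) \<longlonglongrightarrow> indicator {a<..<b} x * u x"
      using tendsto_mult_left[OF bump0_tendsto[of a b x], of "u x"] by (simp add: mult.commute)
  qed
  show "AE x in lborel. norm (u x * bump0 a b n x) \<le> \<bar>indicator {a<..<b} x * u x\<bar>" for n
  proof (intro AE_I2)
    fix x
    have "\<bar>u x\<bar> * bump0 a b n x \<le> \<bar>u x\<bar> * indicator {a<..<b} x"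
      by (intro mult_left_mono bump0_bounds) auto
    then show "norm (u x * bump0 a b n x) \<le> \<bar>indicator {a<..<b} x * u x\<bar>"
      using abs_of_nonneg[OF bump0_bounds(1)[of a b n x]] by (simp add: abs_mult mult.commute)
  qed
qed

text \<open>Open intervals generate the Borel sets and are stable under intersection, so the sets
  over which \<open>u\<close> integrates to zero, a Dynkin system, contain every Borel set. The
  windows from \<open>- n\<close> to \<open>n\<close> make \<open>u\<close> integrable, as the
  complement step requires.\<close>

lemma AE_zero_of_interval_integrals:
  assumes u: "locally_integrable u"
    and zero: "\<And>a b. a < b \<Longrightarrow> (\<integral>x. indicator {a<..<b} x * u x \<partial>lborel) = 0"
  shows "AE x in lborel. u x = 0"
proof -
  have [measurable]: "u \<in> borel_measurable borel" using u by (simp add: locally_integrable_def)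
  have "AE x in lborel. indicator {- real n<..<real n} x * u x = 0" for n
  proof (rule sigma_finite_measure.density_zero[OF sigma_finite_lborel])
    let ?v = "\<lambda>x. indicator {- real n<..<real n} x * u x"
    show int: "integrable lborel ?v" by (rule locally_integrable_Ioo[OF u])
    let ?G = "range (\<lambda>(a, b). box a b :: real set)"
    have G: "Int_stable ?G"
    proof (rule Int_stableI)
      fix A B assume "A \<in> ?G" "B \<in> ?G"
      then obtain a b c d where "A = {a<..<b}" "B = {c<..<d}" by (auto simp: box_real)
      then have "A \<inter> B = box (max a c) (min b d)" by (auto simp: box_real)
      then show "A \<inter> B \<in> ?G" by auto
    qed
    fix A :: "real set" assume "A \<in> sets lborel"
    then have "A \<in> sigma_sets UNIV ?G" by (simp add: borel_eq_box sets_measure_of)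
    have GP: "?G \<subseteq> Pow UNIV" by simp
    have "A \<in> sets lborel \<and> set_lebesgue_integral lborel A ?v = 0"
      using G GP \<open>A \<in> sigma_sets UNIV ?G\<close>
    proof (induct rule: sigma_sets_induct_disjoint)
      case (basic A)
      then obtain a b where A: "A = {a<..<b}" by (auto simp: box_real)
      have "(\<lambda>x. indicator A x *\<^sub>R ?v x) = (\<lambda>x. indicator {max a (- real n)<..<min b (real n)} x * u x)"
        by (auto simp: A indicator_def)
      then show ?case
        using zero[of "max a (- real n)" "min b (real n)"]
        by (cases "max a (- real n) < min b (real n)") (simp_all add: set_lebesgue_integral_def A)
    next
      case empty
      then show ?case by (simp add: set_lebesgue_integral_def)
    next
      case (compl A)
      then have [measurable]: "A \<in> sets borel" by simp
      have iA: "set_integrable lborel A ?v"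
        using int unfolding set_integrable_def by (intro integrable_mult_indicator) auto
      have "(\<lambda>x. indicator (UNIV - A) x *\<^sub>R ?v x) = (\<lambda>x. ?v x - indicator A x *\<^sub>R ?v x)"
        by (auto simp: indicator_def)
      then have "set_lebesgue_integral lborel (UNIV - A) ?v = integral\<^sup>L lborel ?v - set_lebesgue_integral lborel A ?v"
        unfolding set_lebesgue_integral_def using iA int
        by (simp only: set_integrable_def Bochner_Integration.integral_diff)
      moreover have "integral\<^sup>L lborel ?v = 0"
        using zero[of "- real n" "real n"] by (cases "n = 0") auto
      ultimately show ?case using compl by simp
    next
      case (union A)
      then have m: "\<And>i. A i \<in> sets lborel" by auto
      have "set_integrable lborel (\<Union>i. A i) ?v"
        using int m unfolding set_integrable_def by (intro integrable_mult_indicator) auto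
      then have "set_lebesgue_integral lborel (\<Union>i. A i) ?v = (\<Sum>i. set_lebesgue_integral lborel (A i) ?v)"
        using union m by (intro lebesgue_integral_countable_add) (auto simp: disjoint_family_on_def)
      then show ?case using union m by auto
    qed
    then show "set_lebesgue_integral lborel A ?v = 0" by simp
  qed
  then have "AE x in lborel. \<forall>n. indicator {- real n<..<real n} x * u x = 0"
    unfolding AE_all_countable by blast
  then show ?thesis
  proof eventually_elim
    fix x assume *: "\<forall>n. indicator {- real n<..<real n} x * u x = 0"
    obtain n where "\<bar>x\<bar> < real n" using reals_Archimedean2 by blast
    then have "x \<in> {- real n<..<real n}" by auto
    then show "u x = 0" using *[rule_format, of n] by simp
  qed
qed

lemma fundamental_lemma_variations:
  assumes u: "locally_integrable u" and "\<And>\<phi>. test_fun \<phi> \<Longrightarrow> (\<integral>x. u x * \<phi> x \<partial>lborel) = 0"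
  shows "AE x in lborel. u x = 0"
proof (rule AE_zero_of_interval_integrals[OF u])
  fix a b :: real assume "a < b"
  then have "(\<lambda>n. \<integral>x. u x * bump0 a b n x \<partial>lborel) = (\<lambda>n. 0)"
    by (intro ext assms test_fun_bump0)
  then show "(\<integral>x. indicator {a<..<b} x * u x \<partial>lborel) = 0"
    using bump0_integral_tendsto[OF u \<open>a < b\<close>] by (simp add: LIMSEQ_const_iff)
qed

section \<open>Primitives and weak derivatives\<close>

lemma locally_integrable_continuous:
  assumes "continuous_on UNIV f"
  shows "locally_integrable f"
  unfolding locally_integrable_def
proof (intro conjI allI)
  show "f \<in> borel_measurable lborel"
    using assms by (simp add: borel_measurable_continuous_onI)
  show "set_integrable lborel {a..b} f" for a b
    unfolding set_integrable_def
    using assms by (intro borel_integrable_compact) (auto intro: continuous_on_subset)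
qed

lemma locally_integrable_integrable: "integrable lborel f \<Longrightarrow> locally_integrable f"
  unfolding locally_integrable_def set_integrable_def
  by (intro conjI allI integrable_mult_indicator borel_measurable_integrable) auto

lemma locally_integrable_diff:
  "locally_integrable f \<Longrightarrow> locally_integrable g \<Longrightarrow> locally_integrable (\<lambda>x. f x - g x)"
  unfolding locally_integrable_def by (auto intro: set_integral_diff(1))

text \<open>Absolute continuity with density \<open>g\<close>, in integrated form. Only increments
  enter, so adding a constant to \<open>f\<close> changes nothing and no pointwise derivative of
  \<open>f\<close> is involved.\<close>

definition primitive_of :: "(real \<Rightarrow> real) \<Rightarrow> (real \<Rightarrow> real) \<Rightarrow> bool" where
  "primitive_of g f \<longleftrightarrow> (\<forall>a b. a \<le> b \<longrightarrow> f b - f a = (LINT t:{a..b}|lborel. g t))"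

lemma exists_primitive:
  assumes g: "locally_integrable g"
  obtains f where "primitive_of g f"
proof
  have int: "g integrable_on {a..b}" for a b
    using g set_borel_integral_eq_integral(1) unfolding locally_integrable_def by blast
  have eq: "(LINT t:{a..b}|lborel. g t) = integral {a..b} g" for a b
    using g set_borel_integral_eq_integral(2) unfolding locally_integrable_def by blast
  show "primitive_of g (\<lambda>y. if 0 \<le> y then integral {0..y} g else - integral {y..0} g)"
    unfolding primitive_of_def eq
  proof (intro allI impI)
    fix a b :: real assume "a \<le> b"
    then consider "0 \<le> a" | "a < 0" "0 \<le> b" | "b < 0" by linarith
    then show "(if 0 \<le> b then integral {0..b} g else - integral {b..0} g) -
        (if 0 \<le> a then integral {0..a} g else - integral {a..0} g) = integral {a..b} g"
    proof cases
      case 1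
      then show ?thesis using \<open>a \<le> b\<close> Henstock_Kurzweil_Integration.integral_combine[of 0 a b g] int by auto
    next
      case 2
      then show ?thesis using Henstock_Kurzweil_Integration.integral_combine[of a 0 b g] int by auto
    next
      case 3
      then show ?thesis using \<open>a \<le> b\<close> Henstock_Kurzweil_Integration.integral_combine[of a b 0 g] int by auto
    qed
  qed
qed

lemma primitive_of_continuous:
  assumes g: "locally_integrable g" and f: "primitive_of g f"
  shows "continuous_on UNIV f"
proof (rule continuous_at_imp_continuous_on, intro ballI)
  fix x :: real
  have int: "g integrable_on {x - 1..x + 1}"
    using g set_borel_integral_eq_integral(1) unfolding locally_integrable_def by blast
  have eq: "(LINT t:{a..b}|lborel. g t) = integral {a..b} g" for a b
    using g set_borel_integral_eq_integral(2) unfolding locally_integrable_def by blast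
  have "continuous_on {x - 1..x + 1} (\<lambda>y. f (x - 1) + integral {x - 1..y} g)"
    by (intro continuous_intros indefinite_integral_continuous_1 int)
  moreover have "f (x - 1) + integral {x - 1..y} g = f y" if "y \<in> {x - 1..x + 1}" for y
    using f that unfolding primitive_of_def eq by (metis add.commute atLeastAtMost_iff diff_add_cancel)
  ultimately have "continuous_on {x - 1..x + 1} f"
    by (rule continuous_on_eq)
  then show "isCont f x"
    by (rule continuous_on_interior) simp
qed

text \<open>The fundamental theorem of calculus on an interval that contains the support. The
  half-line version is the inner integral in the integration by parts for primitives.\<close>

lemma test_fun_deriv_integral:
  assumes "test_fun \<phi>"
  shows "test_fun (deriv \<phi>)" "(\<integral>y. deriv \<phi> y \<partial>lborel) = 0"
    "(\<integral>y. indicator {t..} y * deriv \<phi> y \<partial>lborel) = - \<phi> t"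
proof -
  obtain R0 where sm: "smooth_fun \<phi>" and R0: "\<And>x. \<bar>x\<bar> > R0 \<Longrightarrow> \<phi> x = 0"
    using assms by (auto simp: test_fun_def)
  define R where "R = \<bar>R0\<bar> + \<bar>t\<bar> + 1"
  have Rt: "\<bar>t\<bar> < R" "R0 < R" "0 < R" by (auto simp: R_def)
  have supp: "\<phi> x = 0" if "\<bar>x\<bar> \<ge> R" for x using R0[of x] that Rt by auto
  have d0: "deriv \<phi> x = 0" if "\<bar>x\<bar> > R0" for x
  proof -
    have "open {x. \<bar>x\<bar> > R0}" by (intro open_Collect_less continuous_intros)
    then have "(\<phi> has_real_derivative 0) (at x)"
      by (rule has_field_derivative_transform_within_open[where f = "\<lambda>_. 0", rotated]) (use that R0 in auto)
    then show ?thesis by (rule DERIV_imp_deriv)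
  qed
  then show "test_fun (deriv \<phi>)" using sm by (auto simp: test_fun_def smooth_fun_deriv)
  have ftc: "(LINT y:{a..b}|lborel. deriv \<phi> y) = \<phi> b - \<phi> a" if "a \<le> b" for a b
    using that sm unfolding set_lebesgue_integral_def
    by (intro integral_FTC_atLeastAtMost)
      (auto intro: smooth_fun_has_derivative smooth_fun_deriv smooth_fun_continuous
        simp flip: has_real_derivative_iff_has_vector_derivative intro: has_field_derivative_at_within)
  have dR: "deriv \<phi> x = 0" if "\<bar>x\<bar> > R" for x using d0[of x] that Rt by linarith
  have "(\<lambda>y. deriv \<phi> y) = (\<lambda>y. indicator {-R..R} y *\<^sub>R deriv \<phi> y)"
    using dR by (force simp: indicator_def fun_eq_iff)
  then have "(\<integral>y. deriv \<phi> y \<partial>lborel) = (LINT y:{-R..R}|lborel. deriv \<phi> y)"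
    unfolding set_lebesgue_integral_def by (rule arg_cong)
  then show "(\<integral>y. deriv \<phi> y \<partial>lborel) = 0"
    using ftc[of "-R" R] supp[of R] supp[of "-R"] Rt by (simp add: set_lebesgue_integral_def)
  have "(\<lambda>y. indicator {t..} y * deriv \<phi> y) = (\<lambda>y. indicator {t..R} y *\<^sub>R deriv \<phi> y)"
  proof
    fix y
    show "indicator {t..} y * deriv \<phi> y = indicator {t..R} y *\<^sub>R deriv \<phi> y"
    proof (cases "\<bar>y\<bar> > R")
      case True
      then show ?thesis by (simp add: dR)
    next
      case False
      then have "y \<in> {t..} \<longleftrightarrow> y \<in> {t..R}" by (auto simp: not_less abs_le_iff)
      then show ?thesis by (simp add: indicator_def)
    qed
  qed
  then show "(\<integral>y. indicator {t..} y * deriv \<phi> y \<partial>lborel) = - \<phi> t"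
    using ftc[of t R] supp[of R] Rt by (simp add: set_lebesgue_integral_def)
qed

lemma integrable_test_fun:
  assumes "locally_integrable u" "test_fun \<phi>"
  shows "integrable lborel (\<lambda>x. u x * \<phi> x)"
proof -
  obtain R where "smooth_fun \<phi>" "\<And>x. \<bar>x\<bar> > R \<Longrightarrow> \<phi> x = 0"
    using assms(2) by (auto simp: test_fun_def)
  then show ?thesis
    by (intro locally_integrable_times_compact_support[OF assms(1)] smooth_fun_continuous)
qed

text \<open>Integration by parts through Fubini: write \<open>f y\<close> as \<open>f (- R)\<close>
  plus the integral of \<open>g\<close> from \<open>- R\<close> to \<open>y\<close>, and integrate
  over \<open>y\<close> first. This replaces almost everywhere differentiability of
  \<open>f\<close>.\<close>

lemma weak_deriv_primitive:
  assumes g: "locally_integrable g" and f: "primitive_of g f"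
  shows "weak_deriv f g"
  unfolding weak_deriv_def
proof (intro conjI allI impI)
  have [measurable]: "g \<in> borel_measurable borel" using g by (simp add: locally_integrable_def)
  show lf: "locally_integrable f"
    by (intro locally_integrable_continuous primitive_of_continuous[OF g f])
  fix \<phi> assume t: "test_fun \<phi>"
  note td = test_fun_deriv_integral[OF t]
  have [measurable]: "deriv \<phi> \<in> borel_measurable borel"
    using td(1) by (intro borel_measurable_continuous_onI smooth_fun_continuous) (simp add: test_fun_def)
  obtain R1 R2 where R1: "\<And>x. \<bar>x\<bar> > R1 \<Longrightarrow> \<phi> x = 0" and R2: "\<And>x. \<bar>x\<bar> > R2 \<Longrightarrow> deriv \<phi> x = 0"
    using t td(1) by (auto simp: test_fun_def)
  define R where "R = \<bar>R1\<bar> + \<bar>R2\<bar> + 1"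
  have R: "\<And>x. \<bar>x\<bar> \<ge> R \<Longrightarrow> \<phi> x = 0" "\<And>x. \<bar>x\<bar> \<ge> R \<Longrightarrow> deriv \<phi> x = 0" "R > 0"
    using R1 R2 by (auto simp: R_def)
  \<comment> \<open>The truncation makes \<open>g\<close> globally integrable, as Fubini on the
    product needs; \<open>\<phi>\<close> vanishes outside the window, so nothing is lost.\<close>
  define gR where "gR t = indicator {-R..R} t * g t" for t
  have [measurable]: "gR \<in> borel_measurable borel" unfolding gR_def by measurable
  have gR: "integrable lborel gR"
    using g unfolding gR_def locally_integrable_def set_integrable_def by simp
  have id: "integrable lborel (deriv \<phi>)"
    using integrable_test_fun[OF locally_integrable_continuous td(1), of "\<lambda>_. 1"] by simp
  define F where "F y t = gR t * (indicator {t..} y * deriv \<phi> y)" for y t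
  have Fm [measurable]: "case_prod F \<in> borel_measurable (lborel \<Otimes>\<^sub>M lborel)"
  proof -
    have [measurable]: "Measurable.pred (borel \<Otimes>\<^sub>M borel) (\<lambda>x::real\<times>real. fst x \<in> {snd x..})"
      unfolding atLeast_iff by measurable
    show ?thesis unfolding F_def case_prod_beta' by measurable
  qed
  have iF: "integrable (lborel \<Otimes>\<^sub>M lborel) (case_prod F)"
  proof (rule Bochner_Integration.integrable_bound)
    show "integrable (lborel \<Otimes>\<^sub>M lborel) (\<lambda>(y, t). deriv \<phi> y * gR t)"
    proof (rule lborel_pair.Fubini_integrable)
      show "integrable lborel (\<lambda>y. \<integral>t. norm (case (y, t) of (y, t) \<Rightarrow> deriv \<phi> y * gR t) \<partial>lborel)"
        using id gR by (simp add: abs_mult)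
      show "AE y in lborel. integrable lborel (\<lambda>t. case (y, t) of (y, t) \<Rightarrow> deriv \<phi> y * gR t)"
        using gR by simp
    qed simp
    show "AE x in lborel \<Otimes>\<^sub>M lborel. norm (case_prod F x) \<le> norm (case x of (y, t) \<Rightarrow> deriv \<phi> y * gR t)"
      by (intro AE_I2) (auto simp: F_def abs_mult indicator_def)
  qed fact
  have 1: "f y * deriv \<phi> y = f (-R) * deriv \<phi> y + (\<integral>t. F y t \<partial>lborel)" for y
  proof (cases "\<bar>y\<bar> \<ge> R")
    case True
    then show ?thesis by (simp add: R F_def)
  next
    case False
    have "(\<lambda>t. gR t * indicator {t..} y) = (\<lambda>t. indicator {-R..y} t *\<^sub>R g t)"
      using False by (auto simp: gR_def indicator_def fun_eq_iff)
    then have "(\<integral>t. gR t * indicator {t..} y \<partial>lborel) = f y - f (-R)"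
      using f False unfolding primitive_of_def set_lebesgue_integral_def by auto
    moreover have "(\<integral>t. F y t \<partial>lborel) = (\<integral>t. gR t * indicator {t..} y \<partial>lborel) * deriv \<phi> y"
      unfolding F_def by (subst integral_mult_left_zero[symmetric]) (simp add: mult.assoc)
    ultimately show ?thesis by (simp add: left_diff_distrib)
  qed
  have "(\<integral>y. f y * deriv \<phi> y \<partial>lborel) = (\<integral>y. f (-R) * deriv \<phi> y \<partial>lborel) + (\<integral>y. (\<integral>t. F y t \<partial>lborel) \<partial>lborel)"
    unfolding 1 using id lborel_pair.integrable_fst'[OF iF]
    by (intro Bochner_Integration.integral_add) auto
  also have "(\<integral>y. f (-R) * deriv \<phi> y \<partial>lborel) = 0" using td(2) by simp
  also have "(\<integral>y. (\<integral>t. F y t \<partial>lborel) \<partial>lborel) = (\<integral>t. (\<integral>y. F y t \<partial>lborel) \<partial>lborel)"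
    by (rule lborel_pair.Fubini_integral[OF iF, symmetric])
  also have "\<dots> = (\<integral>t. - (g t * \<phi> t) \<partial>lborel)"
  proof (intro Bochner_Integration.integral_cong refl)
    fix t
    have "(\<integral>y. F y t \<partial>lborel) = gR t * (- \<phi> t)"
      unfolding F_def using test_fun_deriv_integral(3)[OF t, of t] by simp
    also have "\<dots> = - (g t * \<phi> t)" using R(1)[of t] by (cases "\<bar>t\<bar> \<ge> R") (auto simp: gR_def indicator_def)
    finally show "(\<integral>y. F y t \<partial>lborel) = - (g t * \<phi> t)" .
  qed
  finally show "(\<integral>y. f y * deriv \<phi> y \<partial>lborel) = - (\<integral>y. g y * \<phi> y \<partial>lborel)" by simp
qed fact

lemma weak_deriv_unique:
  assumes "weak_deriv f g" "weak_deriv f h"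
  shows "AE x in lborel. g x = h x"
proof -
  have l: "locally_integrable g" "locally_integrable h" using assms by (auto simp: weak_deriv_def)
  have "AE x in lborel. g x - h x = 0"
  proof (rule fundamental_lemma_variations)
    show "locally_integrable (\<lambda>x. g x - h x)" by (intro locally_integrable_diff l)
    fix \<phi> assume t: "test_fun \<phi>"
    have "(\<integral>x. g x * \<phi> x - h x * \<phi> x \<partial>lborel) = (\<integral>x. g x * \<phi> x \<partial>lborel) - (\<integral>x. h x * \<phi> x \<partial>lborel)"
      by (intro Bochner_Integration.integral_diff integrable_test_fun l t)
    also have "(\<integral>x. g x * \<phi> x \<partial>lborel) = - (\<integral>x. f x * deriv \<phi> x \<partial>lborel)"
      using assms(1) t unfolding weak_deriv_def by auto
    also have "(\<integral>x. h x * \<phi> x \<partial>lborel) = - (\<integral>x. f x * deriv \<phi> x \<partial>lborel)"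
      using assms(2) t unfolding weak_deriv_def by auto
    also have "- (\<integral>x. f x * deriv \<phi> x \<partial>lborel) - - (\<integral>x. f x * deriv \<phi> x \<partial>lborel) = 0" by simp
    finally show "(\<integral>x. (g x - h x) * \<phi> x \<partial>lborel) = 0" by (simp add: left_diff_distrib)
  qed
  then show ?thesis by simp
qed

text \<open>Almost everywhere uniqueness removes the choice operator: whichever weak derivative is
  at hand may be inserted.\<close>

lemma energy_eq:
  assumes "weak_deriv f g"
  shows "energy c f = (\<integral>\<^sup>+ y. ennreal ((1/2) * (g y)\<^sup>2 + c \<bar>f y\<bar>) \<partial>lborel)"
proof -
  have *: "weak_deriv f (SOME g. weak_deriv f g)" by (rule someI[of "weak_deriv f", OF assms])
  have "AE x in lborel. (SOME g. weak_deriv f g) x = g x"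
    by (rule weak_deriv_unique[OF * assms])
  then have "(\<integral>\<^sup>+ y. ennreal ((1/2) * ((SOME g. weak_deriv f g) y)\<^sup>2 + c \<bar>f y\<bar>) \<partial>lborel) =
     (\<integral>\<^sup>+ y. ennreal ((1/2) * (g y)\<^sup>2 + c \<bar>f y\<bar>) \<partial>lborel)"
    by (intro nn_integral_cong_AE) auto
  then show ?thesis using assms by (auto simp: energy_def Let_def)
qed

section \<open>The du Bois-Reymond lemma by way of Cauchy's functional equation\<close>

lemma additive_continuous_linear:
  fixes U :: "real \<Rightarrow> real"
  assumes add: "\<And>x y. U (x + y) = U x + U y" and cont: "continuous_on UNIV U"
  shows "U x = x * U 1"
proof -
  \<comment> \<open>\<open>V\<close> is additive with \<open>V 1 = 0\<close>, hence zero on the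
    rationals, and continuity extends this to their closure.\<close>
  define V where "V x = U x - x * U 1" for x
  have Vadd: "V (x + y) = V x + V y" for x y by (simp add: V_def add algebra_simps)
  have V0: "V 0 = 0" using Vadd[of 0 0] by simp
  have Vmult: "V (real n * x) = real n * V x" for n x
    by (induction n) (simp_all add: V0 Vadd algebra_simps)
  have Vneg: "V (- x) = - V x" for x using Vadd[of x "-x"] V0 by simp
  have "V r = 0" if r: "r \<in> \<rat>" for r
  proof -
    obtain m n where mn: "n \<noteq> 0" "\<bar>r\<bar> = real m / real n" by (rule Rats_abs_nat_div_natE[OF r])
    have "real n * V \<bar>r\<bar> = V (real m * 1)" using mn by (simp flip: Vmult)
    also have "\<dots> = 0" unfolding Vmult by (simp add: V_def)
    finally have "V \<bar>r\<bar> = 0" using mn by simp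
    then show ?thesis using Vneg[of r] by (cases "r \<ge> 0") auto
  qed
  moreover have "continuous_on (closure \<rat>) V"
    unfolding V_def by (intro continuous_intros continuous_on_subset[OF cont]) auto
  moreover have "x \<in> closure \<rat>"
    unfolding closure_approachable
  proof (intro allI impI)
    fix e :: real assume "e > 0"
    then obtain q where "q \<in> \<rat>" "x < q" "q < x + e" using Rats_dense_in_real[of x "x + e"] by auto
    then show "\<exists>y\<in>\<rat>. dist y x < e" by (auto simp: dist_real_def intro!: bexI[of _ q])
  qed
  ultimately have "V x = 0"
    by (intro continuous_constant_on_closure[of "\<rat>" V 0 x])
  then show ?thesis by (simp add: V_def)
qed

lemma bump0_shift: "bump0 a (a + l) n x = bump0 0 l n (x - a)"
  by (auto simp: bump_def algebra_simps)

text \<open>Translates of one bump have equal integrals, so their difference is the derivative of a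
  smooth function of compact support, and \<open>u\<close> annihilates such derivatives.\<close>

lemma bump0_integral_pair:
  assumes "l > 0" "locally_integrable u" "\<And>\<phi>. test_fun \<phi> \<Longrightarrow> (\<integral>x. u x * deriv \<phi> x \<partial>lborel) = 0"
  shows "(\<integral>x. u x * bump0 a (a + l) n x \<partial>lborel) = (\<integral>x. u x * bump0 b (b + l) n x \<partial>lborel)"
proof -
  let ?B = "\<lambda>a. bump0 a (a + l) n"
  have sm: "smooth_fun (?B a)" for a using assms(1) by (intro smooth_fun_bump) auto
  have li: "locally_integrable (?B a)" for a
    by (intro locally_integrable_continuous smooth_fun_continuous sm)
  have ib: "integrable lborel (?B a)" for a
    using integrable_test_fun[OF locally_integrable_continuous test_fun_bump0, of "\<lambda>_. 1" a "a + l" n] assms(1) by simp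
  define d where "d x = ?B a x - ?B b x" for x
  have dsm: "smooth_fun d" unfolding d_def by (intro smooth_fun_diff sm)
  have ld: "locally_integrable d" unfolding d_def by (intro locally_integrable_diff li)
  obtain \<Phi>0 where \<Phi>0: "primitive_of d \<Phi>0" using exists_primitive[OF ld] .
  define R where "R = \<bar>a\<bar> + \<bar>b\<bar> + l"
  \<comment> \<open>Zero to the left of both supports by this normalisation, and to the right of
    them because the total integral of \<open>d\<close> is zero.\<close>
  define \<Phi> where "\<Phi> x = \<Phi>0 x - \<Phi>0 (-R)" for x
  have \<Phi>: "\<Phi> y - \<Phi> x = (LINT t:{x..y}|lborel. d t)" if "x \<le> y" for x y
    using \<Phi>0 that by (auto simp: \<Phi>_def primitive_of_def)
  have supp: "d x = 0" if "\<bar>x\<bar> \<ge> R" for x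
    using that assms(1) by (auto simp: d_def bump_def R_def)
  have der: "(\<Phi> has_real_derivative d x) (at x)" for x
  proof -
    have "((\<lambda>y. integral {x - 1..y} d) has_vector_derivative d x) (at x within {x - 1..x + 1})"
      by (intro integral_has_vector_derivative smooth_fun_continuous dsm) auto
    then have "((\<lambda>y. integral {x - 1..y} d) has_real_derivative d x) (at x)"
      unfolding has_real_derivative_iff_has_vector_derivative
      by (subst (asm) at_within_interior) auto
    then have "((\<lambda>y. \<Phi> (x - 1) + integral {x - 1..y} d) has_real_derivative d x) (at x)"
      by (auto intro!: derivative_eq_intros)
    then show ?thesis
    proof (rule has_field_derivative_transform_within_open[where S = "{x - 1<..<x + 1}"])
      fix y assume "y \<in> {x - 1<..<x + 1}"
      moreover have "(LINT t:{x-1..y}|lborel. d t) = integral {x-1..y} d"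
        using ld set_borel_integral_eq_integral(2) unfolding locally_integrable_def by blast
      ultimately show "\<Phi> (x - 1) + integral {x - 1..y} d = \<Phi> y"
        using \<Phi>[of "x - 1" y] by auto
    qed auto
  qed
  have total: "(\<integral>x. d x \<partial>lborel) = 0"
  proof -
    have "(\<integral>x. ?B a x \<partial>lborel) = (\<integral>x. bump0 0 l n x \<partial>lborel)" for a
      unfolding bump0_shift using lborel_integral_real_affine[of 1 "\<lambda>x. bump0 0 l n x" "- a"] by simp
    then show ?thesis unfolding d_def using ib by simp
  qed
  have "\<Phi> x = 0" if "\<bar>x\<bar> > R" for x
  proof (cases "x < 0")
    case True
    then have "\<Phi> (-R) - \<Phi> x = (LINT t:{x..-R}|lborel. d t)" using that by (intro \<Phi>) auto
    also have "(\<lambda>t. indicator {x..-R} t *\<^sub>R d t) = (\<lambda>t. 0)"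
      using supp assms(1) by (auto simp: indicator_def fun_eq_iff R_def)
    then have "(LINT t:{x..-R}|lborel. d t) = 0" unfolding set_lebesgue_integral_def by simp
    finally show ?thesis by (simp add: \<Phi>_def)
  next
    case False
    then have "\<Phi> x - \<Phi> (-R) = (LINT t:{-R..x}|lborel. d t)" using that assms(1) by (intro \<Phi>) (auto simp: R_def)
    also have "(\<lambda>t. indicator {-R..x} t *\<^sub>R d t) = d"
    proof
      fix t show "indicator {-R..x} t *\<^sub>R d t = d t"
        using supp[of t] False that by (cases "\<bar>t\<bar> \<ge> R") (auto simp: indicator_def)
    qed
    then have "(LINT t:{-R..x}|lborel. d t) = 0" unfolding set_lebesgue_integral_def using total by simp
    finally show ?thesis by (simp add: \<Phi>_def)
  qed
  moreover have "smooth_fun \<Phi>" by (rule smooth_fun_antiderivative[OF dsm der])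
  ultimately have "test_fun \<Phi>" unfolding test_fun_def by blast
  moreover have "deriv \<Phi> = d" using der DERIV_imp_deriv by blast
  ultimately have "(\<integral>x. u x * d x \<partial>lborel) = 0" using assms(3) by auto
  moreover have "integrable lborel (\<lambda>x. u x * ?B a x)" for a
    using assms(1) by (intro integrable_test_fun assms(2) test_fun_bump0) auto
  ultimately show ?thesis by (simp add: d_def right_diff_distrib)
qed

text \<open>By the comparison of translated bumps, the increments of a primitive \<open>U\<close>
  depend only on the length of the interval. So \<open>U\<close> is additive and continuous, hence
  linear, and \<open>u - U 1\<close> integrates to zero over every interval.\<close>

lemma du_bois_reymond:
  assumes u: "locally_integrable u" and "\<And>\<phi>. test_fun \<phi> \<Longrightarrow> (\<integral>x. u x * deriv \<phi> x \<partial>lborel) = 0"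
  obtains k where "AE x in lborel. u x = k"
proof -
  obtain U0 where U0: "primitive_of u U0" using exists_primitive[OF u] .
  define U where "U x = U0 x - U0 0" for x
  have iU: "(\<integral>x. indicator {a<..<b} x * u x \<partial>lborel) = U b - U a" if "a < b" for a b
  proof -
    have "(\<integral>x. indicator {a<..<b} x * u x \<partial>lborel) = (LINT x:{a..b}|lborel. u x)"
      unfolding set_lebesgue_integral_def
    proof (intro integral_cong_AE)
      show "AE x in lborel. indicator {a<..<b} x * u x = indicator {a..b} x *\<^sub>R u x"
        using AE_lborel_singleton[of a] AE_lborel_singleton[of b]
        by eventually_elim (auto simp: indicator_def)
    qed (use u in \<open>auto simp: locally_integrable_def\<close>)
    then show ?thesis using U0 that by (auto simp: primitive_of_def U_def)
  qed
  have shift: "U (a + l) - U a = U (b + l) - U b" if "l > 0" for a b l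
  proof -
    have "(\<lambda>n. \<integral>x. u x * bump0 a (a + l) n x \<partial>lborel) = (\<lambda>n. \<integral>x. u x * bump0 b (b + l) n x \<partial>lborel)"
      by (intro ext bump0_integral_pair assms that)
    then have "(\<integral>x. indicator {a<..<a + l} x * u x \<partial>lborel) = (\<integral>x. indicator {b<..<b + l} x * u x \<partial>lborel)"
      using bump0_integral_tendsto[OF u, of a "a + l"] bump0_integral_tendsto[OF u, of b "b + l"] that
      by (intro LIMSEQ_unique[of "\<lambda>n. \<integral>x. u x * bump0 a (a + l) n x \<partial>lborel"]) auto
    then show ?thesis using iU[of a "a + l"] iU[of b "b + l"] that by simp
  qed
  have add: "U (x + y) = U x + U y" for x y
  proof -
    have U00: "U 0 = 0" by (simp add: U_def)
    consider "y > 0" | "y = 0" | "y < 0" by linarith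
    then show ?thesis
      using shift[of y x 0] shift[of "-y" "x + y" y] U00 by cases auto
  qed
  have cont: "continuous_on UNIV U"
    unfolding U_def by (intro continuous_intros primitive_of_continuous[OF u U0])
  have lin: "U x = x * U 1" for x by (rule additive_continuous_linear[OF add cont])
  have "AE x in lborel. u x - U 1 = 0"
  proof (rule AE_zero_of_interval_integrals)
    have lc: "locally_integrable (\<lambda>_. U 1)" by (intro locally_integrable_continuous continuous_intros)
    then show "locally_integrable (\<lambda>x. u x - U 1)" by (intro locally_integrable_diff u)
    fix a b :: real assume "a < b"
    have "(\<integral>x. indicator {a<..<b} x * u x - indicator {a<..<b} x * U 1 \<partial>lborel) =
       (\<integral>x. indicator {a<..<b} x * u x \<partial>lborel) - (\<integral>x. indicator {a<..<b} x * U 1 \<partial>lborel)"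
      by (intro Bochner_Integration.integral_diff locally_integrable_Ioo u lc)
    also have "\<dots> = U b - U a - (b - a) * U 1" using iU \<open>a < b\<close> by simp
    also have "\<dots> = 0" using lin[of a] lin[of b] by (simp add: algebra_simps)
    finally show "(\<integral>x. indicator {a<..<b} x * (u x - U 1) \<partial>lborel) = 0"
      by (simp add: right_diff_distrib)
  qed
  then show thesis using that[of "U 1"] by simp
qed

text \<open>Apply the du Bois-Reymond lemma to \<open>\<psi>\<close> minus any primitive of
  \<open>g\<close> and absorb the constant. The result is the continuous representative on which
  level crossings make sense.\<close>

lemma weak_deriv_imp_primitive:
  assumes "weak_deriv \<psi> g"
  obtains f where "primitive_of g f" "AE x in lborel. \<psi> x = f x"
proof -
  have l: "locally_integrable \<psi>" "locally_integrable g" using assms by (auto simp: weak_deriv_def)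
  obtain f0 where f0: "primitive_of g f0" using exists_primitive[OF l(2)] .
  have w: "weak_deriv f0 g" by (rule weak_deriv_primitive[OF l(2) f0])
  have l0: "locally_integrable f0" using w by (simp add: weak_deriv_def)
  obtain k where k: "AE x in lborel. \<psi> x - f0 x = k"
  proof (rule du_bois_reymond)
    show "locally_integrable (\<lambda>x. \<psi> x - f0 x)" by (intro locally_integrable_diff l l0)
    fix \<phi> assume t: "test_fun \<phi>"
    have "(\<integral>x. \<psi> x * deriv \<phi> x - f0 x * deriv \<phi> x \<partial>lborel) = (\<integral>x. \<psi> x * deriv \<phi> x \<partial>lborel) - (\<integral>x. f0 x * deriv \<phi> x \<partial>lborel)"
      by (intro Bochner_Integration.integral_diff integrable_test_fun l l0 test_fun_deriv_integral t)
    also have "\<dots> = 0" using assms w t unfolding weak_deriv_def by simp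
    finally show "(\<integral>x. (\<psi> x - f0 x) * deriv \<phi> x \<partial>lborel) = 0" by (simp add: left_diff_distrib)
  qed
  show thesis
  proof (rule that)
    show "primitive_of g (\<lambda>x. f0 x + k)" using f0 by (simp add: primitive_of_def)
    show "AE x in lborel. \<psi> x = f0 x + k" using k by eventually_elim auto
  qed
qed

section \<open>The phase field cost as solution of an Abel equation\<close>

text \<open>\<open>p\<close> is a version of the derivative of \<tau>. Monotonicity is asked on the
  positive axis only, where \<open>p\<close> may be unbounded near 0; an integral with values in
  \<open>ennreal\<close> states the identity without a separate integrability claim.\<close>

locale cost_density =
  fixes \<tau> p :: "real \<Rightarrow> real"
  assumes p_measurable [measurable]: "p \<in> borel_measurable borel"
    and p_nonneg: "0 \<le> p w"
    and p_antimono: "0 < v \<Longrightarrow> v \<le> w \<Longrightarrow> p w \<le> p v"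
    and p_integral: "0 \<le> w \<Longrightarrow> (\<integral>\<^sup>+ t. ennreal (p t) * indicator {0<..<w} t \<partial>lborel) = ennreal (\<tau> w)"
    and \<tau>_nonneg: "0 \<le> w \<Longrightarrow> 0 \<le> \<tau> w"

text \<open>Compare both slopes with that of the chord from \<open>x\<close> to \<open>y'\<close>:
  moving one end point at a time to the right can only lower a slope.\<close>

lemma concave_slope_antimono:
  fixes \<tau> :: "real \<Rightarrow> real"
  assumes c: "concave_on {0..} \<tau>" and "0 \<le> x" "x \<le> x'" "y \<le> y'" "x < y" "x' < y'"
  shows "(\<tau> y' - \<tau> x') / (y' - x') \<le> (\<tau> y - \<tau> x) / (y - x)"
proof -
  have c': "convex_on {0..} (\<lambda>x. - \<tau> x)" using c by (simp add: concave_on_def)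
  have "(\<tau> y' - \<tau> x') / (y' - x') \<le> (\<tau> y' - \<tau> x) / (y' - x)"
  proof (cases "x = x'")
    case False
    then show ?thesis
      using convex_on_slope_le(2)[OF c', of x y' x'] assms by (simp add: field_simps)
  qed simp
  also have "\<dots> \<le> (\<tau> y - \<tau> x) / (y - x)"
  proof (cases "y = y'")
    case False
    then show ?thesis
      using convex_on_slope_le(1)[OF c', of x y' y] assms by (simp add: field_simps)
  qed simp
  finally show ?thesis .
qed

text \<open>The density is the right derivative, as the limit of difference quotients. The integral
  of a quotient over \<open>{0..w}\<close> telescopes to the mean of \<tau> over
  \<open>{w..w + h n}\<close> minus its mean over \<open>{0..h n}\<close>, so continuity gives
  \<open>\<tau> w - \<tau> 0\<close> in the limit.\<close>

lemma admissible_cost_density: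
  assumes "admissible_cost \<tau>"
  obtains p where "cost_density \<tau> p"
proof -
  have mono: "\<And>x y. 0 \<le> x \<Longrightarrow> x \<le> y \<Longrightarrow> \<tau> x \<le> \<tau> y"
    and conc: "concave_on {0..} \<tau>" and cont: "continuous_on {0..} \<tau>" and zero: "\<tau> 0 = 0"
    using assms by (auto simp: admissible_cost_def mono_on_def)
  define \<sigma> where "\<sigma> t = \<tau> (max 0 t)" for t
  have \<sigma>eq: "\<sigma> t = \<tau> t" if "0 \<le> t" for t using that by (simp add: \<sigma>_def)
  have \<sigma>mono: "\<sigma> x \<le> \<sigma> y" if "x \<le> y" for x y using that mono by (auto simp: \<sigma>_def)
  have \<sigma>cont: "continuous_on A \<sigma>" for A
    unfolding \<sigma>_def by (rule continuous_on_compose2[OF cont]) (auto intro: continuous_intros)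
  have [measurable]: "\<sigma> \<in> borel_measurable borel" by (intro borel_measurable_continuous_onI \<sigma>cont)
  define h where "h n = 1 / real (Suc n)" for n
  have h: "h n > 0" for n by (simp add: h_def)
  have hmono: "h n \<le> h m" if "m \<le> n" for m n using that by (simp add: h_def frac_le)
  have hlim: "h \<longlonglongrightarrow> 0"
    unfolding h_def using LIMSEQ_inverse_real_of_nat by (simp add: inverse_eq_divide)
  \<comment> \<open>By concavity the difference quotients increase to \<open>p\<close>, so monotone convergence applies.\<close>
  define q where "q n t = (\<sigma> (t + h n) - \<sigma> t) / h n" for n t
  have [measurable]: "q n \<in> borel_measurable borel" for n unfolding q_def by measurable
  have q0: "0 \<le> q n t" for n t using h[of n] \<sigma>mono[of t "t + h n"] by (simp add: q_def)
  have qinc: "q m t \<le> q n t" if "0 < t" "m \<le> n" for m n t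
    using concave_slope_antimono[OF conc, of t t "t + h n" "t + h m"] that h[of n] h[of m] hmono[of m n]
    by (simp add: q_def \<sigma>eq)
  have qanti: "q n w \<le> q n v" if "0 < v" "v \<le> w" for n v w
    using concave_slope_antimono[OF conc, of v w "v + h n" "w + h n"] that h[of n]
    by (simp add: q_def \<sigma>eq)
  \<comment> \<open>The slope of the chord from 0 bounds all quotients at \<open>t\<close>, which
    makes the increasing sequence convergent.\<close>
  have qbound: "q n t \<le> \<tau> t / t" if "0 < t" for n t
    using concave_slope_antimono[OF conc, of 0 t t "t + h n"] that h[of n]
    by (simp add: q_def \<sigma>eq zero)
  define p where "p t = (if 0 < t then lim (\<lambda>n. q n t) else 0)" for t
  have [measurable]: "p \<in> borel_measurable borel" unfolding p_def by measurable
  have qlim: "(\<lambda>n. q n t) \<longlonglongrightarrow> p t" if "0 < t" for t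
  proof -
    have "incseq (\<lambda>n. q n t)" using qinc[OF that] by (auto simp: incseq_def)
    then obtain L where "(\<lambda>n. q n t) \<longlonglongrightarrow> L"
      using incseq_convergent[of "\<lambda>n. q n t" "\<tau> t / t"] qbound[OF \<open>0 < t\<close>] by blast
    then show ?thesis using that by (simp add: p_def limI)
  qed
  show thesis
  proof (rule that, unfold_locales)
    show "p \<in> borel_measurable borel" by fact
    show "0 \<le> p w" for w
    proof (cases "0 < w")
      case True
      then show ?thesis using qlim q0 by (intro LIMSEQ_le_const[of "\<lambda>n. q n w"]) auto
    qed (simp add: p_def)
    show "p w \<le> p v" if "0 < v" "v \<le> w" for v w
      using that qanti by (intro LIMSEQ_le[OF qlim[of w] qlim[of v]]) auto
    show "0 \<le> \<tau> w" if "0 \<le> w" for w using mono[of 0 w] zero that by simp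
    fix w :: real assume w: "0 \<le> w"
    define I where "I n = integral {0..w} (q n)" for n
    have qcont: "continuous_on {0..w} (q n)" for n
      unfolding q_def using h[of n]
      by (intro continuous_intros continuous_on_compose2[OF \<sigma>cont, of _ "\<lambda>t. t + h n"] \<sigma>cont) auto
    have int: "\<sigma> integrable_on {a..b}" for a b by (intro integrable_continuous_interval \<sigma>cont)
    have I_eq: "I n = (integral {w..w + h n} \<sigma> - integral {0..h n} \<sigma>) / h n" for n
    proof -
      have "(\<lambda>t. \<sigma> (t + h n)) integrable_on {0..w}"
        by (intro integrable_continuous_interval continuous_on_compose2[OF \<sigma>cont, of _ "\<lambda>t. t + h n"] continuous_intros) auto
      then have "I n = (integral {0..w} (\<lambda>t. \<sigma> (t + h n)) - integral {0..w} \<sigma>) / h n"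
        unfolding I_def q_def using int[of 0 w]
        by (simp add: Henstock_Kurzweil_Integration.integral_diff integral_divide)
      also have "integral {0..w} (\<lambda>t. \<sigma> (t + h n)) = integral {h n..w + h n} \<sigma>"
        using integral_shift_real_ivl[of "h n" "h n" "w + h n" \<sigma>] by simp
      also have "\<dots> = integral {0..w + h n} \<sigma> - integral {0..h n} \<sigma>"
        using Henstock_Kurzweil_Integration.integral_combine[of 0 "h n" "w + h n" \<sigma>] int h[of n] w by auto
      also have "integral {0..w + h n} \<sigma> = integral {0..w} \<sigma> + integral {w..w + h n} \<sigma>"
        using Henstock_Kurzweil_Integration.integral_combine[of 0 w "w + h n" \<sigma>] int h[of n] w by auto
      finally show ?thesis by simp
    qed
    have const: "integral {a..a + h n} (\<lambda>_. k) = h n * k" for a k :: real and n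
      using h[of n] by simp
    have lower: "\<tau> w - \<tau> (h n) \<le> I n" for n
    proof -
      have "h n * \<sigma> w \<le> integral {w..w + h n} \<sigma>"
        unfolding const[symmetric, of _ _ w] by (intro integral_le int) (auto intro: \<sigma>mono)
      moreover have "integral {0..h n} \<sigma> \<le> h n * \<sigma> (h n)"
      proof -
        have "integral {0..h n} \<sigma> \<le> integral {0..h n} (\<lambda>_. \<sigma> (h n))"
          by (intro integral_le int integrable_const_ivl) (auto intro: \<sigma>mono)
        then show ?thesis using h[of n] by simp
      qed
      ultimately have "h n * (\<sigma> w - \<sigma> (h n)) \<le> integral {w..w + h n} \<sigma> - integral {0..h n} \<sigma>"
        by (simp add: algebra_simps)
      then show ?thesis using h[of n] w by (simp add: I_eq \<sigma>eq pos_le_divide_eq mult.commute)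
    qed
    have upper: "I n \<le> \<tau> (w + h n)" for n
    proof -
      have "integral {w..w + h n} \<sigma> \<le> h n * \<sigma> (w + h n)"
        unfolding const[symmetric, of _ _ w] by (intro integral_le int) (auto intro: \<sigma>mono)
      moreover have "0 \<le> integral {0..h n} \<sigma>"
        using \<sigma>mono[of 0] zero by (intro integral_nonneg int) (auto simp: \<sigma>_def)
      ultimately have "integral {w..w + h n} \<sigma> - integral {0..h n} \<sigma> \<le> h n * \<sigma> (w + h n)" by simp
      then show ?thesis using h[of n] w by (simp add: I_eq \<sigma>eq pos_divide_le_eq mult.commute)
    qed
    have lims: "(\<lambda>n. \<sigma> (w + h n)) \<longlonglongrightarrow> \<sigma> (w + 0)" "(\<lambda>n. \<sigma> w - \<sigma> (h n)) \<longlonglongrightarrow> \<sigma> w - \<sigma> 0"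
      by (intro tendsto_intros continuous_on_tendsto_compose[OF \<sigma>cont[of UNIV]] hlim; simp)+
    have Ilim: "I \<longlonglongrightarrow> \<tau> w"
    proof (rule tendsto_sandwich)
      show "\<forall>\<^sub>F n in sequentially. \<sigma> w - \<sigma> (h n) \<le> I n"
        using lower w h by (simp add: \<sigma>eq less_imp_le)
      show "\<forall>\<^sub>F n in sequentially. I n \<le> \<sigma> (w + h n)"
        using upper w h by (simp add: \<sigma>eq less_imp_le add_nonneg_nonneg)
    qed (use lims w zero in \<open>simp_all add: \<sigma>eq\<close>)
    let ?f = "\<lambda>n t. ennreal (q n t) * indicator {0<..<w} t"
    have "(\<lambda>n. \<integral>\<^sup>+ t. ?f n t \<partial>lborel) \<longlonglongrightarrow> (\<integral>\<^sup>+ t. ennreal (p t) * indicator {0<..<w} t \<partial>lborel)"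
    proof (rule nn_integral_LIMSEQ)
      show "incseq ?f"
        using qinc by (auto simp: incseq_def le_fun_def indicator_def intro!: ennreal_leI)
      show "(\<lambda>n. ?f n t) \<longlonglongrightarrow> ennreal (p t) * indicator {0<..<w} t" for t
        using qlim[of t] by (cases "0 < t \<and> t < w") (auto simp: indicator_def)
    qed measurable
    moreover have "(\<integral>\<^sup>+ t. ?f n t \<partial>lborel) = ennreal (I n)" for n
    proof -
      have "(\<integral>\<^sup>+ t. ?f n t \<partial>lborel) = (\<integral>\<^sup>+ t. ennreal (q n t) * indicator {0..w} t \<partial>lborel)"
      proof (intro nn_integral_cong_AE)
        show "AE t in lborel. ?f n t = ennreal (q n t) * indicator {0..w} t"
          using AE_lborel_singleton[of 0] AE_lborel_singleton[of w]
          by eventually_elim (auto simp: indicator_def)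
      qed
      also have "\<dots> = ennreal (I n)"
        unfolding I_def
        by (intro nn_integral_has_integral_lebesgue' q0 integrable_integral integrable_continuous_interval qcont)
      finally show ?thesis .
    qed
    ultimately have "(\<lambda>n. ennreal (I n)) \<longlonglongrightarrow> (\<integral>\<^sup>+ t. ennreal (p t) * indicator {0<..<w} t \<partial>lborel)"
      by simp
    moreover have "(\<lambda>n. ennreal (I n)) \<longlonglongrightarrow> ennreal (\<tau> w)" using Ilim by (rule tendsto_ennrealI)
    ultimately show "(\<integral>\<^sup>+ t. ennreal (p t) * indicator {0<..<w} t \<partial>lborel) = ennreal (\<tau> w)"
      by (rule LIMSEQ_unique)
  qed
qed

section \<open>Square roots, layer cakes and the Abel kernel\<close>

definition sqrtp :: "real \<Rightarrow> real" where "sqrtp u = sqrt (max 0 u)"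

lemma sqrtp_nonneg [simp]: "0 \<le> sqrtp u" by (simp add: sqrtp_def)

lemma sqrtp_measurable [measurable]: "sqrtp \<in> borel_measurable borel"
  unfolding sqrtp_def by measurable

lemma sqrtp_mono: "u \<le> v \<Longrightarrow> sqrtp u \<le> sqrtp v" by (simp add: sqrtp_def)

text \<open>The layer-cake density of the square root: its integral over \<open>s\<close> is
  \<open>sqrtp u\<close>. The truncated root is used because \<open>sqrt\<close> is an odd function
  on the reals, whereas negative arguments have to drop out here.\<close>

definition kern :: "real \<Rightarrow> real \<Rightarrow> ennreal" where
  "kern s u = (if 0 < s \<and> s < u then ennreal (1 / (2 * sqrt s)) else 0)"

lemma kern_measurable [measurable]:
  assumes [measurable]: "f \<in> borel_measurable M" "g \<in> borel_measurable M"
  shows "(\<lambda>x. kern (f x) (g x)) \<in> borel_measurable M"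
  unfolding kern_def by measurable

lemma nn_integral_kern: "(\<integral>\<^sup>+ s. kern s u \<partial>lborel) = ennreal (sqrtp u)"
proof (cases "u > 0")
  case True
  have "(\<integral>\<^sup>+ s. kern s u \<partial>lborel) = (\<integral>\<^sup>+ s. ennreal (s powr (- 1/2) * (1/2)) * indicator {0..u} s \<partial>lborel)"
  proof (intro nn_integral_cong_AE)
    show "AE s in lborel. kern s u = ennreal (s powr (- 1/2) * (1/2)) * indicator {0..u} s"
      using AE_lborel_singleton[of 0] AE_lborel_singleton[of u]
      by eventually_elim (auto simp: kern_def indicator_def powr_minus_divide powr_half_sqrt divide_simps)
  qed
  also have "\<dots> = ennreal (u powr (- 1/2 + 1) / (- 1/2 + 1) * (1/2))"
    using True by (intro nn_integral_has_integral_lebesgue' has_integral_mult_left has_integral_powr_from_0) auto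
  also have "u powr (- 1/2 + 1) / (- 1/2 + 1) * (1/2) = sqrtp u"
    using True by (simp add: sqrtp_def powr_half_sqrt)
  finally show ?thesis .
next
  case False
  then have "kern s u = 0" for s by (auto simp: kern_def)
  then show ?thesis using False by (simp add: sqrtp_def max_def)
qed

text \<open>The cut-off is at \<open>x powr (2/3)\<close>, and the antiderivative (2/3) f^(3/2) of
  the root returns \<open>x\<close> linearly. Hence the power 3/2 in the definition of
  \<open>z\<close>: the height integral is linear in the threshold.\<close>

lemma nn_integral_sqrt_below_real:
  assumes "0 \<le> x"
  shows "(\<integral>\<^sup>+ f. (if 0 < f \<and> f powr (3/2) < x then ennreal (sqrt f) else 0) \<partial>lborel) = ennreal (2/3 * x)"
proof -
  define m where "m = x powr (2/3)"
  have iff: "f powr (3/2) < x \<longleftrightarrow> f < m" if "0 < f" for f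
  proof (cases "x = 0")
    case False
    then have "x > 0" using assms by simp
    have "(f < m) = (f powr (3/2) < m powr (3/2))"
      using that powr_less_mono2[of "3/2" f m] powr_mono2[of "3/2" m f] by (force simp: m_def not_less[symmetric])
    also have "m powr (3/2) = x" using \<open>x > 0\<close> by (simp add: m_def powr_powr)
    finally show ?thesis by simp
  qed (use that in \<open>auto simp: m_def\<close>)
  have "(\<integral>\<^sup>+ f. (if 0 < f \<and> f powr (3/2) < x then ennreal (sqrt f) else 0) \<partial>lborel)
      = (\<integral>\<^sup>+ f. ennreal (f powr (1/2)) * indicator {0..m} f \<partial>lborel)"
  proof (intro nn_integral_cong_AE)
    show "AE f in lborel. (if 0 < f \<and> f powr (3/2) < x then ennreal (sqrt f) else 0) = ennreal (f powr (1/2)) * indicator {0..m} f"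
      using AE_lborel_singleton[of 0] AE_lborel_singleton[of m]
      by eventually_elim (auto simp: iff indicator_def powr_half_sqrt)
  qed
  also have "\<dots> = ennreal (m powr (1/2 + 1) / (1/2 + 1))"
    by (intro nn_integral_has_integral_lebesgue' has_integral_powr_from_0) (auto simp: m_def)
  also have "m powr (1/2 + 1) / (1/2 + 1) = 2/3 * x"
    using assms by (simp add: m_def powr_powr)
  finally show ?thesis .
qed

text \<open>The threshold has to range over \<open>ennreal\<close>, as \<open>N\<close> is infinite
  below the limit of \<open>p\<close> at infinity; finite thresholds exhaust the infinite
  one.\<close>

lemma nn_integral_sqrt_below:
  "(\<integral>\<^sup>+ f. (if 0 < f \<and> ennreal (f powr (3/2)) < x then ennreal (sqrt f) else 0) \<partial>lborel) = ennreal (2/3) * x"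
proof (cases x)
  case (real r)
  have "(\<integral>\<^sup>+ f. (if 0 < f \<and> ennreal (f powr (3/2)) < x then ennreal (sqrt f) else 0) \<partial>lborel)
     = (\<integral>\<^sup>+ f. (if 0 < f \<and> f powr (3/2) < r then ennreal (sqrt f) else 0) \<partial>lborel)"
    using real by (intro nn_integral_cong) (auto simp: ennreal_less_iff)
  also have "\<dots> = ennreal (2/3) * x"
    using real by (simp add: nn_integral_sqrt_below_real[of r] ennreal_mult[symmetric])
  finally show ?thesis .
next
  case top
  have "ennreal (real n) \<le> (\<integral>\<^sup>+ f. (if 0 < f \<and> ennreal (f powr (3/2)) < x then ennreal (sqrt f) else 0) \<partial>lborel)" for n
  proof -
    have "ennreal (real n) = (\<integral>\<^sup>+ f. (if 0 < f \<and> f powr (3/2) < 3/2 * real n then ennreal (sqrt f) else 0) \<partial>lborel)"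
      by (subst nn_integral_sqrt_below_real) auto
    also have "\<dots> \<le> (\<integral>\<^sup>+ f. (if 0 < f \<and> ennreal (f powr (3/2)) < x then ennreal (sqrt f) else 0) \<partial>lborel)"
      using top by (intro nn_integral_mono) auto
    finally show ?thesis .
  qed
  then have "(\<integral>\<^sup>+ f. (if 0 < f \<and> ennreal (f powr (3/2)) < x then ennreal (sqrt f) else 0) \<partial>lborel) = top" (is "?I = _")
  proof (cases ?I)
    case (real r)
    obtain n where "r < real n" using reals_Archimedean2 by blast
    then show ?thesis using \<open>\<And>n. ennreal (real n) \<le> ?I\<close>[of n] real by simp
  qed
  then show ?thesis using top by (simp add: ennreal_mult_top)
qed

text \<open>The Beta integral that remains when the Abel integral below is scaled to the unit
  interval; its value is pi/2.\<close>

definition abel_const :: real where "abel_const = Beta (1/2) (3/2)"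

lemma abel_const_pos: "0 < abel_const"
  by (simp add: abel_const_def Beta_def)

text \<open>The kernels s^(-1/2) and s^(1/2) convolve to a multiple of \<open>u\<close>, because
  scaling by \<open>u\<close> leaves a Beta integral. For \<open>u \<le> 0\<close> the factor
  \<open>sqrtp\<close> vanishes at every positive \<open>s\<close>, and \<open>ennreal\<close>
  truncates the right-hand side to 0.\<close>

lemma nn_integral_abel:
  "(\<integral>\<^sup>+ s. (if 0 < s then ennreal (1 / sqrt s) else 0) * ennreal (sqrtp (u - s)) \<partial>lborel) = ennreal (abel_const * u)"
proof (cases "u > 0")
  case True
  have "(\<integral>\<^sup>+ s. (if 0 < s then ennreal (1 / sqrt s) else 0) * ennreal (sqrtp (u - s)) \<partial>lborel)
    = ennreal \<bar>u\<bar> * (\<integral>\<^sup>+ s. (if 0 < 0 + u * s then ennreal (1 / sqrt (0 + u * s)) else 0) * ennreal (sqrtp (u - (0 + u * s))) \<partial>lborel)"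
    using True by (intro nn_integral_real_affine) auto
  also have "(\<integral>\<^sup>+ s. (if 0 < 0 + u * s then ennreal (1 / sqrt (0 + u * s)) else 0) * ennreal (sqrtp (u - (0 + u * s))) \<partial>lborel)
    = (\<integral>\<^sup>+ s. ennreal (s powr (1/2 - 1) * (1 - s) powr (3/2 - 1)) * indicator {0..1} s \<partial>lborel)"
  proof (intro nn_integral_cong)
    fix s :: real
    consider "s \<le> 0" | "s \<ge> 1" | "0 < s" "s < 1" by linarith
    then show "(if 0 < 0 + u * s then ennreal (1 / sqrt (0 + u * s)) else 0) * ennreal (sqrtp (u - (0 + u * s)))
      = ennreal (s powr (1/2 - 1) * (1 - s) powr (3/2 - 1)) * indicator {0..1} s"
    proof cases
      case 1
      then have "\<not> 0 < u * s" using True by (simp add: zero_less_mult_iff)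
      then show ?thesis using 1 by (auto simp: indicator_def)
    next
      case 2
      then have "u - u * s \<le> 0" using True by simp
      then show ?thesis using 2 by (auto simp: sqrtp_def indicator_def max_def)
    next
      case 3
      have "u - u * s = u * (1 - s)" by (simp add: algebra_simps)
      then have "1 / sqrt (u * s) * sqrtp (u - u * s) = s powr (1/2 - 1) * (1 - s) powr (3/2 - 1)"
        using 3 True by (simp add: sqrtp_def max_def real_sqrt_mult powr_half_sqrt powr_minus_divide)
      then show ?thesis using 3 True by (simp add: ennreal_mult'[symmetric])
    qed
  qed
  also have "\<dots> = ennreal abel_const"
    unfolding abel_const_def
    by (intro nn_integral_has_integral_lebesgue' has_integral_Beta_real) auto
  also have "ennreal \<bar>u\<bar> * ennreal abel_const = ennreal (abel_const * u)"
    using True abel_const_pos by (simp add: ennreal_mult[symmetric] mult.commute)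
  finally show ?thesis .
next
  case False
  then have "(\<integral>\<^sup>+ s. (if 0 < s then ennreal (1 / sqrt s) else 0) * ennreal (sqrtp (u - s)) \<partial>lborel) = (\<integral>\<^sup>+ (s::real). 0 \<partial>lborel)"
    by (intro nn_integral_cong) (auto simp: sqrtp_def max_def)
  also have "\<dots> = ennreal (abel_const * u)"
    using False abel_const_pos by (simp add: ennreal_neg mult_nonneg_nonpos)
  finally show ?thesis .
qed

section \<open>The mass-specific cost \<open>z\<close> and its inverse \<open>N\<close>\<close>

context cost_density
begin

text \<open>The constant is chosen such that the identity \<open>abel_identity\<close> below holds without a factor.\<close>

definition K :: real where "K = 3 / (2 * sqrt 2 * abel_const)"

lemma K_pos: "0 < K" using abel_const_pos by (simp add: K_def)

text \<open>Exchanging the layer cake of the root with the integral over \<open>w\<close> shows this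
  to be, up to the factor, a fractional integral of order 1/2 over r > s of the measure of {p > r}.
  It plays the role of the 3/2 power of the inverse function of \<open>z\<close>.\<close>

definition N :: "real \<Rightarrow> ennreal" where
  "N s = ennreal K * (\<integral>\<^sup>+ w. ennreal (sqrtp (p w - s)) * indicator {0<..} w \<partial>lborel)"

text \<open>A generalised inverse of \<open>N\<close>. The restriction \<open>0 \<le> s\<close>
  bounds the set below, and 0 for \<open>f \<le> 0\<close> is a default that keeps \<open>z\<close>
  nonnegative on the whole line.\<close>

definition z :: "real \<Rightarrow> real" where
  "z f = (if 0 < f then Inf {s. 0 \<le> s \<and> N s \<le> ennreal (f powr (3/2))} else 0)"

text \<open>The supremum of \<open>\<tau> w - l * w\<close> over \<open>w\<close>, a conjugate of
  \<tau>: as \<open>p\<close> is nonincreasing, the integral of \<open>p - l\<close> over an initial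
  interval is largest when it stops at the sign change.\<close>

definition G :: "real \<Rightarrow> ennreal" where
  "G l = (\<integral>\<^sup>+ w. ennreal (p w - l) * indicator {0<..} w \<partial>lborel)"

lemma N_antimono: "s \<le> t \<Longrightarrow> N t \<le> N s"
  unfolding N_def by (intro mult_left_mono nn_integral_mono mult_right_mono ennreal_leI sqrtp_mono) auto

lemma N_measurable [measurable]: "N \<in> borel_measurable borel"
  unfolding N_def by measurable

text \<open>By this one-sided continuity the infimum defining \<open>z\<close> is attained.\<close>

lemma N_le_of_right_limit:
  assumes "\<And>t. s < t \<Longrightarrow> N t \<le> x"
  shows "N s \<le> x"
proof -
  define h where "h n = 1 / real (Suc n)" for n
  have h: "h n > 0" for n by (simp add: h_def)
  have hmono: "h n \<le> h m" if "m \<le> n" for m n using that by (simp add: h_def frac_le)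
  have hlim: "h \<longlonglongrightarrow> 0"
    unfolding h_def using LIMSEQ_inverse_real_of_nat by (simp add: inverse_eq_divide)
  let ?f = "\<lambda>n w. ennreal (sqrtp (p w - (s + h n))) * indicator {0<..} w"
  have "(\<lambda>n. \<integral>\<^sup>+ w. ?f n w \<partial>lborel) \<longlonglongrightarrow> (\<integral>\<^sup>+ w. ennreal (sqrtp (p w - s)) * indicator {0<..} w \<partial>lborel)"
  proof (rule nn_integral_LIMSEQ)
    show "incseq ?f"
      using hmono by (auto simp: incseq_def le_fun_def intro!: mult_right_mono ennreal_leI sqrtp_mono)
    show "(\<lambda>n. ?f n w) \<longlonglongrightarrow> ennreal (sqrtp (p w - s)) * indicator {0<..} w" for w
    proof -
      have "(\<lambda>n. sqrt (max 0 (p w - (s + h n)))) \<longlonglongrightarrow> sqrt (max 0 (p w - (s + 0)))"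
        by (intro tendsto_intros hlim)
      then show ?thesis
        by (cases "0 < w") (auto simp: sqrtp_def intro: tendsto_ennrealI)
    qed
  qed measurable
  then have "(\<lambda>n. N (s + h n)) \<longlonglongrightarrow> N s"
    unfolding N_def by (intro ennreal_tendsto_cmult) auto
  then show ?thesis
    using assms h by (intro LIMSEQ_le_const2[of "\<lambda>n. N (s + h n)"]) auto
qed

text \<open>Where the root is nonzero one has p > s, hence sqrt(p - s) \<le> p / sqrt s, and such
  points lie to the left of \<open>w\<close>. The bound gives both finiteness of \<open>N\<close>
  and its decay for large \<open>s\<close>.\<close>

lemma N_bound:
  assumes "0 < s" "p w \<le> s" "0 < w"
  shows "N s \<le> ennreal (K * \<tau> w / sqrt s)"
proof -
  have pw: "sqrtp (p t - s) \<le> p t / sqrt s" "0 < t \<Longrightarrow> s < p t \<Longrightarrow> t < w" for t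
  proof -
    show "sqrtp (p t - s) \<le> p t / sqrt s"
    proof (cases "s < p t")
      case True
      have "sqrtp (p t - s) \<le> sqrt (p t)" using assms True by (simp add: sqrtp_def)
      also have "sqrt (p t) * sqrt s \<le> sqrt (p t) * sqrt (p t)"
        using True assms by (intro mult_left_mono) auto
      then have "sqrt (p t) \<le> p t / sqrt s" using True assms by (simp add: pos_le_divide_eq)
      finally show ?thesis .
    qed (use assms p_nonneg[of t] in \<open>auto simp: sqrtp_def max_def\<close>)
    show "t < w" if "0 < t" "s < p t"
      using p_antimono[of w t] assms that by (cases "t < w") auto
  qed
  have "(\<integral>\<^sup>+ t. ennreal (sqrtp (p t - s)) * indicator {0<..} t \<partial>lborel)
     \<le> (\<integral>\<^sup>+ t. ennreal (1 / sqrt s) * (ennreal (p t) * indicator {0<..<w} t) \<partial>lborel)"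
  proof (intro nn_integral_mono)
    fix t
    show "ennreal (sqrtp (p t - s)) * indicator {0<..} t \<le> ennreal (1 / sqrt s) * (ennreal (p t) * indicator {0<..<w} t)"
    proof (cases "0 < t \<and> s < p t")
      case True
      then show ?thesis using pw[of t] assms p_nonneg[of t]
        by (simp add: ennreal_mult[symmetric])
    next
      case False
      then have "sqrtp (p t - s) = 0 \<or> \<not> 0 < t" by (auto simp: sqrtp_def max_def)
      then show ?thesis by auto
    qed
  qed
  also have "\<dots> = ennreal (1 / sqrt s) * ennreal (\<tau> w)"
    using p_integral[of w] assms by (simp add: nn_integral_cmult)
  finally have "N s \<le> ennreal K * (ennreal (1 / sqrt s) * ennreal (\<tau> w))"
    unfolding N_def by (intro mult_left_mono) auto
  also have "\<dots> = ennreal (K * \<tau> w / sqrt s)"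
    using assms K_pos \<tau>_nonneg[of w] by (simp add: ennreal_mult[symmetric])
  finally show ?thesis .
qed

text \<open>The Galois connection between \<open>z\<close> and \<open>N\<close>, through which
  \<open>z\<close> is handled from here on. The defining set is nonempty because \<open>N\<close>
  tends to zero, and its infimum is attained by the one-sided continuity of
  \<open>N\<close>.\<close>

lemma z_le_iff:
  assumes f: "0 < f" and s: "0 \<le> s"
  shows "z f \<le> s \<longleftrightarrow> N s \<le> ennreal (f powr (3/2))"
proof -
  let ?S = "{s. 0 \<le> s \<and> N s \<le> ennreal (f powr (3/2))}"
  have ne: "?S \<noteq> {}"
  proof -
    define a where "a = f powr (3/2)"
    have a: "a > 0" using f by (simp add: a_def)
    \<comment> \<open>\<open>t \<ge> p 1\<close> makes \<open>N_bound\<close> applicable at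
      \<open>w = 1\<close>; the square makes the resulting bound at most \<open>a\<close>.\<close>
    define t where "t = max (max 1 (p 1)) ((K * \<tau> 1 / a)\<^sup>2)"
    have t: "t \<ge> 1" "t \<ge> p 1" "t \<ge> (K * \<tau> 1 / a)\<^sup>2" by (auto simp: t_def)
    have k0: "K * \<tau> 1 \<ge> 0" using K_pos \<tau>_nonneg[of 1] by simp
    have "K * \<tau> 1 / a \<le> sqrt t" using t(3) k0 a by (intro real_le_rsqrt) auto
    then have "K * \<tau> 1 / sqrt t \<le> a" using a t by (simp add: field_simps)
    then have "N t \<le> ennreal a"
      using N_bound[of t 1] t by (auto intro: order_trans ennreal_leI)
    then show ?thesis using t by (auto simp: a_def intro!: exI[of _ t])
  qed
  have bdd: "bdd_below ?S" by (rule bdd_belowI[of _ 0]) auto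
  show ?thesis
  proof
    assume "N s \<le> ennreal (f powr (3/2))"
    then show "z f \<le> s" unfolding z_def using f s bdd by (auto intro: cInf_lower)
  next
    assume zs: "z f \<le> s"
    show "N s \<le> ennreal (f powr (3/2))"
    proof (rule N_le_of_right_limit)
      fix t assume "s < t"
      then have "Inf ?S < t" using zs f by (simp add: z_def)
      then obtain r where "r \<in> ?S" "r < t" using cInf_lessD[OF ne] by blast
      then show "N t \<le> ennreal (f powr (3/2))" using N_antimono[of r t] by auto
    qed
  qed
qed

lemma z_nonneg: "0 \<le> z f"
proof (cases "0 < f")
  case True
  show ?thesis
  proof (rule ccontr)
    assume "\<not> 0 \<le> z f"
    then have "N 0 \<le> ennreal (f powr (3/2))" using z_le_iff[OF True, of 0] by simp
    then have "0 \<in> {s. 0 \<le> s \<and> N s \<le> ennreal (f powr (3/2))}" by simp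
    then have "0 \<le> Inf {s. 0 \<le> s \<and> N s \<le> ennreal (f powr (3/2))}"
      by (intro cInf_greatest) auto
    then show False using \<open>\<not> 0 \<le> z f\<close> True by (simp add: z_def)
  qed
qed (simp add: z_def)

lemma z_antimono:
  assumes "0 < f" "f \<le> f'"
  shows "z f' \<le> z f"
proof -
  have "N (z f) \<le> ennreal (f powr (3/2))" using z_le_iff[of f "z f"] assms z_nonneg by simp
  also have "\<dots> \<le> ennreal (f' powr (3/2))" using assms by (intro ennreal_leI powr_mono2) auto
  finally show ?thesis using z_le_iff[of f' "z f"] assms z_nonneg by simp
qed

lemma z_measurable [measurable]: "z \<in> borel_measurable borel"
proof (rule borel_measurableI_greater)
  fix a
  show "{x \<in> space borel. a < z x} \<in> sets borel"
  proof (cases "0 \<le> a")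
    case True
    have "{x. a < z x} = {x. 0 < x \<and> ennreal (x powr (3/2)) < N a}"
    proof (intro Collect_cong)
      fix x
      show "a < z x \<longleftrightarrow> 0 < x \<and> ennreal (x powr (3/2)) < N a"
        using z_le_iff[OF _ True, of x] True by (cases "0 < x") (auto simp: not_le[symmetric] z_def)
    qed
    then show ?thesis by simp
  next
    case False
    then have "a < z x" for x using z_nonneg[of x] by linarith
    then have "{x. a < z x} = UNIV" by auto
    then show ?thesis by simp
  qed
qed

text \<open>For \<open>a \<ge> 0\<close> the condition \<open>z y > a\<close> reads y^(3/2) < N a,
  which is open because the power is continuous. Negative \<open>a\<close> lie below all values of
  \<open>z\<close>.\<close>

lemma z_lsc: "lsc_on {0<..} z"
  unfolding lsc_on_def
proof (intro ballI allI impI)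
  fix x a assume x: "x \<in> {0<..}" and a: "a < z x"
  show "\<exists>e>0. \<forall>y\<in>{0<..}. \<bar>y - x\<bar> < e \<longrightarrow> a < z y"
  proof (cases "0 \<le> a")
    case True
    define U where "U = {y. ennreal (y powr (3/2)) < N a} \<inter> {0<..}"
    have "continuous_on {0<..} (\<lambda>y::real. ennreal (y powr (3/2)))"
      by (intro continuous_on_ennreal continuous_intros) auto
    then have "open ({0<..} \<inter> (\<lambda>y::real. ennreal (y powr (3/2))) -` {..<N a})"
      by (rule continuous_open_preimage) auto
    then have "open U" by (simp add: U_def vimage_def Int_commute)
    moreover have "x \<in> U" using x a True z_le_iff[of x a] by (auto simp: U_def not_le)
    ultimately obtain e where "e > 0" "\<And>y. dist y x < e \<Longrightarrow> y \<in> U" unfolding open_dist by blast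
    then have "\<forall>y\<in>{0<..}. \<bar>y - x\<bar> < e \<longrightarrow> a < z y"
      using True z_le_iff[of _ a] by (auto simp: dist_real_def U_def not_le[symmetric])
    then show ?thesis using \<open>e > 0\<close> by blast
  next
    case False
    then have "a < z y" for y using z_nonneg[of y] by linarith
    then show ?thesis by (intro exI[of _ 1]) auto
  qed
qed

text \<open>Cutting sqrt(z - l) into layers and integrating over the heights first leaves (2/3) N(l
  + s) against a multiple of 1 / sqrt s. Inserting the definition of \<open>N\<close> produces, for
  each \<open>w\<close>, the Abel integral with u = p w - l.\<close>

lemma abel_identity:
  assumes "0 \<le> l"
  shows "(\<integral>\<^sup>+ f. ennreal (2 * sqrt 2 * (sqrtp f * sqrtp (z f - l))) \<partial>lborel) = G l"
proof -
  have "(\<integral>\<^sup>+ f. ennreal (2 * sqrt 2 * (sqrtp f * sqrtp (z f - l))) \<partial>lborel)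
     = (\<integral>\<^sup>+ f. ennreal (2 * sqrt 2 * sqrtp f) * (\<integral>\<^sup>+ s. kern s (z f - l) \<partial>lborel) \<partial>lborel)"
    by (intro nn_integral_cong) (simp add: nn_integral_kern ennreal_mult[symmetric] mult.assoc)
  also have "\<dots> = (\<integral>\<^sup>+ f. (\<integral>\<^sup>+ s. ennreal (2 * sqrt 2 * sqrtp f) * kern s (z f - l) \<partial>lborel) \<partial>lborel)"
    by (intro nn_integral_cong nn_integral_cmult[symmetric]) measurable
  also have "\<dots> = (\<integral>\<^sup>+ s. (\<integral>\<^sup>+ f. ennreal (2 * sqrt 2 * sqrtp f) * kern s (z f - l) \<partial>lborel) \<partial>lborel)"
    by (rule lborel_pair.Fubini') measurable
  also have "\<dots> = (\<integral>\<^sup>+ s. (if 0 < s then ennreal (sqrt 2 / sqrt s) else 0) * (ennreal (2/3) * N (l + s)) \<partial>lborel)"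
  proof (intro nn_integral_cong)
    fix s :: real
    have "ennreal (2 * sqrt 2 * sqrtp f) * kern s (z f - l)
       = (if 0 < s then ennreal (sqrt 2 / sqrt s) else 0) *
         (if 0 < f \<and> ennreal (f powr (3/2)) < N (l + s) then ennreal (sqrt f) else 0)" for f
    proof (cases "0 < s \<and> 0 < f")
      case True
      then have "s < z f - l \<longleftrightarrow> ennreal (f powr (3/2)) < N (l + s)"
        using z_le_iff[of f "l + s"] assms by (auto simp: not_le[symmetric])
      then show ?thesis using True
        by (auto simp: kern_def sqrtp_def max_def ennreal_mult[symmetric])
    next
      case False
      then show ?thesis by (auto simp: kern_def sqrtp_def max_def)
    qed
    then show "(\<integral>\<^sup>+ f. ennreal (2 * sqrt 2 * sqrtp f) * kern s (z f - l) \<partial>lborel)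
       = (if 0 < s then ennreal (sqrt 2 / sqrt s) else 0) * (ennreal (2/3) * N (l + s))"
      by (simp only: nn_integral_cmult nn_integral_sqrt_below[symmetric]) (rule nn_integral_cmult, measurable)
  qed
  also have "\<dots> = (\<integral>\<^sup>+ s. (\<integral>\<^sup>+ w. ennreal (sqrt 2 * (2/3) * K) * ((if 0 < s then ennreal (1 / sqrt s) else 0) *
       ennreal (sqrtp (p w - l - s))) * indicator {0<..} w \<partial>lborel) \<partial>lborel)"
  proof (intro nn_integral_cong)
    fix s :: real
    have "(if 0 < s then ennreal (sqrt 2 / sqrt s) else 0) * (ennreal (2/3) * N (l + s))
       = (ennreal (sqrt 2 * (2/3) * K) * (if 0 < s then ennreal (1 / sqrt s) else 0)) *
         (\<integral>\<^sup>+ w. ennreal (sqrtp (p w - l - s)) * indicator {0<..} w \<partial>lborel)"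
      using K_pos by (simp add: N_def diff_diff_eq mult.assoc[symmetric] ennreal_mult[symmetric]) (simp add: mult.commute)
    also have "\<dots> = (\<integral>\<^sup>+ w. (ennreal (sqrt 2 * (2/3) * K) * (if 0 < s then ennreal (1 / sqrt s) else 0)) *
        (ennreal (sqrtp (p w - l - s)) * indicator {0<..} w) \<partial>lborel)"
      by (intro nn_integral_cmult[symmetric]) measurable
    finally show "(if 0 < s then ennreal (sqrt 2 / sqrt s) else 0) * (ennreal (2/3) * N (l + s))
      = (\<integral>\<^sup>+ w. ennreal (sqrt 2 * (2/3) * K) * ((if 0 < s then ennreal (1 / sqrt s) else 0) *
       ennreal (sqrtp (p w - l - s))) * indicator {0<..} w \<partial>lborel)"
      by (simp only: mult.assoc)
  qed
  also have "\<dots> = (\<integral>\<^sup>+ w. (\<integral>\<^sup>+ s. ennreal (sqrt 2 * (2/3) * K) * ((if 0 < s then ennreal (1 / sqrt s) else 0) *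
       ennreal (sqrtp (p w - l - s))) * indicator {0<..} w \<partial>lborel) \<partial>lborel)"
    by (rule lborel_pair.Fubini') measurable
  also have "\<dots> = (\<integral>\<^sup>+ w. ennreal (sqrt 2 * (2/3) * K) * ennreal (abel_const * (p w - l)) * indicator {0<..} w \<partial>lborel)"
    by (intro nn_integral_cong) (simp add: nn_integral_cmult nn_integral_multc nn_integral_abel)
  also have "\<dots> = G l"
    unfolding G_def
  proof (intro nn_integral_cong arg_cong2[where f = "(*)"] refl)
    fix w
    have "sqrt 2 * (2/3) * K * (abel_const * (p w - l)) = p w - l"
      using abel_const_pos by (simp add: K_def field_simps)
    moreover have "ennreal (sqrt 2 * (2/3) * K) * ennreal (abel_const * (p w - l)) = ennreal (sqrt 2 * (2/3) * K * (abel_const * (p w - l)))"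
      using K_pos by (intro ennreal_mult'[symmetric]) auto
    ultimately show "ennreal (sqrt 2 * (2/3) * K) * ennreal (abel_const * (p w - l)) = ennreal (p w - l)"
      by (simp only:)
  qed
  finally show ?thesis .
qed

section \<open>Duality between \<tau> and \<open>G\<close>\<close>

lemma \<tau>_le_G:
  assumes "0 \<le> w" "0 \<le> l"
  shows "ennreal (\<tau> w) \<le> G l + ennreal (l * w)"
proof -
  have "ennreal (\<tau> w) = (\<integral>\<^sup>+ t. ennreal (p t) * indicator {0<..<w} t \<partial>lborel)"
    using p_integral assms by simp
  also have "\<dots> \<le> (\<integral>\<^sup>+ t. ennreal (p t - l) * indicator {0<..} t + ennreal l * indicator {0<..<w} t \<partial>lborel)"
  proof (intro nn_integral_mono)
    fix t
    have "ennreal (p t) \<le> ennreal (p t - l) + ennreal l"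
      using assms by (cases "p t \<ge> l") (auto simp: ennreal_plus[symmetric] ennreal_neg simp del: ennreal_plus intro: ennreal_leI)
    then show "ennreal (p t) * indicator {0<..<w} t \<le> ennreal (p t - l) * indicator {0<..} t + ennreal l * indicator {0<..<w} t"
      by (auto simp: indicator_def)
  qed
  also have "\<dots> = G l + ennreal (l * w)"
    using assms by (simp add: nn_integral_add G_def nn_integral_cmult ennreal_mult)
  finally show ?thesis .
qed

text \<open>Monotonicity of \<open>p\<close> makes \<open>p t - p w\<close> nonnegative before
  \<open>w\<close> and nonpositive after it, so the two integrands combine to \<open>p\<close> cut
  off at \<open>w\<close>.\<close>

lemma G_at_density:
  assumes "0 < w"
  shows "G (p w) + ennreal (p w * w) = ennreal (\<tau> w)"
proof -
  have "ennreal (p w * w) = (\<integral>\<^sup>+ t. ennreal (p w) * indicator {0<..<w} t \<partial>lborel)"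
    using assms p_nonneg[of w] by (simp add: nn_integral_cmult ennreal_mult)
  then have "G (p w) + ennreal (p w * w) = (\<integral>\<^sup>+ t. ennreal (p t - p w) * indicator {0<..} t + ennreal (p w) * indicator {0<..<w} t \<partial>lborel)"
    by (simp add: nn_integral_add G_def)
  also have "\<dots> = (\<integral>\<^sup>+ t. ennreal (p t) * indicator {0<..<w} t \<partial>lborel)"
  proof (intro nn_integral_cong)
    fix t
    consider "t \<le> 0" | "0 < t" "t < w" | "w \<le> t" by linarith
    then show "ennreal (p t - p w) * indicator {0<..} t + ennreal (p w) * indicator {0<..<w} t = ennreal (p t) * indicator {0<..<w} t"
    proof cases
      case 2
      then have "p w \<le> p t" using p_antimono by auto
      then show ?thesis using 2 p_nonneg[of w] by (simp add: ennreal_plus[symmetric] del: ennreal_plus)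
    next
      case 3
      then have "p t \<le> p w" using p_antimono assms by auto
      then show ?thesis using 3 by (simp add: ennreal_neg)
    qed simp
  qed
  also have "\<dots> = ennreal (\<tau> w)" using p_integral assms by simp
  finally show ?thesis .
qed

text \<open>Beyond \<open>w\<close> the positive part of \<open>p - l\<close> vanishes, so lowering
  the level by \<open>d\<close> gains at most \<open>d\<close> on an interval of length
  \<open>w\<close>. This difference quotient of \<open>G\<close> later bounds the mass of a
  profile.\<close>

lemma G_diff_le:
  assumes "0 < w" "p w \<le> l" "0 \<le> d"
  shows "G l \<le> G (l + d) + ennreal (d * w)"
proof -
  have "G l \<le> (\<integral>\<^sup>+ t. ennreal (p t - (l + d)) * indicator {0<..} t + ennreal d * indicator {0<..<w} t \<partial>lborel)"
    unfolding G_def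
  proof (intro nn_integral_mono)
    fix t
    consider "t \<le> 0" | "0 < t" "t < w" | "w \<le> t" by linarith
    then show "ennreal (p t - l) * indicator {0<..} t \<le> ennreal (p t - (l + d)) * indicator {0<..} t + ennreal d * indicator {0<..<w} t"
    proof cases
      case 2
      have "ennreal (p t - l) \<le> ennreal (p t - (l + d)) + ennreal d"
        using assms by (cases "p t \<ge> l + d") (auto simp: ennreal_plus[symmetric] ennreal_neg simp del: ennreal_plus intro: ennreal_leI)
      then show ?thesis using 2 by simp
    next
      case 3
      then have "p t \<le> l" using p_antimono[of w t] assms by auto
      then show ?thesis by (simp add: ennreal_neg)
    qed simp
  qed
  also have "\<dots> = G (l + d) + ennreal (d * w)"
    using assms by (simp add: nn_integral_add G_def nn_integral_cmult ennreal_mult)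
  finally show ?thesis .
qed

end

section \<open>Lower bound on the energy\<close>

text \<open>Take \<open>t\<close> as the first point where \<beta> is reached and \<open>s\<close>
  as the last point before \<open>t\<close> with value at most \<alpha>; compactness provides
  both.\<close>

lemma crossing_interval:
  fixes f :: "real \<Rightarrow> real"
  assumes cont: "continuous_on {a..b} f" and "a \<le> b" "f a < \<alpha>" "\<alpha> < \<beta>" "\<beta> \<le> f b"
  obtains s t where "a \<le> s" "s < t" "t \<le> b" "f s \<le> \<alpha>" "\<beta> \<le> f t"
    "\<And>y. y \<in> {s<..<t} \<Longrightarrow> \<alpha> < f y \<and> f y < \<beta>"
proof -
  define T where "T = {a..b} \<inter> f -` {\<beta>..}"
  have "closed T" unfolding T_def by (rule continuous_closed_preimage[OF cont]) auto
  then have "compact T" by (auto simp: compact_eq_bounded_closed T_def intro: bounded_subset[of "{a..b}"])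
  moreover have "b \<in> T" using assms by (auto simp: T_def)
  ultimately obtain t where t: "t \<in> T" "\<And>y. y \<in> T \<Longrightarrow> t \<le> y" using compact_attains_inf[of T] by (metis empty_iff)
  have tab: "a \<le> t" "t \<le> b" "\<beta> \<le> f t" using t by (auto simp: T_def)
  define S where "S = {a..t} \<inter> f -` {..\<alpha>}"
  have "closed S" unfolding S_def
    using tab by (intro continuous_closed_preimage continuous_on_subset[OF cont]) auto
  then have "compact S" by (auto simp: compact_eq_bounded_closed S_def intro: bounded_subset[of "{a..t}"])
  moreover have "a \<in> S" using assms tab by (auto simp: S_def)
  ultimately obtain s where s: "s \<in> S" "\<And>y. y \<in> S \<Longrightarrow> y \<le> s" using compact_attains_sup[of S] by (metis empty_iff)
  have sab: "a \<le> s" "s \<le> t" "f s \<le> \<alpha>" using s by (auto simp: S_def)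
  show thesis
  proof (rule that[of s t])
    show "s < t" using sab tab assms by (cases "s = t") auto
    fix y assume y: "y \<in> {s<..<t}"
    have "y \<notin> S" using s(2)[of y] y by auto
    moreover have "y \<notin> T" using t(2)[of y] y by auto
    ultimately show "\<alpha> < f y \<and> f y < \<beta>" using y sab tab by (auto simp: S_def T_def)
  qed (use sab tab in auto)
qed

lemma primitive_variation_bound:
  assumes g: "locally_integrable g" and f: "primitive_of g f" and "s \<le> t"
  shows "ennreal \<bar>f t - f s\<bar> \<le> (\<integral>\<^sup>+ y. ennreal \<bar>g y\<bar> * indicator {s<..<t} y \<partial>lborel)"
proof -
  have "ennreal \<bar>f t - f s\<bar> = ennreal (norm (\<integral>y. indicator {s..t} y *\<^sub>R g y \<partial>lborel))"
    using f \<open>s \<le> t\<close> by (simp add: primitive_of_def set_lebesgue_integral_def)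
  also have "\<dots> \<le> (\<integral>\<^sup>+ y. ennreal (norm (indicator {s..t} y *\<^sub>R g y)) \<partial>lborel)"
    using g unfolding locally_integrable_def set_integrable_def by (intro integral_norm_bound_ennreal) auto
  also have "\<dots> = (\<integral>\<^sup>+ y. ennreal \<bar>g y\<bar> * indicator {s<..<t} y \<partial>lborel)"
  proof (intro nn_integral_cong_AE)
    show "AE y in lborel. ennreal (norm (indicator {s..t} y *\<^sub>R g y)) = ennreal \<bar>g y\<bar> * indicator {s<..<t} y"
      using AE_lborel_singleton[of s] AE_lborel_singleton[of t]
      by eventually_elim (auto simp: indicator_def)
  qed
  finally show ?thesis .
qed

text \<open>If the absolute value of \<open>f\<close> were at least \<alpha> on all
  \<open>A n\<close>, its integral would be at least every \<open>\<alpha> * n\<close>. With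
  intervals growing to one side this finds small values on either side of a peak, in place of decay
  at infinity.\<close>

lemma integrable_small_value:
  fixes f :: "real \<Rightarrow> real"
  assumes "integrable lborel f" "0 < \<alpha>" "\<And>n. emeasure lborel (A n) = ennreal (real n)"
    "\<And>n::nat. A n \<in> sets borel"
  obtains n y where "y \<in> A n" "\<bar>f y\<bar> < \<alpha>"
proof (rule ccontr)
  assume "\<not> thesis"
  with that have ge: "\<alpha> \<le> \<bar>f y\<bar>" if "y \<in> A n" for y n using that by (meson not_le)
  have fin: "(\<integral>\<^sup>+ y. ennreal \<bar>f y\<bar> \<partial>lborel) < \<infinity>" using assms(1) by (simp add: integrable_iff_bounded)
  then obtain r where r: "(\<integral>\<^sup>+ y. ennreal \<bar>f y\<bar> \<partial>lborel) = ennreal r" "0 \<le> r"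
    by (cases "\<integral>\<^sup>+ y. ennreal \<bar>f y\<bar> \<partial>lborel") auto
  obtain n where n: "r / \<alpha> < real n" using reals_Archimedean2 by blast
  have "ennreal (\<alpha> * real n) = (\<integral>\<^sup>+ y. ennreal \<alpha> * indicator (A n) y \<partial>lborel)"
    using assms by (simp add: nn_integral_cmult ennreal_mult)
  also have "\<dots> \<le> (\<integral>\<^sup>+ y. ennreal \<bar>f y\<bar> \<partial>lborel)"
    using ge by (intro nn_integral_mono) (auto simp: indicator_def intro: ennreal_leI)
  finally show False using r n \<open>0 < \<alpha>\<close> by (simp add: field_simps)
qed

text \<open>Between a peak and small values on either side of it lie two disjoint crossings of the
  band from \<alpha> to \<beta>, each with variation at least \<open>\<beta> - \<alpha>\<close>.
  This matches the factor two in the energy of a profile with two flanks.\<close>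

lemma level_flux_bound:
  assumes g: "locally_integrable g" and f: "primitive_of g f" and int: "integrable lborel f"
    and ab: "0 < \<alpha>" "\<alpha> < \<beta>" "\<beta> \<le> \<bar>f y0\<bar>"
  shows "ennreal (2 * (\<beta> - \<alpha>)) \<le> (\<integral>\<^sup>+ y. ennreal \<bar>g y\<bar> * indicator {y. \<alpha> < \<bar>f y\<bar> \<and> \<bar>f y\<bar> < \<beta>} y \<partial>lborel)"
proof -
  have [measurable]: "g \<in> borel_measurable borel" using g by (simp add: locally_integrable_def)
  have cont: "continuous_on A f" for A
    using primitive_of_continuous[OF g f] continuous_on_subset by blast
  \<comment> \<open>Multiplying by the sign of the peak makes it positive, so a competitor that
    changes sign needs no separate case.\<close>
  define F where "F y = sgn (f y0) * f y" for y
  have F0: "\<beta> \<le> F y0" using ab by (simp add: F_def abs_sgn mult.commute)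
  have sg: "\<bar>sgn (f y0)\<bar> = 1" using ab by (auto simp: abs_sgn_eq)
  have F: "\<bar>F y\<bar> = \<bar>f y\<bar>" "\<bar>F y - F x\<bar> = \<bar>f y - f x\<bar>" for x y
    using sg by (simp_all add: F_def abs_mult flip: right_diff_distrib)
  have contF: "continuous_on A F" for A unfolding F_def by (intro continuous_intros cont)
  obtain n1 a where a: "a \<in> {y0 - real n1..y0}" "\<bar>f a\<bar> < \<alpha>"
    by (rule integrable_small_value[OF int ab(1), of "\<lambda>n. {y0 - real n..y0}"]) auto
  obtain n2 b where b: "b \<in> {y0..y0 + real n2}" "\<bar>f b\<bar> < \<alpha>"
    by (rule integrable_small_value[OF int ab(1), of "\<lambda>n. {y0..y0 + real n}"]) auto
  obtain s1 t1 where 1: "s1 < t1" "t1 \<le> y0" "F s1 \<le> \<alpha>" "\<beta> \<le> F t1" "\<And>y. y \<in> {s1<..<t1} \<Longrightarrow> \<alpha> < F y \<and> F y < \<beta>"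
    using a F(1)[of a] by (rule_tac crossing_interval[OF contF, of a y0 \<alpha> \<beta>]) (use ab F0 in auto)
  obtain s2 t2 where 2: "s2 < t2" "t2 \<le> - y0" "F (- s2) \<le> \<alpha>" "\<beta> \<le> F (- t2)" "\<And>y. y \<in> {s2<..<t2} \<Longrightarrow> \<alpha> < F (- y) \<and> F (- y) < \<beta>"
  proof (rule crossing_interval[of "- b" "- y0" "\<lambda>y. F (- y)" \<alpha> \<beta>])
    show "continuous_on {- b..- y0} (\<lambda>y. F (- y))"
      by (rule continuous_on_compose2[OF contF[of UNIV]]) (auto intro: continuous_intros)
  qed (use b F(1)[of b] ab F0 in auto)
  have "ennreal (\<beta> - \<alpha>) \<le> ennreal \<bar>f t1 - f s1\<bar>"
    using 1 F(2)[of t1 s1] by (intro ennreal_leI) auto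
  also have "\<dots> \<le> (\<integral>\<^sup>+ y. ennreal \<bar>g y\<bar> * indicator {s1<..<t1} y \<partial>lborel)"
    using 1 by (intro primitive_variation_bound[OF g f]) auto
  finally have I1: "ennreal (\<beta> - \<alpha>) \<le> (\<integral>\<^sup>+ y. ennreal \<bar>g y\<bar> * indicator {s1<..<t1} y \<partial>lborel)" .
  have "ennreal (\<beta> - \<alpha>) \<le> ennreal \<bar>f (- s2) - f (- t2)\<bar>"
    using 2 F(2)[of "-s2" "-t2"] by (intro ennreal_leI) auto
  also have "\<dots> \<le> (\<integral>\<^sup>+ y. ennreal \<bar>g y\<bar> * indicator {- t2<..<- s2} y \<partial>lborel)"
    using 2 by (intro primitive_variation_bound[OF g f]) auto
  finally have I2: "ennreal (\<beta> - \<alpha>) \<le> (\<integral>\<^sup>+ y. ennreal \<bar>g y\<bar> * indicator {- t2<..<- s2} y \<partial>lborel)" .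
  have "ennreal (2 * (\<beta> - \<alpha>)) = ennreal (\<beta> - \<alpha>) + ennreal (\<beta> - \<alpha>)"
    using ab by (simp add: ennreal_plus[symmetric] del: ennreal_plus)
  also have "\<dots> \<le> (\<integral>\<^sup>+ y. ennreal \<bar>g y\<bar> * indicator {s1<..<t1} y \<partial>lborel) + (\<integral>\<^sup>+ y. ennreal \<bar>g y\<bar> * indicator {- t2<..<- s2} y \<partial>lborel)"
    by (intro add_mono I1 I2)
  also have "\<dots> = (\<integral>\<^sup>+ y. ennreal \<bar>g y\<bar> * indicator {s1<..<t1} y + ennreal \<bar>g y\<bar> * indicator {- t2<..<- s2} y \<partial>lborel)"
    by (intro nn_integral_add[symmetric]) measurable
  also have "\<dots> \<le> (\<integral>\<^sup>+ y. ennreal \<bar>g y\<bar> * indicator {y. \<alpha> < \<bar>f y\<bar> \<and> \<bar>f y\<bar> < \<beta>} y \<partial>lborel)"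
  proof (intro nn_integral_mono)
    fix y
    have A: "\<alpha> < \<bar>f y\<bar> \<and> \<bar>f y\<bar> < \<beta>" if "y \<in> {s1<..<t1} \<or> y \<in> {- t2<..<- s2}"
    proof -
      have "\<alpha> < F y \<and> F y < \<beta>" using that 1(5)[of y] 2(5)[of "- y"] by auto
      then show ?thesis using ab F(1)[of y] by auto
    qed
    have B: "\<not> (y \<in> {s1<..<t1} \<and> y \<in> {- t2<..<- s2})" using 1 2 by auto
    show "ennreal \<bar>g y\<bar> * indicator {s1<..<t1} y + ennreal \<bar>g y\<bar> * indicator {- t2<..<- s2} y
      \<le> ennreal \<bar>g y\<bar> * indicator {y. \<alpha> < \<bar>f y\<bar> \<and> \<bar>f y\<bar> < \<beta>} y"
      using A B by (auto simp: indicator_def)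
  qed
  finally show ?thesis .
qed

definition kern0 :: "real \<Rightarrow> ennreal" where
  "kern0 s = (if 0 < s then ennreal (1 / (2 * sqrt s)) else 0)"

lemma kern0_measurable [measurable]: "kern0 \<in> borel_measurable borel"
  unfolding kern0_def by measurable

text \<open>Layering both roots expresses the integral through the \<open>m\<close>-measure of joint
  superlevel sets of \<open>u\<close> and \<open>v\<close>. Applied to heights and to a competitor
  alike, it reduces the comparison of fluxes to a single pair of levels and stands in for a coarea
  formula.\<close>

lemma double_layer_cake:
  fixes m :: "real \<Rightarrow> ennreal" and u v :: "real \<Rightarrow> real"
  assumes [measurable]: "m \<in> borel_measurable borel" "u \<in> borel_measurable borel" "v \<in> borel_measurable borel"
  shows "(\<integral>\<^sup>+ y. m y * ennreal (sqrtp (u y) * sqrtp (v y)) \<partial>lborel) =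
    (\<integral>\<^sup>+ r. (\<integral>\<^sup>+ s. kern0 r * kern0 s * (\<integral>\<^sup>+ y. m y * indicator {y. r < u y \<and> s < v y} y \<partial>lborel) \<partial>lborel) \<partial>lborel)"
proof -
  have eq: "kern0 r * kern0 s * (\<integral>\<^sup>+ y. m y * indicator {y. r < u y \<and> s < v y} y \<partial>lborel)
      = (\<integral>\<^sup>+ y. m y * (kern r (u y) * kern s (v y)) \<partial>lborel)" for r s
    by (subst nn_integral_cmult[symmetric])
      (auto intro!: nn_integral_cong simp: kern0_def kern_def indicator_def mult_ac)
  have "(\<integral>\<^sup>+ r. (\<integral>\<^sup>+ s. (\<integral>\<^sup>+ y. m y * (kern r (u y) * kern s (v y)) \<partial>lborel) \<partial>lborel) \<partial>lborel)
     = (\<integral>\<^sup>+ r. (\<integral>\<^sup>+ y. (\<integral>\<^sup>+ s. m y * (kern r (u y) * kern s (v y)) \<partial>lborel) \<partial>lborel) \<partial>lborel)"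
    by (intro nn_integral_cong lborel_pair.Fubini') measurable
  also have "\<dots> = (\<integral>\<^sup>+ r. (\<integral>\<^sup>+ y. m y * (kern r (u y) * ennreal (sqrtp (v y))) \<partial>lborel) \<partial>lborel)"
    by (intro nn_integral_cong) (simp add: nn_integral_cmult nn_integral_kern)
  also have "\<dots> = (\<integral>\<^sup>+ y. (\<integral>\<^sup>+ r. m y * (kern r (u y) * ennreal (sqrtp (v y))) \<partial>lborel) \<partial>lborel)"
    by (intro lborel_pair.Fubini') measurable
  also have "\<dots> = (\<integral>\<^sup>+ y. m y * ennreal (sqrtp (u y) * sqrtp (v y)) \<partial>lborel)"
    by (intro nn_integral_cong) (simp add: nn_integral_cmult nn_integral_multc nn_integral_kern ennreal_mult)
  finally show ?thesis by (simp add: eq)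
qed

section \<open>The energy inequality for competitors\<close>

context cost_density
begin

text \<open>As \<open>z\<close> is nonincreasing, the heights in question, if any, fill an interval
  from \<open>r\<close> up to some \<open>m\<close>. The point \<open>y0\<close> guarantees that the
  competitor reaches \<open>m\<close>, so the band from \<open>r\<close> to \<open>m\<close> is
  crossed twice.\<close>

lemma superlevel_flux_bound:
  assumes g: "locally_integrable g" and f: "primitive_of g f" and int: "integrable lborel f"
    and "0 < r" "z \<bar>f y0\<bar> < t" "f y0 \<noteq> 0"
  shows "(\<integral>\<^sup>+ \<phi>. 2 * indicator {\<phi>. r < \<phi> \<and> t < z \<phi>} \<phi> \<partial>lborel)
    \<le> (\<integral>\<^sup>+ y. ennreal \<bar>g y\<bar> * indicator {y. r < \<bar>f y\<bar> \<and> t < z \<bar>f y\<bar>} y \<partial>lborel)"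
proof -
  define A where "A = {\<phi>. r < \<phi> \<and> t < z \<phi>}"
  have [measurable]: "A \<in> sets borel" unfolding A_def by measurable
  show ?thesis
  proof (cases "A = {}")
    case True
    then have e: "(\<lambda>\<phi>. 2 * indicator {\<phi>. r < \<phi> \<and> t < z \<phi>} \<phi> :: ennreal) = (\<lambda>_. 0)"
      unfolding A_def[symmetric] by simp
    show ?thesis unfolding e by simp
  next
    case False
    have le: "\<phi> \<le> \<bar>f y0\<bar>" if "\<phi> \<in> A" for \<phi>
    proof (rule ccontr)
      assume "\<not> \<phi> \<le> \<bar>f y0\<bar>"
      then have "z \<phi> \<le> z \<bar>f y0\<bar>" using assms by (intro z_antimono) auto
      then show False using that assms by (auto simp: A_def)
    qed
    then have bdd: "bdd_above A" by (rule bdd_aboveI)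
    define m where "m = Sup A"
    have m: "\<And>\<phi>. \<phi> \<in> A \<Longrightarrow> \<phi> \<le> m" "m \<le> \<bar>f y0\<bar>"
      using bdd False le by (auto simp: m_def intro: cSup_upper cSup_least)
    have sub: "x \<in> A" if x: "r < x" "x < m" for x
    proof -
      obtain \<phi> where \<phi>: "\<phi> \<in> A" "x < \<phi>" using x(2) less_cSupD[OF False] unfolding m_def by blast
      then have "z \<phi> \<le> z x" using x assms by (intro z_antimono) auto
      then show ?thesis using \<phi> x by (auto simp: A_def)
    qed
    have rm: "r < m" using False m(1) by (force simp: A_def)
    have "(\<integral>\<^sup>+ \<phi>. 2 * indicator A \<phi> \<partial>lborel) \<le> (\<integral>\<^sup>+ \<phi>. 2 * indicator {r..m} \<phi> \<partial>lborel)"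
      using m(1) by (intro nn_integral_mono) (auto simp: indicator_def A_def)
    also have "\<dots> = ennreal (2 * (m - r))"
      using rm by (simp add: nn_integral_cmult ennreal_mult del: right_diff_distrib_numeral)
    also have "\<dots> \<le> (\<integral>\<^sup>+ y. ennreal \<bar>g y\<bar> * indicator {y. r < \<bar>f y\<bar> \<and> \<bar>f y\<bar> < m} y \<partial>lborel)"
      by (rule level_flux_bound[OF g f int \<open>0 < r\<close> rm m(2)])
    also have "\<dots> \<le> (\<integral>\<^sup>+ y. ennreal \<bar>g y\<bar> * indicator {y. r < \<bar>f y\<bar> \<and> t < z \<bar>f y\<bar>} y \<partial>lborel)"
      using sub by (intro nn_integral_mono) (auto simp: indicator_def A_def)
    finally show ?thesis by (simp add: A_def)
  qed
qed

lemma energy_lower_bound: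
  assumes w: "0 \<le> w" and \<psi>: "integrable lborel \<psi>" "(\<integral>y. \<psi> y \<partial>lborel) = w"
  shows "ennreal (\<tau> w) \<le> energy (\<lambda>x. x * z x) \<psi>"
proof (cases "w = 0 \<or> (\<nexists>g. weak_deriv \<psi> g)")
  case True
  then show ?thesis using p_integral[of 0] by (auto simp: energy_def)
next
  case False
  then obtain g where wd: "weak_deriv \<psi> g" and w0: "w > 0" using w by auto
  have g: "locally_integrable g" using wd by (simp add: weak_deriv_def)
  then have [measurable]: "g \<in> borel_measurable borel" by (simp add: locally_integrable_def)
  obtain f where f: "primitive_of g f" and ae: "AE x in lborel. \<psi> x = f x"
    using weak_deriv_imp_primitive[OF wd] .
  have [measurable]: "f \<in> borel_measurable borel"
    by (intro borel_measurable_continuous_onI primitive_of_continuous[OF g f])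
  have [measurable]: "\<psi> \<in> borel_measurable borel" using \<psi>(1) by auto
  have int: "integrable lborel f" and wf: "(\<integral>y. f y \<partial>lborel) = w"
    using \<psi> ae integrable_cong_AE[of \<psi> lborel f] integral_cong_AE[of \<psi> lborel f] by auto
  \<comment> \<open>Zeros of \<open>f\<close> are left out: there \<open>z\<close> has its default
    value 0, which would spoil the infimum.\<close>
  define Z where "Z = (\<lambda>y. z \<bar>f y\<bar>) ` {y. f y \<noteq> 0}"
  have ne: "Z \<noteq> {}"
  proof
    assume "Z = {}"
    then have "f = (\<lambda>_. 0)" by (auto simp: Z_def)
    then show False using wf w0 by simp
  qed
  have bdd: "bdd_below Z" by (rule bdd_belowI[of _ 0]) (auto simp: Z_def z_nonneg)
  define l where "l = Inf Z"
  have l0: "0 \<le> l" unfolding l_def by (rule cInf_greatest[OF ne]) (auto simp: Z_def z_nonneg)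
  have lz: "l \<le> z \<bar>f y\<bar>" if "f y \<noteq> 0" for y
    unfolding l_def using that by (intro cInf_lower bdd) (auto simp: Z_def)
  have flux: "(\<integral>\<^sup>+ \<phi>. 2 * ennreal (sqrtp \<phi> * sqrtp (z \<phi> - l)) \<partial>lborel)
     \<le> (\<integral>\<^sup>+ y. ennreal \<bar>g y\<bar> * ennreal (sqrtp \<bar>f y\<bar> * sqrtp (z \<bar>f y\<bar> - l)) \<partial>lborel)"
  proof (subst (1 2) double_layer_cake, (measurable)[6], intro nn_integral_mono)
    fix r s :: real
    show "kern0 r * kern0 s * (\<integral>\<^sup>+ y. 2 * indicator {y. r < y \<and> s < z y - l} y \<partial>lborel)
       \<le> kern0 r * kern0 s * (\<integral>\<^sup>+ y. ennreal \<bar>g y\<bar> * indicator {y. r < \<bar>f y\<bar> \<and> s < z \<bar>f y\<bar> - l} y \<partial>lborel)"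
    proof (cases "0 < r \<and> 0 < s")
      case True
      \<comment> \<open>The infimum need not be attained, but for every \<open>s > 0\<close> some
        value of \<open>z\<close> falls below \<open>l + s\<close>; this is the witness that the
        superlevel estimate asks for.\<close>
      then have "Inf Z < l + s" by (simp add: l_def)
      then obtain y0 where "f y0 \<noteq> 0" "z \<bar>f y0\<bar> < l + s"
        using cInf_lessD[OF ne] by (auto simp: Z_def)
      then have "(\<integral>\<^sup>+ \<phi>. 2 * indicator {\<phi>. r < \<phi> \<and> l + s < z \<phi>} \<phi> \<partial>lborel)
        \<le> (\<integral>\<^sup>+ y. ennreal \<bar>g y\<bar> * indicator {y. r < \<bar>f y\<bar> \<and> l + s < z \<bar>f y\<bar>} y \<partial>lborel)"
        using True by (intro superlevel_flux_bound[OF g f int]) auto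
      then show ?thesis by (intro mult_left_mono) (auto simp: less_diff_eq add.commute)
    qed (auto simp: kern0_def)
  qed
  have "ennreal (\<tau> w) \<le> G l + ennreal (l * w)" by (rule \<tau>_le_G[OF w l0])
  also have "G l = ennreal (sqrt 2) * (\<integral>\<^sup>+ \<phi>. 2 * ennreal (sqrtp \<phi> * sqrtp (z \<phi> - l)) \<partial>lborel)"
    unfolding abel_identity[OF l0, symmetric]
    by (subst nn_integral_cmult[symmetric], measurable, intro nn_integral_cong)
      (simp add: ennreal_mult mult_ac)
  also have "\<dots> \<le> ennreal (sqrt 2) * (\<integral>\<^sup>+ y. ennreal \<bar>g y\<bar> * ennreal (sqrtp \<bar>f y\<bar> * sqrtp (z \<bar>f y\<bar> - l)) \<partial>lborel)"
    by (intro mult_left_mono flux) auto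
  also have "\<dots> = (\<integral>\<^sup>+ y. ennreal (sqrt 2 * (\<bar>g y\<bar> * (sqrtp \<bar>f y\<bar> * sqrtp (z \<bar>f y\<bar> - l)))) \<partial>lborel)"
    by (subst nn_integral_cmult[symmetric], measurable) (simp add: ennreal_mult)
  also have "ennreal (l * w) \<le> (\<integral>\<^sup>+ y. ennreal (l * \<bar>f y\<bar>) \<partial>lborel)"
  proof -
    have "ennreal (norm (\<integral>y. l * f y \<partial>lborel)) \<le> (\<integral>\<^sup>+ y. ennreal (norm (l * f y)) \<partial>lborel)"
      using int by (intro integral_norm_bound_ennreal) auto
    then show ?thesis using wf l0 w by (simp add: abs_mult)
  qed
  also have "(\<integral>\<^sup>+ y. ennreal (sqrt 2 * (\<bar>g y\<bar> * (sqrtp \<bar>f y\<bar> * sqrtp (z \<bar>f y\<bar> - l)))) \<partial>lborel) + (\<integral>\<^sup>+ y. ennreal (l * \<bar>f y\<bar>) \<partial>lborel)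
     = (\<integral>\<^sup>+ y. ennreal (sqrt 2 * (\<bar>g y\<bar> * (sqrtp \<bar>f y\<bar> * sqrtp (z \<bar>f y\<bar> - l)))) + ennreal (l * \<bar>f y\<bar>) \<partial>lborel)"
    by (intro nn_integral_add[symmetric]) measurable
  also have "\<dots> \<le> (\<integral>\<^sup>+ y. ennreal ((1/2) * (g y)\<^sup>2 + \<bar>f y\<bar> * z \<bar>f y\<bar>) \<partial>lborel)"
  proof (intro nn_integral_mono)
    fix y
    have "sqrt 2 * (\<bar>g y\<bar> * (sqrtp \<bar>f y\<bar> * sqrtp (z \<bar>f y\<bar> - l))) + l * \<bar>f y\<bar> \<le> (1/2) * (g y)\<^sup>2 + \<bar>f y\<bar> * z \<bar>f y\<bar>"
    proof (cases "f y = 0")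
      case False
      \<comment> \<open>\<open>k\<close> is the optimal speed at this height: half its square equals
        \<open>\<bar>f y\<bar> * (z \<bar>f y\<bar> - l)\<close>.\<close>
      define k where "k = sqrt 2 * (sqrtp \<bar>f y\<bar> * sqrtp (z \<bar>f y\<bar> - l))"
      have "k\<^sup>2 = 2 * (\<bar>f y\<bar> * (z \<bar>f y\<bar> - l))"
        using lz[OF False] by (simp add: k_def sqrtp_def max_def power_mult_distrib)
      moreover have "0 \<le> (\<bar>g y\<bar> - k)\<^sup>2" by simp
      ultimately have "\<bar>g y\<bar> * k \<le> (1/2) * (g y)\<^sup>2 + \<bar>f y\<bar> * (z \<bar>f y\<bar> - l)"
        by (simp add: power2_diff)
      moreover have "sqrt 2 * (\<bar>g y\<bar> * (sqrtp \<bar>f y\<bar> * sqrtp (z \<bar>f y\<bar> - l))) = \<bar>g y\<bar> * k"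
        by (simp add: k_def)
      ultimately show ?thesis by (simp only:) (simp add: right_diff_distrib mult.commute)
    qed (simp add: sqrtp_def)
    then show "ennreal (sqrt 2 * (\<bar>g y\<bar> * (sqrtp \<bar>f y\<bar> * sqrtp (z \<bar>f y\<bar> - l)))) + ennreal (l * \<bar>f y\<bar>)
      \<le> ennreal ((1/2) * (g y)\<^sup>2 + \<bar>f y\<bar> * z \<bar>f y\<bar>)"
      using l0 by (subst ennreal_plus[symmetric]) (auto intro: ennreal_leI simp del: ennreal_plus)
  qed
  also have "\<dots> = (\<integral>\<^sup>+ y. ennreal ((1/2) * (g y)\<^sup>2 + \<bar>\<psi> y\<bar> * z \<bar>\<psi> y\<bar>) \<partial>lborel)"
    using ae by (intro nn_integral_cong_AE) auto
  also have "\<dots> = energy (\<lambda>x. x * z x) \<psi>" by (rule energy_eq[OF wd, symmetric])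
  finally show ?thesis by (simp add: add_mono)
qed

end

section \<open>Profiles with prescribed speed\<close>

text \<open>This solves q' = v(q) from 0 to \<open>h\<close> in time \<open>L\<close>, the integral
  of 1/v. As \<open>v\<close> is merely measurable, \<open>q\<close> is the quantile function of the
  measure with density 1/v, and the last claim takes the place of the substitution dx = v
  dy.\<close>

lemma quantile_profile:
  fixes v :: "real \<Rightarrow> real" and h :: real
  assumes [measurable]: "v \<in> borel_measurable borel" and v: "\<And>x. 0 < x \<Longrightarrow> x < h \<Longrightarrow> 0 < v x" and h: "0 < h"
    and fin: "(\<integral>\<^sup>+ x. ennreal (1 / v x) * indicator {0<..<h} x \<partial>lborel) < \<infinity>"
  obtains L :: real and q :: "real \<Rightarrow> real" where "0 < L" "mono q" "\<And>y. y \<le> 0 \<Longrightarrow> q y = 0" "\<And>y. L \<le> y \<Longrightarrow> q y = h"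
    "\<And>F. F \<in> borel_measurable borel \<Longrightarrow> (\<integral>\<^sup>+ y. F (q y) * indicator {0<..<L} y \<partial>lborel)
       = (\<integral>\<^sup>+ x. F x * (ennreal (1 / v x) * indicator {0<..<h} x) \<partial>lborel)"
proof -
  define d where "d x = ennreal (1 / v x) * indicator {0<..<h} x" for x
  have [measurable]: "d \<in> borel_measurable borel" unfolding d_def by measurable
  define \<mu> where "\<mu> = density lborel d"
  have [simp]: "sets \<mu> = sets borel" "space \<mu> = UNIV" by (simp_all add: \<mu>_def)
  have e\<mu>: "emeasure \<mu> A = (\<integral>\<^sup>+ x. d x * indicator A x \<partial>lborel)" if "A \<in> sets borel" for A
    unfolding \<mu>_def using that by (simp add: emeasure_density)
  interpret \<mu>: finite_measure \<mu>
    by standard (use fin e\<mu>[of UNIV] in \<open>auto simp: d_def\<close>)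
  define Y where "Y x = measure \<mu> {..x}" for x
  define L where "L = measure \<mu> UNIV"
  have Ymono: "Y x \<le> Y x'" if "x \<le> x'" for x x'
    unfolding Y_def using that by (intro \<mu>.finite_measure_mono) auto
  have Y0: "0 \<le> Y x" "Y x \<le> L" for x by (auto simp: Y_def L_def intro: \<mu>.finite_measure_mono)
  have Yneg: "Y x = 0" if "x \<le> 0" for x
  proof -
    have "d t * indicator {..x} t = 0" for t using that by (auto simp: d_def indicator_def)
    then have "emeasure \<mu> {..x} = 0" unfolding e\<mu>[OF atMost_borel] by (simp only: nn_integral_const mult_zero_left)
    then show ?thesis by (simp add: Y_def measure_def)
  qed
  have Yh: "Y x = L" if "h \<le> x" for x
  proof -
    have "d t * indicator {..x} t = d t * indicator UNIV t" for t using that by (auto simp: d_def indicator_def)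
    then have "emeasure \<mu> {..x} = emeasure \<mu> UNIV" using e\<mu>[of UNIV] by (simp only: e\<mu>[OF atMost_borel]) simp
    then show ?thesis by (simp add: Y_def L_def measure_def)
  qed
  have Lpos: "0 < L"
  proof (rule ccontr)
    assume "\<not> 0 < L"
    then have "L = 0" by (simp add: L_def zero_less_measure_iff)
    then have "emeasure \<mu> UNIV = 0" by (simp add: L_def \<mu>.emeasure_eq_measure)
    then have "(\<integral>\<^sup>+ x. d x \<partial>lborel) = 0" using e\<mu>[of UNIV] by simp
    then have "AE x in lborel. d x = 0" by (subst (asm) nn_integral_0_iff_AE) auto
    then have "AE x in lborel. x \<notin> {0<..<h}"
    proof eventually_elim
      fix x assume "d x = 0"
      then show "x \<notin> {0<..<h}" using v[of x] by (auto simp: d_def)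
    qed
    then have "emeasure lborel {x \<in> space lborel. x \<in> {0<..<h}} = 0"
      by (intro emeasure_eq_0_AE) auto
    moreover have "{x \<in> space lborel. x \<in> {0<..<h}} = {0<..<h}" by auto
    ultimately show False using h by simp
  qed
  \<comment> \<open>Right continuity of \<open>Y\<close>, from continuity of the measure along
    decreasing sets; it makes the infimum in \<open>q\<close> attained.\<close>
  have Yright: "y \<le> Y x" if "\<And>t. x < t \<Longrightarrow> y \<le> Y t" for x y
  proof -
    let ?A = "\<lambda>n. {..x + 1 / real (Suc n)}"
    have "decseq ?A" by (auto simp: decseq_def intro: order_trans frac_le)
    then have "(\<lambda>n. measure \<mu> (?A n)) \<longlonglongrightarrow> measure \<mu> (\<Inter>n. ?A n)"
      by (intro \<mu>.finite_Lim_measure_decseq) auto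
    moreover have "(\<Inter>n. ?A n) = {..x}"
    proof (intro equalityI subsetI)
      fix t assume "t \<in> (\<Inter>n. ?A n)"
      then have "t \<le> x + 1 / real (Suc n)" for n by auto
      moreover have "(\<lambda>n. x + 1 / real (Suc n)) \<longlonglongrightarrow> x + 0"
        using LIMSEQ_inverse_real_of_nat by (intro tendsto_intros) (simp add: inverse_eq_divide)
      ultimately have "t \<le> x + 0" by (intro LIMSEQ_le_const[of "\<lambda>n. x + 1 / real (Suc n)"]) auto
      then show "t \<in> {..x}" by simp
    qed (auto intro: order_trans)
    ultimately have "(\<lambda>n. Y (x + 1 / real (Suc n))) \<longlonglongrightarrow> Y x" by (simp add: Y_def)
    then show ?thesis using that by (intro LIMSEQ_le_const[of "\<lambda>n. Y (x + 1 / real (Suc n))"]) auto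
  qed
  \<comment> \<open>The generalised inverse of \<open>Y\<close> pushes Lebesgue measure on \<open>(0, L)\<close> forward to \<open>\<mu>\<close>.\<close>
  define q where "q y = (if y \<le> 0 then 0 else if L \<le> y then h else Inf {x. y \<le> Y x})" for y
  have gal: "q y \<le> x \<longleftrightarrow> y \<le> Y x" if y: "0 < y" "y < L" for x y
  proof -
    let ?S = "{x. y \<le> Y x}"
    have ne: "?S \<noteq> {}" using y Yh[of h] by (auto intro!: exI[of _ h])
    have bdd: "bdd_below ?S"
    proof (rule bdd_belowI[of _ 0])
      fix x assume "x \<in> ?S"
      then show "0 \<le> x" using Yneg[of x] y by (cases "x \<le> 0") auto
    qed
    have qy: "q y = Inf ?S" using y by (simp add: q_def)
    show ?thesis
    proof
      assume "y \<le> Y x" then show "q y \<le> x" unfolding qy by (intro cInf_lower bdd) auto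
    next
      assume qx: "q y \<le> x"
      show "y \<le> Y x"
      proof (rule Yright)
        fix t assume "x < t"
        then have "Inf ?S < t" using qx qy by simp
        then obtain r where "r \<in> ?S" "r < t" using cInf_lessD[OF ne] by blast
        then show "y \<le> Y t" using Ymono[of r t] by auto
      qed
    qed
  qed
  have q0: "0 \<le> q y" "q y \<le> h" for y
  proof -
    show "0 \<le> q y"
    proof (cases "0 < y \<and> y < L")
      case True
      show ?thesis
      proof (rule ccontr)
        assume "\<not> 0 \<le> q y"
        then have "y \<le> Y (q y)" "Y (q y) = 0" using gal[of y "q y"] True Yneg[of "q y"] by auto
        then show False using True by simp
      qed
    qed (use h in \<open>auto simp: q_def\<close>)
    show "q y \<le> h"
    proof (cases "0 < y \<and> y < L")
      case True
      then show ?thesis using gal[of y h] Yh[of h] by auto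
    qed (use h in \<open>auto simp: q_def\<close>)
  qed
  have qmono: "mono q"
  proof
    fix y y' :: real assume "y \<le> y'"
    consider "y \<le> 0" | "L \<le> y'" | "0 < y" "y' < L" by linarith
    then show "q y \<le> q y'"
    proof cases
      case 1 then show ?thesis using q0[of y'] by (simp add: q_def[of y])
    next
      case 2 then show ?thesis using q0[of y] Lpos by (simp add: q_def[of y'])
    next
      case 3
      then have "y' \<le> Y (q y')" using gal[of y' "q y'"] \<open>y \<le> y'\<close> by auto
      then show ?thesis using gal[of y "q y'"] 3 \<open>y \<le> y'\<close> by auto
    qed
  qed
  then have [measurable]: "q \<in> borel_measurable borel" by (rule borel_measurable_mono)
  have eq: "distr (density lborel (indicator {0<..<L})) borel q = \<mu>"
  proof (rule measure_eqI_lessThan)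
    fix x :: real
    have [measurable]: "q -` {x<..} \<in> sets borel" using measurable_sets[of q borel borel "{x<..}"] by simp
    have "emeasure (distr (density lborel (indicator {0<..<L})) borel q) {x<..}
       = (\<integral>\<^sup>+ y. indicator {0<..<L} y * indicator (q -` {x<..}) y \<partial>lborel)"
      by (simp add: emeasure_distr emeasure_density)
    also have "\<dots> = (\<integral>\<^sup>+ y. indicator {Y x<..<L} y \<partial>lborel)"
    proof (intro nn_integral_cong)
      fix y
      show "indicator {0<..<L} y * indicator (q -` {x<..}) y = (indicator {Y x<..<L} y :: ennreal)"
        using gal[of y x] Y0(1)[of x] by (cases "0 < y \<and> y < L") (auto simp: indicator_def not_le[symmetric])
    qed
    also have "\<dots> = ennreal (L - Y x)" using Y0(2)[of x] by simp
    finally have 1: "emeasure (distr (density lborel (indicator {0<..<L})) borel q) {x<..} = ennreal (L - Y x)" .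
    have "UNIV - {..x} = {x<..}" by auto
    then have "measure \<mu> {x<..} = L - Y x"
      using \<mu>.finite_measure_compl[of "{..x}"] by (simp add: L_def Y_def)
    then show "emeasure (distr (density lborel (indicator {0<..<L})) borel q) {x<..} = emeasure \<mu> {x<..}"
      using 1 by (simp add: \<mu>.emeasure_eq_measure)
    show "emeasure (distr (density lborel (indicator {0<..<L})) borel q) {x<..} < \<infinity>" using 1 by simp
  qed auto
  show thesis
  proof (rule that[of L q])
    fix F :: "real \<Rightarrow> ennreal" assume [measurable]: "F \<in> borel_measurable borel"
    have "(\<integral>\<^sup>+ y. F (q y) * indicator {0<..<L} y \<partial>lborel) = (\<integral>\<^sup>+ x. F x \<partial>distr (density lborel (indicator {0<..<L})) borel q)"
      by (simp add: nn_integral_distr nn_integral_density mult.commute)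
    also have "\<dots> = (\<integral>\<^sup>+ x. F x * (ennreal (1 / v x) * indicator {0<..<h} x) \<partial>lborel)"
      unfolding eq \<mu>_def by (simp add: nn_integral_density d_def mult.commute)
    finally show "(\<integral>\<^sup>+ y. F (q y) * indicator {0<..<L} y \<partial>lborel) = (\<integral>\<^sup>+ x. F x * (ennreal (1 / v x) * indicator {0<..<h} x) \<partial>lborel)" .
  qed (use Lpos qmono in \<open>auto simp: q_def\<close>)
qed

section \<open>Reflecting, translating and adding primitives\<close>

lemma nn_integral_reflect:
  fixes E :: "real \<Rightarrow> ennreal"
  assumes [measurable]: "E \<in> borel_measurable borel"
  shows "(\<integral>\<^sup>+ y. E (a - \<bar>y\<bar>) \<partial>lborel) = 2 * (\<integral>\<^sup>+ t. E t * indicator {..<a} t \<partial>lborel)"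
proof -
  have 1: "(\<integral>\<^sup>+ t. E t * indicator {..<a} t \<partial>lborel) = (\<integral>\<^sup>+ y. E (a - y) * indicator {0<..} y \<partial>lborel)"
    using nn_integral_real_affine[of "\<lambda>t. E t * indicator {..<a} t" "-1" a] by (simp add: indicator_def)
  have 2: "(\<integral>\<^sup>+ t. E t * indicator {..<a} t \<partial>lborel) = (\<integral>\<^sup>+ y. E (a + y) * indicator {..<0} y \<partial>lborel)"
    using nn_integral_real_affine[of "\<lambda>t. E t * indicator {..<a} t" 1 a] by (simp add: indicator_def)
  have "(\<integral>\<^sup>+ y. E (a - \<bar>y\<bar>) \<partial>lborel) = (\<integral>\<^sup>+ y. E (a - y) * indicator {0<..} y + E (a + y) * indicator {..<0} y \<partial>lborel)"
  proof (intro nn_integral_cong_AE)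
    show "AE y in lborel. E (a - \<bar>y\<bar>) = E (a - y) * indicator {0<..} y + E (a + y) * indicator {..<0} y"
      using AE_lborel_singleton[of 0] by eventually_elim (auto simp: indicator_def abs_if)
  qed
  also have "\<dots> = (\<integral>\<^sup>+ t. E t * indicator {..<a} t \<partial>lborel) + (\<integral>\<^sup>+ t. E t * indicator {..<a} t \<partial>lborel)"
    by (subst nn_integral_add) (auto simp: 1[symmetric] 2[symmetric])
  finally show ?thesis by (simp add: mult_2)
qed

lemma primitive_of_translate:
  assumes "primitive_of g f"
  shows "primitive_of (\<lambda>y. g (a + y)) (\<lambda>y. f (a + y))"
  unfolding primitive_of_def
proof (intro allI impI)
  fix b c :: real assume "b \<le> c"
  have "f (a + c) - f (a + b) = (\<integral>t. indicator {a + b..a + c} t *\<^sub>R g t \<partial>lborel)"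
    using assms \<open>b \<le> c\<close> unfolding primitive_of_def set_lebesgue_integral_def by simp
  also have "\<dots> = (\<integral>t. indicator {a + b..a + c} (a + t) *\<^sub>R g (a + t) \<partial>lborel)"
    using lborel_integral_real_affine[of 1 "\<lambda>t. indicator {a + b..a + c} t *\<^sub>R g t" a] by simp
  also have "\<dots> = (LINT t:{b..c}|lborel. g (a + t))"
    unfolding set_lebesgue_integral_def by (simp add: indicator_def)
  finally show "f (a + c) - f (a + b) = (LINT t:{b..c}|lborel. g (a + t))" .
qed

lemma primitive_of_reflect:
  assumes "primitive_of g f"
  shows "primitive_of (\<lambda>y. - g (a - y)) (\<lambda>y. f (a - y))"
  unfolding primitive_of_def
proof (intro allI impI)
  fix b c :: real assume "b \<le> c"
  have "f (a - b) - f (a - c) = (\<integral>t. indicator {a - c..a - b} t *\<^sub>R g t \<partial>lborel)"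
    using assms \<open>b \<le> c\<close> unfolding primitive_of_def set_lebesgue_integral_def by simp
  also have "\<dots> = (\<integral>t. indicator {a - c..a - b} (a - t) *\<^sub>R g (a - t) \<partial>lborel)"
    using lborel_integral_real_affine[of "-1" "\<lambda>t. indicator {a - c..a - b} t *\<^sub>R g t" a] by simp
  also have "\<dots> = (LINT t:{b..c}|lborel. g (a - t))"
    unfolding set_lebesgue_integral_def
    by (intro Bochner_Integration.integral_cong) (auto simp: indicator_def)
  finally have "f (a - c) - f (a - b) = - (LINT t:{b..c}|lborel. g (a - t))" by simp
  then show "f (a - c) - f (a - b) = (LINT t:{b..c}|lborel. - g (a - t))"
    by (simp add: set_lebesgue_integral_def)
qed

lemma primitive_of_add:
  assumes "locally_integrable g" "locally_integrable g'" "primitive_of g f" "primitive_of g' f'"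
  shows "primitive_of (\<lambda>y. g y + g' y) (\<lambda>y. f y + f' y)"
  unfolding primitive_of_def
proof (intro allI impI)
  fix a b :: real assume "a \<le> b"
  then have "f b - f a = (LINT t:{a..b}|lborel. g t)" "f' b - f' a = (LINT t:{a..b}|lborel. g' t)"
    using assms by (auto simp: primitive_of_def)
  moreover have "(LINT t:{a..b}|lborel. g t + g' t) = (LINT t:{a..b}|lborel. g t) + (LINT t:{a..b}|lborel. g' t)"
    using assms by (intro set_integral_add(2)) (auto simp: locally_integrable_def)
  ultimately show "f b + f' b - (f a + f' a) = (LINT t:{a..b}|lborel. g t + g' t)" by simp
qed

lemma primitive_of_nonneg:
  assumes int: "integrable lborel g" and g0: "\<And>t. 0 \<le> g t" and q0: "\<And>y. 0 \<le> q y"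
    and q: "\<And>y. (\<integral>\<^sup>+ t. ennreal (g t) * indicator {..<y} t \<partial>lborel) = ennreal (q y)"
  shows "primitive_of g q"
  unfolding primitive_of_def
proof (intro allI impI)
  fix a b :: real assume "a \<le> b"
  have [measurable]: "g \<in> borel_measurable borel" using int by auto
  have iA: "integrable lborel (\<lambda>t. indicator A t *\<^sub>R g t)" if "A \<in> sets borel" for A
    using int that by (intro integrable_mult_indicator) auto
  have eq: "(\<integral>t. indicator {..<y} t *\<^sub>R g t \<partial>lborel) = q y" for y
  proof -
    have "ennreal (\<integral>t. indicator {..<y} t *\<^sub>R g t \<partial>lborel) = (\<integral>\<^sup>+ t. ennreal (indicator {..<y} t *\<^sub>R g t) \<partial>lborel)"
      using g0 by (intro nn_integral_eq_integral[symmetric] iA) auto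
    also have "\<dots> = (\<integral>\<^sup>+ t. ennreal (g t) * indicator {..<y} t \<partial>lborel)"
      by (intro nn_integral_cong) (auto simp: indicator_def)
    also have "\<dots> = ennreal (q y)" by (rule q)
    finally show ?thesis using q0[of y] g0 by (simp add: integral_nonneg_AE)
  qed
  have "q b - q a = (\<integral>t. indicator {..<b} t *\<^sub>R g t - indicator {..<a} t *\<^sub>R g t \<partial>lborel)"
    by (simp only: Bochner_Integration.integral_diff iA eq lessThan_borel)
  also have "\<dots> = (LINT t:{a..b}|lborel. g t)"
    unfolding set_lebesgue_integral_def
  proof (intro integral_cong_AE)
    show "AE t in lborel. indicator {..<b} t *\<^sub>R g t - indicator {..<a} t *\<^sub>R g t = indicator {a..b} t *\<^sub>R g t"
      using AE_lborel_singleton[of b] by eventually_elim (use \<open>a \<le> b\<close> in \<open>auto simp: indicator_def\<close>)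
  qed auto
  finally show "q b - q a = (LINT t:{a..b}|lborel. g t)" .
qed

text \<open>The competitor is symmetric: a flank along \<open>q\<close>, a plateau at height
  \<open>h\<close>, and the mirrored flank. On a flank dy = dx / v, so v^2 / 2 + c contributes v / 2
  + c / v per unit of height; \<open>m\<close> is the mass of one flank, and a plateau of length (w
  - 2 m) / h carries the rest.\<close>

lemma profile_with_plateau:
  fixes v c :: "real \<Rightarrow> real" and h w m :: real
  assumes [measurable]: "v \<in> borel_measurable borel" "c \<in> borel_measurable borel"
    and v: "\<And>x. 0 < x \<Longrightarrow> x < h \<Longrightarrow> 0 < v x" and h: "0 < h"
    and fin: "(\<integral>\<^sup>+ x. ennreal (1 / v x) * indicator {0<..<h} x \<partial>lborel) < \<infinity>"
    and c: "c 0 = 0" "\<And>x. 0 \<le> x \<Longrightarrow> 0 \<le> c x"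
    and m: "(\<integral>\<^sup>+ x. ennreal (x / v x) * indicator {0<..<h} x \<partial>lborel) = ennreal m" "0 \<le> m" "2 * m \<le> w"
  obtains \<psi> where "integrable lborel \<psi>" "(\<integral>y. \<psi> y \<partial>lborel) = w"
    "energy c \<psi> = 2 * (\<integral>\<^sup>+ x. ennreal (v x / 2 + c x / v x) * indicator {0<..<h} x \<partial>lborel) + ennreal ((w - 2 * m) * (c h / h))"
proof -
  obtain L :: real and q :: "real \<Rightarrow> real" where L: "0 < L" and qmono: "mono q" and qneg: "\<And>y. y \<le> 0 \<Longrightarrow> q y = 0" and qL: "\<And>y. L \<le> y \<Longrightarrow> q y = h"
    and tr: "\<And>F. F \<in> borel_measurable borel \<Longrightarrow> (\<integral>\<^sup>+ y. F (q y) * indicator {0<..<L} y \<partial>lborel)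
       = (\<integral>\<^sup>+ x. F x * (ennreal (1 / v x) * indicator {0<..<h} x) \<partial>lborel)"
  proof (rule quantile_profile[OF assms(1) v h fin])
    fix L :: real and q :: "real \<Rightarrow> real"
    assume "0 < L" "mono q" "\<And>y. y \<le> 0 \<Longrightarrow> q y = 0" "\<And>y. L \<le> y \<Longrightarrow> q y = h"
      "\<And>F. F \<in> borel_measurable borel \<Longrightarrow> (\<integral>\<^sup>+ y. F (q y) * indicator {0<..<L} y \<partial>lborel)
       = (\<integral>\<^sup>+ x. F x * (ennreal (1 / v x) * indicator {0<..<h} x) \<partial>lborel)"
    then show thesis by (rule that)
  qed
  have [measurable]: "q \<in> borel_measurable borel" using qmono by (rule borel_measurable_mono)
  have q0: "0 \<le> q y" "q y \<le> h" for y
    using monoD[OF qmono, of "min y 0" y] qneg[of "min y 0"] monoD[OF qmono, of y "max y L"] qL[of "max y L"] by auto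
  \<comment> \<open>The weak derivative of \<open>q\<close>. The maximum guards against heights
    outside the open interval, where the sign of \<open>v\<close> is unknown.\<close>
  define g where "g y = (if 0 < y \<and> y < L then max 0 (v (q y)) else 0)" for y
  have [measurable]: "g \<in> borel_measurable borel" unfolding g_def by measurable
  have g0: "0 \<le> g t" for t by (simp add: g_def)
  have vv: "ennreal (max 0 (v x)) * (ennreal (1 / v x) * indicator {0<..<h} x) = indicator {0<..<h} x" for x
    using v[of x] by (auto simp: indicator_def ennreal_mult'[symmetric] max_def)
  have gint: "(\<integral>\<^sup>+ t. ennreal (g t) * indicator {..<y} t \<partial>lborel) = ennreal (q y)" for y
  proof -
    consider "y \<le> 0" | "0 < y" "y < L" | "L \<le> y" by linarith
    then show ?thesis
    proof cases
      case 1
      then have "(\<integral>\<^sup>+ t. ennreal (g t) * indicator {..<y} t \<partial>lborel) = (\<integral>\<^sup>+ (t::real). 0 \<partial>lborel)"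
        by (intro nn_integral_cong) (auto simp: g_def indicator_def)
      then show ?thesis using 1 qneg by simp
    next
      case 2
      \<comment> \<open>A level set of \<open>q\<close> between 0 and \<open>L\<close> is null,
        since the image measure has a density. Hence \<open>t < y\<close> and
        \<open>q t < q y\<close> agree for almost every such \<open>t\<close>, although
        \<open>q\<close> is only known to be monotone.\<close>
      have "(\<integral>\<^sup>+ t. indicator {q y} (q t) * indicator {0<..<L} t \<partial>lborel) = (\<integral>\<^sup>+ x. indicator {q y} x * (ennreal (1 / v x) * indicator {0<..<h} x) \<partial>lborel)"
        by (rule tr) auto
      also have "\<dots> = 0"
      proof (subst nn_integral_0_iff_AE)
        show "AE x in lborel. indicator {q y} x * (ennreal (1 / v x) * indicator {0<..<h} x) = 0"
          using AE_lborel_singleton[of "q y"] by eventually_elim auto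
      qed auto
      finally have "AE t in lborel. indicator {q y} (q t) * indicator {0<..<L} t = (0::ennreal)"
        by (subst (asm) nn_integral_0_iff_AE) auto
      then have ae: "AE t in lborel. ennreal (g t) * indicator {..<y} t
         = (ennreal (max 0 (v (q t))) * indicator {..<q y} (q t)) * indicator {0<..<L} t"
        using AE_lborel_singleton[of y]
      proof eventually_elim
        fix t assume A: "indicator {q y} (q t) * indicator {0<..<L} t = (0::ennreal)" "t \<noteq> y"
        show "ennreal (g t) * indicator {..<y} t
         = (ennreal (max 0 (v (q t))) * indicator {..<q y} (q t)) * indicator {0<..<L} t"
        proof (cases "0 < t \<and> t < L")
          case True
          then have "q t \<noteq> q y" using A by (auto simp: indicator_def split: if_splits)
          then have "t < y \<longleftrightarrow> q t < q y"
            using monoD[OF qmono, of t y] monoD[OF qmono, of y t] by linarith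
          then show ?thesis using True by (simp add: g_def indicator_def)
        qed (auto simp: g_def indicator_def)
      qed
      have "(\<integral>\<^sup>+ t. ennreal (g t) * indicator {..<y} t \<partial>lborel)
        = (\<integral>\<^sup>+ t. (ennreal (max 0 (v (q t))) * indicator {..<q y} (q t)) * indicator {0<..<L} t \<partial>lborel)"
        by (rule nn_integral_cong_AE[OF ae])
      also have "\<dots> = (\<integral>\<^sup>+ x. (ennreal (max 0 (v x)) * indicator {..<q y} x) * (ennreal (1 / v x) * indicator {0<..<h} x) \<partial>lborel)"
        by (rule tr) measurable
      also have "\<dots> = (\<integral>\<^sup>+ x. indicator {0<..<q y} x \<partial>lborel)"
      proof (intro nn_integral_cong)
        fix x
        have "(ennreal (max 0 (v x)) * indicator {..<q y} x) * (ennreal (1 / v x) * indicator {0<..<h} x)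
          = indicator {..<q y} x * (ennreal (max 0 (v x)) * (ennreal (1 / v x) * indicator {0<..<h} x))"
          by (simp only: mult_ac)
        also have "\<dots> = indicator {..<q y} x * indicator {0<..<h} x" by (simp only: vv)
        finally have "(ennreal (max 0 (v x)) * indicator {..<q y} x) * (ennreal (1 / v x) * indicator {0<..<h} x)
          = indicator {..<q y} x * indicator {0<..<h} x" .
        then show "(ennreal (max 0 (v x)) * indicator {..<q y} x) * (ennreal (1 / v x) * indicator {0<..<h} x) = indicator {0<..<q y} x"
          using q0(2)[of y] by (auto simp: indicator_def)
      qed
      also have "\<dots> = ennreal (q y)" using q0(1)[of y] by simp
      finally show ?thesis .
    next
      case 3
      have "(\<integral>\<^sup>+ t. ennreal (g t) * indicator {..<y} t \<partial>lborel)
        = (\<integral>\<^sup>+ t. ennreal (max 0 (v (q t))) * indicator {0<..<L} t \<partial>lborel)"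
        using 3 by (intro nn_integral_cong) (auto simp: g_def indicator_def)
      also have "\<dots> = (\<integral>\<^sup>+ x. ennreal (max 0 (v x)) * (ennreal (1 / v x) * indicator {0<..<h} x) \<partial>lborel)"
        by (rule tr) measurable
      also have "\<dots> = ennreal (q y)" unfolding vv using 3 qL[of y] h by simp
      finally show ?thesis .
    qed
  qed
  have ig: "integrable lborel g"
  proof (rule integrableI_bounded)
    have "(\<integral>\<^sup>+ x. ennreal (norm (g x)) \<partial>lborel) = (\<integral>\<^sup>+ t. ennreal (g t) * indicator {..<L} t \<partial>lborel)"
      using g0 by (intro nn_integral_cong) (auto simp: g_def indicator_def)
    then show "(\<integral>\<^sup>+ x. ennreal (norm (g x)) \<partial>lborel) < \<infinity>" using gint[of L] by simp
  qed simp
  have prim: "primitive_of g q" by (rule primitive_of_nonneg[OF ig g0 q0(1) gint])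
  \<comment> \<open>Half the width of the support: each flank takes length \<open>L\<close>, and the
    plateau takes 2 (a - L) = (w - 2 m) / h.\<close>
  define a where "a = L + (w - 2 * m) / (2 * h)"
  have aL: "L \<le> a" using m h by (simp add: a_def)
  \<comment> \<open>Equal to \<open>q (a - \<bar>y\<bar>)\<close>, because one of the two values of
    \<open>q\<close> is always \<open>h\<close>. The sum form consists of a translation, a
    reflection and an addition, under which primitives are stable.\<close>
  define \<psi> where "\<psi> y = q (a + y) + (q (a - y) - h)" for y
  define G where "G y = g (a + y) + - g (a - y)" for y
  have \<psi>eq: "\<psi> y = q (a - \<bar>y\<bar>)" for y
    using aL qL[of "a + y"] qL[of "a - y"] by (cases "y \<ge> 0") (auto simp: \<psi>_def)
  have Geq: "(G y)\<^sup>2 = (g (a - \<bar>y\<bar>))\<^sup>2" if "y \<noteq> 0" for y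
    using aL that by (cases "y \<ge> 0") (auto simp: G_def g_def)
  have lg1: "locally_integrable (\<lambda>y. g (a + y))"
    using lborel_integrable_real_affine[OF ig, of 1 a] by (intro locally_integrable_integrable) simp
  have lg2: "locally_integrable (\<lambda>y. - g (a - y))"
    using lborel_integrable_real_affine[OF ig, of "-1" a] by (intro locally_integrable_integrable) simp
  have "primitive_of (\<lambda>y. - g (a - y)) (\<lambda>y. q (a - y) - h)"
    using primitive_of_reflect[OF prim, of a] by (simp add: primitive_of_def)
  then have pG: "primitive_of G \<psi>"
    unfolding G_def \<psi>_def by (intro primitive_of_add lg1 lg2 primitive_of_translate prim)
  have lG: "locally_integrable G"
    using locally_integrable_diff[OF lg1, of "\<lambda>y. g (a - y)"] lborel_integrable_real_affine[OF ig, of "-1" a]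
    unfolding G_def by (simp add: locally_integrable_integrable)
  have wd: "weak_deriv \<psi> G" by (rule weak_deriv_primitive[OF lG pG])
  \<comment> \<open>\<open>E\<close> is a quantity along the profile, \<open>F\<close> the same
    quantity as a function of the height, and \<open>k\<close> its plateau value; this serves for
    the mass and for the energy.\<close>
  have reflect: "(\<integral>\<^sup>+ y. E (a - \<bar>y\<bar>) \<partial>lborel) = 2 * (\<integral>\<^sup>+ x. F x * (ennreal (1 / v x) * indicator {0<..<h} x) \<partial>lborel)
     + ennreal ((w - 2 * m) / h) * k"
    if [measurable]: "E \<in> borel_measurable borel" "F \<in> borel_measurable borel"
      and E: "\<And>t. t \<le> 0 \<Longrightarrow> E t = 0" "\<And>t. 0 < t \<Longrightarrow> t < L \<Longrightarrow> E t = F (q t)" "\<And>t. L \<le> t \<Longrightarrow> E t = k" for E F k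
  proof -
    have "(\<integral>\<^sup>+ t. E t * indicator {..<a} t \<partial>lborel) = (\<integral>\<^sup>+ t. F (q t) * indicator {0<..<L} t + k * indicator {L..<a} t \<partial>lborel)"
    proof (intro nn_integral_cong)
      fix t
      consider "t \<le> 0" | "0 < t" "t < L" | "L \<le> t" by linarith
      then show "E t * indicator {..<a} t = F (q t) * indicator {0<..<L} t + k * indicator {L..<a} t"
        using aL L E[of t] by cases (auto simp: indicator_def)
    qed
    also have "\<dots> = (\<integral>\<^sup>+ x. F x * (ennreal (1 / v x) * indicator {0<..<h} x) \<partial>lborel) + k * ennreal (a - L)"
      using aL by (simp add: nn_integral_add tr nn_integral_cmult)
    finally have "(\<integral>\<^sup>+ y. E (a - \<bar>y\<bar>) \<partial>lborel) = 2 * (\<integral>\<^sup>+ x. F x * (ennreal (1 / v x) * indicator {0<..<h} x) \<partial>lborel) + 2 * (k * ennreal (a - L))"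
      by (simp add: nn_integral_reflect distrib_left)
    also have "2 * (k * ennreal (a - L)) = (2 * ennreal (a - L)) * k" by (simp only: mult_ac)
    also have "2 * ennreal (a - L) = ennreal (2 * (a - L))" using aL by (simp add: ennreal_mult del: right_diff_distrib_numeral)
    also have "2 * (a - L) = (w - 2 * m) / h" using h by (simp add: a_def field_simps)
    finally show ?thesis .
  qed
  have w: "0 \<le> w" using m by simp
  have mass: "(\<integral>\<^sup>+ y. ennreal (\<psi> y) \<partial>lborel) = ennreal w"
  proof -
    have "(\<integral>\<^sup>+ y. ennreal (\<psi> y) \<partial>lborel) = 2 * (\<integral>\<^sup>+ x. ennreal (max 0 x) * (ennreal (1 / v x) * indicator {0<..<h} x) \<partial>lborel) + ennreal ((w - 2 * m) / h) * ennreal h"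
      unfolding \<psi>eq by (rule reflect) (auto simp: qneg qL q0 max_def)
    also have "(\<integral>\<^sup>+ x. ennreal (max 0 x) * (ennreal (1 / v x) * indicator {0<..<h} x) \<partial>lborel) = (\<integral>\<^sup>+ x. ennreal (x / v x) * indicator {0<..<h} x \<partial>lborel)"
      using v by (intro nn_integral_cong) (auto simp: indicator_def max_def ennreal_mult'[symmetric])
    also have "2 * \<dots> + ennreal ((w - 2 * m) / h) * ennreal h = ennreal (2 * m) + ennreal (w - 2 * m)"
      using m h by (simp add: ennreal_mult[symmetric] ennreal_mult)
    also have "\<dots> = ennreal w" using m by (simp add: ennreal_plus[symmetric] del: ennreal_plus)
    finally show ?thesis .
  qed
  have \<psi>0: "0 \<le> \<psi> y" for y by (simp add: \<psi>eq q0)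
  have [measurable]: "\<psi> \<in> borel_measurable borel" unfolding \<psi>_def by measurable
  show thesis
  proof (rule that[of \<psi>])
    show int: "integrable lborel \<psi>"
      by (rule integrableI_nonneg) (auto simp: \<psi>0 mass)
    show "(\<integral>y. \<psi> y \<partial>lborel) = w"
      using nn_integral_eq_integral[OF int] \<psi>0 mass w by (simp add: integral_nonneg_AE)
    have "energy c \<psi> = (\<integral>\<^sup>+ y. ennreal ((1/2) * (G y)\<^sup>2 + c \<bar>\<psi> y\<bar>) \<partial>lborel)" by (rule energy_eq[OF wd])
    also have "\<dots> = (\<integral>\<^sup>+ y. ennreal ((1/2) * (g (a - \<bar>y\<bar>))\<^sup>2 + c (q (a - \<bar>y\<bar>))) \<partial>lborel)"
    proof (intro nn_integral_cong_AE)
      show "AE y in lborel. ennreal ((1/2) * (G y)\<^sup>2 + c \<bar>\<psi> y\<bar>) = ennreal ((1/2) * (g (a - \<bar>y\<bar>))\<^sup>2 + c (q (a - \<bar>y\<bar>)))"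
        using AE_lborel_singleton[of 0]
      proof eventually_elim
        fix y :: real assume "y \<noteq> 0"
        moreover have "\<bar>\<psi> y\<bar> = q (a - \<bar>y\<bar>)" using \<psi>0[of y] \<psi>eq[of y] by simp
        ultimately show "ennreal ((1/2) * (G y)\<^sup>2 + c \<bar>\<psi> y\<bar>) = ennreal ((1/2) * (g (a - \<bar>y\<bar>))\<^sup>2 + c (q (a - \<bar>y\<bar>)))"
          by (simp add: Geq)
      qed
    qed
    also have "\<dots> = 2 * (\<integral>\<^sup>+ x. ennreal ((1/2) * (max 0 (v x))\<^sup>2 + c x) * (ennreal (1 / v x) * indicator {0<..<h} x) \<partial>lborel)
       + ennreal ((w - 2 * m) / h) * ennreal (c h)"
      by (rule reflect) (use L in \<open>auto simp: qneg qL g_def c\<close>)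
    also have "(\<integral>\<^sup>+ x. ennreal ((1/2) * (max 0 (v x))\<^sup>2 + c x) * (ennreal (1 / v x) * indicator {0<..<h} x) \<partial>lborel)
       = (\<integral>\<^sup>+ x. ennreal (v x / 2 + c x / v x) * indicator {0<..<h} x \<partial>lborel)"
    proof (intro nn_integral_cong)
      fix x
      show "ennreal ((1/2) * (max 0 (v x))\<^sup>2 + c x) * (ennreal (1 / v x) * indicator {0<..<h} x) = ennreal (v x / 2 + c x / v x) * indicator {0<..<h} x"
      proof (cases "0 < x \<and> x < h")
        case True
        then have vx: "0 < v x" "0 \<le> c x" using v c by auto
        then have "ennreal ((1/2) * (max 0 (v x))\<^sup>2 + c x) * ennreal (1 / v x) = ennreal (((1/2) * (v x)\<^sup>2 + c x) * (1 / v x))"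
          by (simp add: ennreal_mult[symmetric] max_def del: ennreal_plus)
        also have "((1/2) * (v x)\<^sup>2 + c x) * (1 / v x) = v x / 2 + c x / v x"
          using vx by (simp add: field_simps power2_eq_square)
        finally show ?thesis using True by simp
      qed (auto simp: indicator_def)
    qed
    also have "ennreal ((w - 2 * m) / h) * ennreal (c h) = ennreal ((w - 2 * m) * (c h / h))"
      using m h c(2)[of h] by (simp add: ennreal_mult[symmetric])
    finally show "energy c \<psi> = 2 * (\<integral>\<^sup>+ x. ennreal (v x / 2 + c x / v x) * indicator {0<..<h} x \<partial>lborel) + ennreal ((w - 2 * m) * (c h / h))" .
  qed
qed

section \<open>Upper bound on the energy\<close>

context cost_density
begin

text \<open>Here \<open>z \<le> p w + d\<close> at every positive height, and the height used in the
  general case would be zero. A low plateau with flanks of unit slope does instead: its energy is at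
  most \<open>h + (p w + d) * w\<close>, and \<open>p w * w \<le> \<tau> w\<close>.\<close>

lemma energy_upper_bound_linear:
  assumes w: "0 < w" and d: "0 < d" and N0: "N (p w + d) = 0"
  obtains \<psi> where "integrable lborel \<psi>" "(\<integral>y. \<psi> y \<partial>lborel) = w"
    "energy (\<lambda>x. x * z x) \<psi> \<le> ennreal (\<tau> w + d * (w + 1))"
proof -
  define s where "s = p w + d"
  have s: "0 < s" using d p_nonneg[of w] by (simp add: s_def)
  have zs: "z x \<le> s" if "0 < x" for x using z_le_iff[OF that, of s] s N0 by (simp add: s_def)
  \<comment> \<open>At most \<open>d\<close> to make the flanks cheap, and at most
    \<open>sqrt w\<close> so that their total mass h^2 does not exceed \<open>w\<close>.\<close>
  define h where "h = min d (sqrt w)"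
  have h: "0 < h" "h \<le> d" "h\<^sup>2 \<le> w"
  proof -
    show "0 < h" "h \<le> d" using w d by (auto simp: h_def)
    have "h\<^sup>2 \<le> (sqrt w)\<^sup>2" using w d by (intro power_mono) (auto simp: h_def)
    then show "h\<^sup>2 \<le> w" using w by simp
  qed
  have len: "(\<integral>\<^sup>+ x. ennreal k * indicator {0<..<h} x \<partial>lborel) = ennreal (k * h)" if "0 \<le> k" for k
    using h that by (simp add: nn_integral_cmult ennreal_mult)
  have mass: "(\<integral>\<^sup>+ x. ennreal (x * k) * indicator {0<..<h} x \<partial>lborel) = ennreal (h\<^sup>2 / 2 * k)" if "0 \<le> k" for k
  proof -
    have "(\<integral>\<^sup>+ x. ennreal (x * k) * indicator {0<..<h} x \<partial>lborel) = (\<integral>\<^sup>+ x. ennreal (x powr 1 * k) * indicator {0..h} x \<partial>lborel)"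
    proof (intro nn_integral_cong_AE)
      show "AE x in lborel. ennreal (x * k) * indicator {0<..<h} x = ennreal (x powr 1 * k) * indicator {0..h} x"
        using AE_lborel_singleton[of 0] AE_lborel_singleton[of h] by eventually_elim (auto simp: indicator_def)
    qed
    also have "\<dots> = ennreal (h powr (1 + 1) / (1 + 1) * k)"
      using h that by (intro nn_integral_has_integral_lebesgue' has_integral_mult_left has_integral_powr_from_0) auto
    also have "h powr (1 + 1) = h\<^sup>2" using h by (simp add: powr_numeral)
    finally show ?thesis by simp
  qed
  show thesis
  proof (rule profile_with_plateau[of "\<lambda>_. 1" "\<lambda>x. x * z x" h "h\<^sup>2 / 2" w])
    show "(\<integral>\<^sup>+ x. ennreal (1 / 1) * indicator {0<..<h} x \<partial>lborel) < \<infinity>" using len[of 1] by simp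
    show "(\<integral>\<^sup>+ x. ennreal (x / 1) * indicator {0<..<h} x \<partial>lborel) = ennreal (h\<^sup>2 / 2)" using mass[of 1] by simp
    fix \<psi>
    assume \<psi>: "integrable lborel \<psi>" "(\<integral>y. \<psi> y \<partial>lborel) = w"
      and e: "energy (\<lambda>x. x * z x) \<psi> = 2 * (\<integral>\<^sup>+ x. ennreal (1 / 2 + x * z x / 1) * indicator {0<..<h} x \<partial>lborel)
        + ennreal ((w - 2 * (h\<^sup>2 / 2)) * (h * z h / h))"
    have "(\<integral>\<^sup>+ x. ennreal (1 / 2 + x * z x / 1) * indicator {0<..<h} x \<partial>lborel)
      \<le> (\<integral>\<^sup>+ x. ennreal (1 / 2) * indicator {0<..<h} x + ennreal (x * s) * indicator {0<..<h} x \<partial>lborel)"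
    proof (intro nn_integral_mono)
      fix x
      have *: "ennreal (1 / 2 + x * z x / 1) \<le> ennreal (1 / 2) + ennreal (x * s)" if "0 < x"
      proof -
        have "1 / 2 + x * z x / 1 \<le> 1 / 2 + x * s" using zs[OF that] that by simp
        then have "ennreal (1 / 2 + x * z x / 1) \<le> ennreal (1 / 2 + x * s)" by (rule ennreal_leI)
        also have "\<dots> = ennreal (1 / 2) + ennreal (x * s)" using that s by (intro ennreal_plus) auto
        finally show ?thesis .
      qed
      show "ennreal (1 / 2 + x * z x / 1) * indicator {0<..<h} x \<le> ennreal (1 / 2) * indicator {0<..<h} x + ennreal (x * s) * indicator {0<..<h} x"
        using * by (cases "0 < x \<and> x < h") (auto simp: indicator_def)
    qed
    also have "\<dots> = ennreal (1 / 2 * h) + ennreal (h\<^sup>2 / 2 * s)"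
      using len[of "1/2"] mass[of s] s by (simp add: nn_integral_add)
    also have "\<dots> = ennreal (h / 2 + h\<^sup>2 / 2 * s)" using h s by (simp add: ennreal_plus[symmetric] del: ennreal_plus)
    finally have "energy (\<lambda>x. x * z x) \<psi> \<le> 2 * ennreal (h / 2 + h\<^sup>2 / 2 * s) + ennreal ((w - 2 * (h\<^sup>2 / 2)) * (h * z h / h))"
      unfolding e by (intro add_mono mult_left_mono) auto
    also have "\<dots> \<le> ennreal (2 * (h / 2 + h\<^sup>2 / 2 * s)) + ennreal ((w - h\<^sup>2) * s)"
      using h s zs[of h] by (intro add_mono ennreal_leI) (auto simp: ennreal_mult simp del: distrib_left_numeral intro: mult_left_mono)
    also have "\<dots> = ennreal (h + w * s)"
      using h s by (subst ennreal_plus[symmetric]) (auto simp: algebra_simps simp del: ennreal_plus)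
    also have "\<dots> \<le> ennreal (\<tau> w + d * (w + 1))"
    proof (rule ennreal_leI)
      have "ennreal (p w * w) \<le> ennreal (\<tau> w)" using G_at_density[OF w] by (metis le_iff_add add.commute)
      then have "p w * w \<le> \<tau> w" using \<tau>_nonneg[of w] w by simp
      then show "h + w * s \<le> \<tau> w + d * (w + 1)" using h by (simp add: s_def algebra_simps)
    qed
    finally show thesis using that \<psi> by blast
  qed (use h z_nonneg in auto)
qed

text \<open>Stopping where \<open>z\<close> has fallen to \<open>l + d\<close> keeps
  \<open>v\<close> above sqrt(2 d x), so each flank has finite length. With flank mass
  \<open>m\<close> the energy is at most G(l) + 2 l m + (w - 2 m)(l + d), hence at most G(l) + l w +
  d w = \<tau>(w) + d w by the choice of \<open>l\<close>.\<close>

lemma energy_upper_bound: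
  assumes w: "0 < w" and d: "0 < d"
  obtains \<psi> where "integrable lborel \<psi>" "(\<integral>y. \<psi> y \<partial>lborel) = w"
    "energy (\<lambda>x. x * z x) \<psi> \<le> ennreal (\<tau> w + d * (w + 1))"
proof (cases "N (p w + d) = 0")
  case True
  show thesis by (rule energy_upper_bound_linear[OF w d True]) (rule that)
next
  case False
  define l where "l = p w"
  define s where "s = l + d"
  have l: "0 \<le> l" and s: "0 < s" using d p_nonneg[of w] by (auto simp: s_def l_def)
  have "N s \<le> ennreal (K * \<tau> w / sqrt s)" using w d s by (intro N_bound) (auto simp: s_def l_def)
  then obtain n where n: "N s = ennreal n" "0 \<le> n"
    by (cases "N s") (auto simp: top_unique)
  then have n0: "0 < n" using False by (cases "n = 0") (auto simp: s_def l_def)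
  \<comment> \<open>The height with h^(3/2) = N s: below it \<open>z > s\<close>, and at it
    \<open>z\<close> is at most \<open>s\<close>.\<close>
  define h where "h = n powr (2/3)"
  have h: "0 < h" "h powr (3/2) = n" using n0 by (auto simp: h_def powr_powr)
  have zh: "z h \<le> s" using z_le_iff[of h s] h s n by simp
  have zbelow: "s < z x" if "0 < x" "x < h" for x
  proof -
    have "x powr (3/2) < n" using powr_less_mono2[of "3/2" x h] that h by simp
    then show ?thesis using z_le_iff[of x s] that s n by (auto simp: not_le[symmetric])
  qed
  define v where "v x = sqrt 2 * (sqrtp x * sqrtp (z x - l))" for x
  have [measurable]: "v \<in> borel_measurable borel" unfolding v_def by measurable
  have v2: "(v x)\<^sup>2 = 2 * x * (z x - l)" and vpos: "0 < v x" and vlow: "sqrt (2 * d) * sqrt x \<le> v x" if "0 < x" "x < h" for x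
  proof -
    have zx: "d < z x - l" using zbelow[OF that] by (simp add: s_def)
    then show "(v x)\<^sup>2 = 2 * x * (z x - l)" "0 < v x"
      using that d by (auto simp: v_def sqrtp_def max_def power_mult_distrib)
    have "sqrt (2 * d) * sqrt x = sqrt 2 * (sqrt x * sqrt d)" by (simp add: real_sqrt_mult)
    also have "\<dots> \<le> v x" unfolding v_def using that zx d by (intro mult_left_mono) (auto simp: sqrtp_def max_def)
    finally show "sqrt (2 * d) * sqrt x \<le> v x" .
  qed
  have v0: "0 \<le> v x" for x by (simp add: v_def)
  have Gv: "G l = (\<integral>\<^sup>+ x. ennreal (2 * v x) \<partial>lborel)"
    using abel_identity[OF l] by (simp add: v_def mult.assoc)
  have Gfin: "G l \<le> ennreal (\<tau> w)" using G_at_density[OF w] unfolding l_def by (metis le_iff_add)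
  define M where "M = (\<integral>\<^sup>+ x. ennreal (x / v x) * indicator {0<..<h} x \<partial>lborel)"
  \<comment> \<open>Concavity of the square root bounds the mass of the profile by a difference quotient of \<open>G\<close>.\<close>
  have "G s + ennreal (2 * d) * M \<le> G l"
  proof -
    have "G s + ennreal (2 * d) * M = (\<integral>\<^sup>+ x. ennreal (2 * sqrt 2 * (sqrtp x * sqrtp (z x - s))) + ennreal (2 * d) * (ennreal (x / v x) * indicator {0<..<h} x) \<partial>lborel)"
      using abel_identity[of s] s by (simp add: M_def nn_integral_add nn_integral_cmult)
    also have "\<dots> \<le> G l"
      unfolding Gv
    proof (intro nn_integral_mono)
      fix x
      define b where "b = sqrt 2 * (sqrtp x * sqrtp (z x - s))"
      have b0: "0 \<le> b" by (simp add: b_def)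
      have "ennreal (2 * b) + ennreal (2 * d) * (ennreal (x / v x) * indicator {0<..<h} x) \<le> ennreal (2 * v x)"
      proof (cases "0 < x \<and> x < h")
        case True
        then have x: "0 < x" "x < h" by auto
        have "b\<^sup>2 = 2 * x * (z x - s)"
          using x zbelow[OF x] by (auto simp: b_def sqrtp_def max_def power_mult_distrib)
        \<comment> \<open>Since v^2 - b^2 = 2 d x, this square gives the tangent bound v - b \<ge> d
          x / v.\<close>
        moreover have "0 \<le> (v x - b)\<^sup>2" by simp
        ultimately have "2 * b * v x + 2 * d * x \<le> 2 * (v x)\<^sup>2"
          using v2[OF x] by (simp add: power2_diff s_def algebra_simps)
        then have "2 * b + 2 * d * (x / v x) \<le> 2 * v x"
          using vpos[OF x] by (simp add: field_simps power2_eq_square)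
        then show ?thesis using x vpos[OF x] d b0
          by (simp add: ennreal_mult[symmetric] ennreal_plus[symmetric] del: ennreal_plus)
      next
        case False
        have "b \<le> v x" unfolding b_def v_def using d by (intro mult_left_mono sqrtp_mono) (auto simp: s_def)
        then show ?thesis using False by (auto simp: indicator_def intro: ennreal_leI)
      qed
      then show "ennreal (2 * sqrt 2 * (sqrtp x * sqrtp (z x - s))) + ennreal (2 * d) * (ennreal (x / v x) * indicator {0<..<h} x) \<le> ennreal (2 * v x)"
        by (simp add: b_def mult.assoc)
    qed
    finally show ?thesis .
  qed
  moreover have "G l \<le> G s + ennreal (d * w)" unfolding s_def by (rule G_diff_le) (use w d in \<open>auto simp: l_def\<close>)
  ultimately have "G s + ennreal (2 * d) * M \<le> G s + ennreal (d * w)" and "G s \<le> G l"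
    by (auto intro: order_trans simp: le_iff_add add.assoc) 
  \<comment> \<open>\<open>G s\<close> is at most \<open>G l\<close>, hence finite, and
    cancels.\<close>
  then have dM: "ennreal (2 * d) * M \<le> ennreal (d * w)"
    using Gfin by (auto simp: top_unique ennreal_add_left_cancel_le dest: order_trans)
  then obtain m where m: "M = ennreal m" "0 \<le> m"
    using d by (cases M) (auto simp: ennreal_mult_top top_unique)
  then have "2 * d * m \<le> d * w" using dM d w by (simp add: ennreal_mult[symmetric])
  then have mw: "2 * m \<le> w" using d by simp
  show thesis
  proof (rule profile_with_plateau[of v "\<lambda>x. x * z x" h m w])
    have "(\<integral>\<^sup>+ x. ennreal (1 / v x) * indicator {0<..<h} x \<partial>lborel) \<le> (\<integral>\<^sup>+ x. ennreal (2 / sqrt (2 * d)) * kern x h \<partial>lborel)"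
    proof (intro nn_integral_mono)
      fix x
      show "ennreal (1 / v x) * indicator {0<..<h} x \<le> ennreal (2 / sqrt (2 * d)) * kern x h"
      proof (cases "0 < x \<and> x < h")
        case True
        then have "1 / v x \<le> 1 / (sqrt (2 * d) * sqrt x)" using vlow[of x] vpos[of x] d by (intro divide_left_mono) auto
        also have "\<dots> = 2 / sqrt (2 * d) * (1 / (2 * sqrt x))" by simp
        finally show ?thesis using True d by (auto simp: kern_def ennreal_mult[symmetric] intro: ennreal_leI)
      qed auto
    qed
    also have "\<dots> < \<infinity>" by (simp add: nn_integral_cmult nn_integral_kern ennreal_mult_less_top)
    finally show "(\<integral>\<^sup>+ x. ennreal (1 / v x) * indicator {0<..<h} x \<partial>lborel) < \<infinity>" .
    fix \<psi>
    assume \<psi>: "integrable lborel \<psi>" "(\<integral>y. \<psi> y \<partial>lborel) = w"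
      and e: "energy (\<lambda>x. x * z x) \<psi> = 2 * (\<integral>\<^sup>+ x. ennreal (v x / 2 + x * z x / v x) * indicator {0<..<h} x \<partial>lborel)
        + ennreal ((w - 2 * m) * (h * z h / h))"
    have "2 * (\<integral>\<^sup>+ x. ennreal (v x / 2 + x * z x / v x) * indicator {0<..<h} x \<partial>lborel)
      = (\<integral>\<^sup>+ x. 2 * (ennreal (v x / 2 + x * z x / v x) * indicator {0<..<h} x) \<partial>lborel)"
      by (intro nn_integral_cmult[symmetric]) measurable
    also have "\<dots> \<le> (\<integral>\<^sup>+ x. ennreal (2 * v x) + ennreal (2 * l) * (ennreal (x / v x) * indicator {0<..<h} x) \<partial>lborel)"
    proof (intro nn_integral_mono)
      fix x
      show "2 * (ennreal (v x / 2 + x * z x / v x) * indicator {0<..<h} x) \<le> ennreal (2 * v x) + ennreal (2 * l) * (ennreal (x / v x) * indicator {0<..<h} x)"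
      proof (cases "0 < x \<and> x < h")
        case True
        then have x: "0 < x" "x < h" by auto
        have "2 * (v x / 2 + x * z x / v x) = 2 * v x + 2 * l * (x / v x)"
        proof -
          have "x * z x = (v x)\<^sup>2 / 2 + l * x" using v2[OF x] by (simp add: algebra_simps)
          then show ?thesis using vpos[OF x] by (simp add: add_divide_distrib power2_eq_square)
        qed
        moreover have "2 * ennreal (v x / 2 + x * z x / v x) = ennreal (2 * (v x / 2 + x * z x / v x))"
          using vpos[OF x] z_nonneg[of x] x by (simp add: ennreal_mult del: distrib_left_numeral)
        moreover have "ennreal (2 * v x + 2 * l * (x / v x)) = ennreal (2 * v x) + ennreal (2 * l) * ennreal (x / v x)"
          using vpos[OF x] l x by (subst ennreal_plus) (auto simp flip: ennreal_mult)
        ultimately show ?thesis using x by simp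
      qed auto
    qed
    also have "\<dots> = G l + ennreal (2 * l) * M"
      by (simp add: Gv M_def nn_integral_add nn_integral_cmult)
    finally have "energy (\<lambda>x. x * z x) \<psi> \<le> G l + ennreal (2 * l) * M + ennreal ((w - 2 * m) * (h * z h / h))"
      unfolding e by (intro add_mono) auto
    also have "\<dots> \<le> G l + ennreal (2 * l) * M + ennreal ((w - 2 * m) * s)"
      using h zh mw by (intro add_mono ennreal_leI mult_left_mono) auto
    also have "\<dots> = G l + ennreal (2 * l * m + (w - 2 * m) * s)"
      using m l mw s by (simp add: ennreal_mult[symmetric] add.assoc)
    also have "\<dots> \<le> G l + ennreal (l * w + d * w)"
      using m d mult_nonneg_nonneg[of d m] by (intro add_left_mono ennreal_leI) (simp add: s_def algebra_simps)
    also have "\<dots> = ennreal (\<tau> w) + ennreal (d * w)"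
      using G_at_density[OF w] l d w by (simp add: l_def add.assoc[symmetric])
    also have "\<dots> \<le> ennreal (\<tau> w + d * (w + 1))"
      using \<tau>_nonneg[of w] w d by (subst ennreal_plus[symmetric]) (auto intro!: ennreal_leI simp: algebra_simps simp del: ennreal_plus)
    finally show thesis using that \<psi> by blast
  qed (use h m mw vpos z_nonneg in \<open>auto simp: M_def[symmetric]\<close>)
qed

lemma cost_eq_energy_inf:
  assumes "0 \<le> w"
  shows "ennreal (\<tau> w) = (INF \<psi> \<in> {\<psi>. integrable lborel \<psi> \<and> (\<integral>y. \<psi> y \<partial>lborel) = w}. energy (\<lambda>x. x * z x) \<psi>)"
    (is "_ = ?I")
proof (rule antisym)
  show "ennreal (\<tau> w) \<le> ?I" using assms by (intro INF_greatest) (auto intro: energy_lower_bound)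
  show "?I \<le> ennreal (\<tau> w)"
  proof (cases "w = 0")
    case True
    have "weak_deriv (\<lambda>_. 0) (\<lambda>_. 0)"
      by (auto simp: weak_deriv_def locally_integrable_def set_integrable_def)
    then have "energy (\<lambda>x. x * z x) (\<lambda>_. 0) = 0" by (simp add: energy_eq)
    moreover have "?I \<le> energy (\<lambda>x. x * z x) (\<lambda>_. 0)" using True by (intro INF_lower) auto
    ultimately show ?thesis by simp
  next
    case False
    then have w: "0 < w" using assms by simp
    show ?thesis
    proof (rule ennreal_le_epsilon)
      fix e :: real assume e: "0 < e"
      obtain \<psi> where \<psi>: "integrable lborel \<psi>" "(\<integral>y. \<psi> y \<partial>lborel) = w"
        "energy (\<lambda>x. x * z x) \<psi> \<le> ennreal (\<tau> w + e / (w + 1) * (w + 1))"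
        by (rule energy_upper_bound[OF w, of "e / (w + 1)"]) (use e w in auto)
      have "?I \<le> energy (\<lambda>x. x * z x) \<psi>" using \<psi> by (intro INF_lower) auto
      also have "\<dots> \<le> ennreal (\<tau> w + e)" using \<psi>(3) w by simp
      finally show "?I \<le> ennreal (\<tau> w) + ennreal e" using \<tau>_nonneg[of w] w e by simp
    qed
  qed
qed

end

theorem mainTheorem5:
  fixes \<tau> :: "real \<Rightarrow> real"
  assumes "admissible_cost \<tau>"
  shows "\<exists>c :: real \<Rightarrow> real. (\<forall>s\<ge>0. c s \<ge> 0) \<and>
           (\<forall>w\<ge>0. ennreal (\<tau> w) =
              (INF \<psi> \<in> {\<psi>. integrable lborel \<psi> \<and> (\<integral>y. \<psi> y \<partial>lborel) = w}. energy c \<psi>)) \<and>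
           lsc_on {0<..} (\<lambda>s. c s / s) \<and> antimono_on {0<..} (\<lambda>s. c s / s)"
proof -
  obtain p where "cost_density \<tau> p" by (rule admissible_cost_density[OF assms])
  then interpret cost_density \<tau> p .
  have eq: "x * z x / x = z x" if "x \<in> {0<..}" for x using that by simp
  show ?thesis
  proof (intro exI[of _ "\<lambda>x. x * z x"] conjI allI impI)
    show "0 \<le> s * z s" if "0 \<le> s" for s using that z_nonneg by simp
    show "lsc_on {0<..} (\<lambda>s. s * z s / s)"
      using z_lsc unfolding lsc_on_def by (simp add: eq)
    show "antimono_on {0<..} (\<lambda>s. s * z s / s)"
      by (auto simp: monotone_on_def intro: z_antimono)
  qed (rule cost_eq_energy_inf)
qed

end
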